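(* Let $\sigma:\overline{\Omega}\times\mathrm{Psym}_n\to[0,\infty)$ satisfy the hypotheses (1)--(3) listed in the context, and let $\mathbf{d}=\mathbf{id}$ on $\mathcal{D}$. Suppose that $\mathbf{u}_e=\mathbf{id}$ (i.e. $\mathbf{u}_e(\mathbf{x})=\mathbf{x}$) is a weak solution of the equilibrium equations that satisfies, for some $k>0$, every $\mathbf{P}\in L^2(\Omega;\mathrm{Sym}_n)$, every $\mathbf{a}\in\mathbb{R}^n$, and almost every $\mathbf{x}\in\Omega$, $$\int_\Omega\mathbf{P}(\mathbf{x}):\mathbb{C}(\mathbf{x},\mathbf{I})[\mathbf{P}(\mathbf{x})]\,d\mathbf{x}\ge16k\int_\Omega|\mathbf{P}(\mathbf{x})|^2\,d\mathbf{x},\qquad \mathbf{a}\cdot\mathbf{K}(\mathbf{x},\mathbf{I})\mathbf{a}\ge-2kC_M|\mathbf{a}|^2,$$ where $C_M$ is the constant defined in the context. Fix $X>\sqrt{n}$. Then there exists $\delta=\delta(X)>0$ such that any $\mathbf{v}\in\mathrm{AD}$ that satisfies $\mathbf{v}\ne\mathbf{id}$ and, with $\mathbf{C}_{\mathbf v}:=(\nabla\mathbf{v})^{\mathrm T}\nabla\mathbf{v}$, $$[\mathbf{C}_{\mathbf v}]_{\mathrm{BMO}(\Omega)}+\Big|\frac1{|\Omega|}\int_\Omega[\mathbf{C}_{\mathbf v}-\mathbf{I}]\,d\mathbf{x}\Big|<\delta,\qquad\|\mathbf{C}_{\mathbf v}\|_{\infty,\Omega}<X,\qquad\det\nabla\mathbf{v}>X^{-1}\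 \text{a.e.},$$ has strictly greater energy than $\mathbf{id}$, i.e. $\mathcal{E}(\mathbf{v})>\mathcal{E}(\mathbf{id})$. Moreover, if in addition, for almost every $\mathbf{x}\in\Omega$ and every $\mathbf{a}\in\mathbb{R}^n$, $$\mathbf{a}\cdot\Big[\mathbf{K}(\mathbf{x},\mathbf{I})+\mathbf{K}\big(\mathbf{x},\mathbf{C}_{\mathbf v}(\mathbf{x})\big)\Big]\mathbf{a}\ge-3kC_M|\mathbf{a}|^2,$$ then $\mathbf{v}$ is not a weak solution of the equilibrium equations. In particular if, for a.e. $\mathbf{x}\in\Omega$, $\mathbf{K}(\mathbf{x},\mathbf{I})$ and $\mathbf{K}(\mathbf{x},\mathbf{C}_{\mathbf v}(\mathbf{x}))$ are positive semidefinite, then $\mathbf{v}$ is not a weak solution of the equilibrium equations.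
   Context: Matrices. $n\in\{2,3\}$. $\mathbb{M}^{n\times n}$ is the space of real $n\times n$ matrices with $\mathbf{H}:\mathbf{L}=\mathrm{trace}(\mathbf{H}\mathbf{L}^{\mathrm T})$ and $|\mathbf{H}|=\sqrt{\mathbf{H}:\mathbf{H}}$; $\mathbf{I}$ is the identity matrix; $\mathrm{Sym}_n$ and $\mathrm{Psym}_n$ are the symmetric and the symmetric positive-definite matrices. Body and data. $\Omega\subset\mathbb{R}^n$ is a bounded Lipschitz domain (nonempty, connected, open, with strongly Lipschitz boundary). $\partial\Omega=\overline{\mathcal{D}}\cup\overline{\mathcal{S}}$ with $\mathcal{D},\mathcal{S}$ relatively open, $\mathcal{D}\cap\mathcal{S}=\varnothing$, $\mathcal{D}\neq\varnothing$. The boundary deformation is $\mathbf{d}=\mathbf{id}$ on $\mathcal{D}$; $\mathbf{s}\in L^2(\mathcal{S};\mathbb{R}^n)$ (if $\mathcal{S}\ne\varnothing$) and $\mathbf{b}\in L^2(\Omega;\mathbb{R}^n)$ are prescribed. The reference configuration is not required to be stress free. Set $$\mathrm{AD}:=\{\mathbf{u}\in W^{1,\infty}(\Omega;\mathbb{R}^n):\det\nabla\mathbf{u}>0\text{ a.e.},\ \mathbf{u}=\mathbf{d}\text{ on }\mathcal{D}\},\quad \mathrm{Var}:=\{\mathbf{w}\in W^{1,2}(\Omega;\mathbb{R}^n):\mathbf{w}=\mathbf{0}\text{ on }\mathcal{D}\}.$$ For a deformation $\mathbf{u}$, $\mathbf{C}_{\mathbf u}:=(\nabla\mathbf{u})^{\mathrm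 T}\nabla\mathbf{u}$. Hypotheses on the stored-energy density $\sigma:\overline{\Omega}\times\mathrm{Psym}_n\to[0,\infty)$: (1) $\mathbf{C}\mapsto\sigma(\mathbf{x},\mathbf{C})\in C^3(\mathrm{Psym}_n)$ for a.e. $\mathbf{x}\in\Omega$; (2) $(\mathbf{x},\mathbf{C})\mapsto \mathrm{D}^k\sigma(\mathbf{x},\mathbf{C})$, $k=0,1,2,3$, are Lebesgue measurable on $\Omega\times\mathrm{Psym}_n$; (3) $\mathrm{D}^k\sigma$, $k=0,1,2,3$, are bounded on $\overline{\Omega}\times K$ for every nonempty compact $K\subset\mathrm{Psym}_n$. Here $\mathrm{D}^k\sigma$ is the $k$-th derivative with respect to $\mathbf{C}$; $\mathrm{D}\sigma$ takes values in $\mathrm{Sym}_n$ and $\mathrm{D}^2\sigma$ in the linear maps $\mathrm{Sym}_n\to\mathrm{Sym}_n$. Stress and elasticity tensors: $\mathbf{K}(\mathbf{x},\mathbf{C}):=2\mathrm{D}\sigma(\mathbf{x},\mathbf{C})$, $\mathbf{S}(\mathbf{x},\mathbf{F}):=\mathbf{F}\mathbf{K}(\mathbf{x},\mathbf{F}^{\mathrm T}\mathbf{F})$ for $\det\mathbf{F}>0$, $\mathbb{C}(\mathbf{x},\mathbf{C}):=4\mathrm{D}^2\sigma(\mathbf{x},\mathbf{C})$. Energy: for $\mathbf{u}\in\mathrm{AD}$, $\mathcal{E}(\mathbf{u}):=\int_\Omega[\sigma(\mathbf{x},\mathbf{C}_{\mathbf u}(\mathbf{x}))-\mathbf{b}\cdot\mathbf{u}]\,d\mathbf{x}-\int_{\mathcal{S}}\mathbf{s}\cdot\mathbf{u}\,d\mathcal{H}^{n-1}$.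 Weak solution of the equilibrium equations: $\mathbf{u}\in\mathrm{AD}$ with $\int_\Omega[\mathbf{S}(\mathbf{x},\nabla\mathbf{u}(\mathbf{x})):\nabla\mathbf{w}-\mathbf{b}\cdot\mathbf{w}]\,d\mathbf{x}-\int_{\mathcal{S}}\mathbf{s}\cdot\mathbf{w}\,d\mathcal{H}^{n-1}=0$ for all $\mathbf{w}\in\mathrm{Var}$. BMO-seminorm (for matrix-valued $\psi\in L^1_{\mathrm{loc}}(\Omega)$): $[\psi]_{\mathrm{BMO}(\Omega)}:=\sup_{Q\subset\subset\Omega}\frac1{|Q|}\int_Q|\psi-\langle\psi\rangle_Q|\,d\mathbf{x}$, $\langle\psi\rangle_Q:=\frac1{|Q|}\int_Q\psi\,d\mathbf{x}$, the supremum being over nonempty bounded open cubes $Q$ with faces parallel to the coordinate hyperplanes and contained in a compact subset of $\Omega$. The constant $C_M>0$ (depending on $\Omega,\mathcal{D}$) denotes a constant such that $$\int_\Omega|\mathbf{C}_{\mathbf u}-\mathbf{I}|^2\,d\mathbf{x}\ge C_M\,\|\mathbf{u}-\mathbf{id}\|_{W^{1,2}(\Omega)}^2$$ for all $\mathbf{u}\in W^{1,4}(\Omega;\mathbb{R}^n)$ with $\det\nabla\mathbf{u}>0$ a.e. in $\Omega$ and $\mathbf{u}=\mathbf{id}$ on $\mathcal{D}$, where $\|\mathbf{w}\|_{W^{1,2}(\Omega)}^2=\int_\Omega|\mathbf{w}|^2\,d\mathbf{x}+\int_\Omega|\nabla\mathbf{w}|^2\,d\mathbf{x}$. Such a constant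 exists by a known theorem of Ciarlet and Mardare. *)

theory Defs
  imports "HOL-Analysis.Analysis" "HOL-Probability.Essential_Supremum"
begin

(* Throughout, H : L is the inner product and |H| the norm of real^'n^'n; both are the
   Frobenius ones in HOL-Analysis. *)

section \<open>Lipschitz domains and surface measure\<close>

(* Near each boundary point the domain is the part of a ball lying strictly on one side of the
   graph, in direction e, of a Lipschitz function of the coordinates orthogonal to e. *)
definition strongly_lipschitz_boundary :: "(real^'n) set \<Rightarrow> bool" where
  "strongly_lipschitz_boundary \<Omega> \<longleftrightarrow>
     (\<forall>x\<in>frontier \<Omega>. \<exists>e g L r. norm e = 1 \<and> r > 0 \<and> L-lipschitz_on {z. z \<bullet> e = 0} g \<and>
        (\<forall>y\<in>ball x r. y \<in> \<Omega> \<longleftrightarrow> g (y - (y \<bullet> e) *\<^sub>R e) < y \<bullet> e))"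

definition lipschitz_domain :: "(real^'n) set \<Rightarrow> bool" where
  "lipschitz_domain \<Omega> \<longleftrightarrow> \<Omega> \<noteq> {} \<and> bounded \<Omega> \<and> open \<Omega> \<and> connected \<Omega> \<and>
     strongly_lipschitz_boundary \<Omega>"

definition hausdorff_content :: "nat \<Rightarrow> real \<Rightarrow> 'a::metric_space set \<Rightarrow> ennreal" where
  "hausdorff_content m \<delta> A =
     (INF C\<in>{C :: nat \<Rightarrow> 'a set. A \<subseteq> (\<Union>i. C i) \<and> (\<forall>i. bounded (C i) \<and> diameter (C i) \<le> \<delta>)}.
        \<Sum>i. if C i = {} then 0
            else ennreal (unit_ball_vol (real m) * (diameter (C i) / 2) ^ m))"

definition hausdorff_outer :: "nat \<Rightarrow> 'a::metric_space set \<Rightarrow> ennreal" where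
  "hausdorff_outer m A = (SUP \<delta>\<in>{0<..}. hausdorff_content m \<delta> A)"

(* lambda_system selects the Caratheodory-measurable sets. *)
definition hausdorff_measure :: "nat \<Rightarrow> 'a::metric_space measure" where
  "hausdorff_measure m =
     measure_of UNIV (lambda_system UNIV (Pow UNIV) (hausdorff_outer m)) (hausdorff_outer m)"

definition surface_on :: "(real^'n) set \<Rightarrow> (real^'n) measure" where
  "surface_on A = restrict_space (hausdorff_measure (CARD('n) - 1)) A"

section \<open>Lebesgue and Sobolev spaces\<close>

definition Lp :: "'a measure \<Rightarrow> nat \<Rightarrow> ('a \<Rightarrow> 'b::euclidean_space) \<Rightarrow> bool" where
  "Lp M p f \<longleftrightarrow> f \<in> borel_measurable M \<and> integrable M (\<lambda>x. norm (f x) ^ p)"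

definition Linf :: "'a measure \<Rightarrow> ('a \<Rightarrow> 'b::euclidean_space) \<Rightarrow> bool" where
  "Linf M f \<longleftrightarrow> f \<in> borel_measurable M \<and> (\<exists>B. AE x in M. norm (f x) \<le> B)"

primrec C_k :: "nat \<Rightarrow> ('a::euclidean_space \<Rightarrow> real) \<Rightarrow> bool" where
  "C_k 0 f \<longleftrightarrow> continuous_on UNIV f"
| "C_k (Suc k) f \<longleftrightarrow> (\<forall>x. f differentiable (at x)) \<and>
     (\<forall>e\<in>Basis. C_k k (\<lambda>x. frechet_derivative f (at x) e))"

definition test_function :: "'a::euclidean_space set \<Rightarrow> ('a \<Rightarrow> real) \<Rightarrow> bool" where
  "test_function \<Omega> \<phi> \<longleftrightarrow> (\<forall>k. C_k k \<phi>) \<and>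
     (\<exists>K. compact K \<and> K \<subseteq> \<Omega> \<and> (\<forall>x. x \<notin> K \<longrightarrow> \<phi> x = 0))"

(* G x $ i $ j is the j-th weak partial derivative of the i-th component of u. *)
definition has_weak_gradient ::
  "(real^'n) set \<Rightarrow> (real^'n \<Rightarrow> real^'n) \<Rightarrow> (real^'n \<Rightarrow> real^'n^'n) \<Rightarrow> bool" where
  "has_weak_gradient \<Omega> u G \<longleftrightarrow>
     (\<forall>K. compact K \<and> K \<subseteq> \<Omega> \<longrightarrow> u absolutely_integrable_on K \<and> G absolutely_integrable_on K) \<and>
     (\<forall>\<phi>. test_function \<Omega> \<phi> \<longrightarrow>
        (\<forall>i j. (\<integral>x. u x $ i * frechet_derivative \<phi> (at x) (axis j 1) \<partial>(lebesgue_on \<Omega>))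
               = - (\<integral>x. G x $ i $ j * \<phi> x \<partial>(lebesgue_on \<Omega>))))"

definition wgrad :: "(real^'n) set \<Rightarrow> (real^'n \<Rightarrow> real^'n) \<Rightarrow> real^'n \<Rightarrow> real^'n^'n" where
  "wgrad \<Omega> u = (SOME G. has_weak_gradient \<Omega> u G)"

definition W1p :: "(real^'n) set \<Rightarrow> nat \<Rightarrow> (real^'n \<Rightarrow> real^'n) \<Rightarrow> bool" where
  "W1p \<Omega> p u \<longleftrightarrow> Lp (lebesgue_on \<Omega>) p u \<and>
     (\<exists>G. has_weak_gradient \<Omega> u G \<and> Lp (lebesgue_on \<Omega>) p G)"

definition W1inf :: "(real^'n) set \<Rightarrow> (real^'n \<Rightarrow> real^'n) \<Rightarrow> bool" where
  "W1inf \<Omega> u \<longleftrightarrow> Linf (lebesgue_on \<Omega>) u \<and>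
     (\<exists>G. has_weak_gradient \<Omega> u G \<and> Linf (lebesgue_on \<Omega>) G)"

definition W12_norm :: "(real^'n) set \<Rightarrow> (real^'n \<Rightarrow> real^'n) \<Rightarrow> real" where
  "W12_norm \<Omega> w = sqrt ((\<integral>x. (norm (w x))\<^sup>2 \<partial>(lebesgue_on \<Omega>))
                        + (\<integral>x. (norm (wgrad \<Omega> w x))\<^sup>2 \<partial>(lebesgue_on \<Omega>)))"

(* The trace operator is the continuous extension to W^{1,2} of the restriction map
   u |-> u on the boundary, u in W^{1,2} and continuous on the closure; has_trace is its graph.
   On a bounded Lipschitz domain every w in W^{1,2} has a trace, and it is unique almost everywhere
   with respect to surface measure. *)
definition has_trace ::
  "(real^'n) set \<Rightarrow> (real^'n \<Rightarrow> real^'n) \<Rightarrow> (real^'n \<Rightarrow> real^'n) \<Rightarrow> bool" where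
  "has_trace \<Omega> w g \<longleftrightarrow> W1p \<Omega> 2 w \<and> Lp (surface_on (frontier \<Omega>)) 2 g \<and>
     (\<exists>\<phi> :: nat \<Rightarrow> real^'n \<Rightarrow> real^'n.
        (\<forall>m. continuous_on (closure \<Omega>) (\<phi> m) \<and> W1p \<Omega> 2 (\<phi> m)) \<and>
        (\<lambda>m. W12_norm \<Omega> (\<lambda>x. \<phi> m x - w x)) \<longlonglongrightarrow> 0 \<and>
        (\<lambda>m. \<integral>x. (norm (\<phi> m x - g x))\<^sup>2 \<partial>(surface_on (frontier \<Omega>))) \<longlonglongrightarrow> 0)"

definition trace_eq_on ::
  "(real^'n) set \<Rightarrow> (real^'n) set \<Rightarrow> (real^'n \<Rightarrow> real^'n) \<Rightarrow> (real^'n \<Rightarrow> real^'n) \<Rightarrow> bool" where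
  "trace_eq_on \<Omega> \<D> w d \<longleftrightarrow> (\<exists>g. has_trace \<Omega> w g \<and> (AE x in surface_on \<D>. g x = d x))"

definition bmo_seminorm ::
  "(real^'n) set \<Rightarrow> (real^'n \<Rightarrow> 'b::euclidean_space) \<Rightarrow> ennreal" where
  "bmo_seminorm \<Omega> \<psi> =
     (SUP Q\<in>{box a b | a b. (\<exists>h>0. \<forall>i. b $ i - a $ i = h) \<and>
                            (\<exists>K. compact K \<and> box a b \<subseteq> K \<and> K \<subseteq> \<Omega>)}.
        let m = (1 / measure lebesgue Q) *\<^sub>R (\<integral>x. \<psi> x \<partial>(lebesgue_on Q))
        in ennreal ((1 / measure lebesgue Q) * (\<integral>x. norm (\<psi> x - m) \<partial>(lebesgue_on Q))))"

section \<open>Stored-energy densities\<close>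

definition Symm :: "(real^'n^'n) set" where
  "Symm = {A. transpose A = A}"

definition Psym :: "(real^'n^'n) set" where
  "Psym = {A \<in> Symm. \<forall>a. a \<noteq> 0 \<longrightarrow> a \<bullet> (A *v a) > 0}"

definition sym_part :: "real^'n^'n \<Rightarrow> real^'n^'n" where
  "sym_part A = (1/2) *\<^sub>R (A + transpose A)"

(* Derivatives of functions on Psym. Since Psym is open in Symm, but not in the space of all
   matrices, frechet_derivative f (at C within Psym) is uniquely determined only on Symm, and it
   must only be applied to elements of Symm. The first derivative is identified with the gradient,
   an element of Symm, so that the second one maps Symm to Symm. *)
definition D1 :: "(real^'n^'n \<Rightarrow> real) \<Rightarrow> real^'n^'n \<Rightarrow> real^'n^'n" where
  "D1 f C = (THE G. G \<in> Symm \<and> (\<forall>H\<in>Symm. frechet_derivative f (at C within Psym) H = G \<bullet> H))"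

definition D2 :: "(real^'n^'n \<Rightarrow> real) \<Rightarrow> real^'n^'n \<Rightarrow> real^'n^'n \<Rightarrow> real^'n^'n" where
  "D2 f C H = frechet_derivative (D1 f) (at C within Psym) H"

definition D3 :: "(real^'n^'n \<Rightarrow> real) \<Rightarrow> real^'n^'n \<Rightarrow> real^'n^'n \<Rightarrow> real^'n^'n \<Rightarrow> real^'n^'n" where
  "D3 f C H J = frechet_derivative (\<lambda>C'. D2 f C' H) (at C within Psym) J"

definition C3_Psym :: "(real^'n^'n \<Rightarrow> real) \<Rightarrow> bool" where
  "C3_Psym f \<longleftrightarrow> f differentiable_on Psym \<and> D1 f differentiable_on Psym \<and>
     (\<forall>H\<in>Symm. (\<lambda>C. D2 f C H) differentiable_on Psym \<and>
        (\<forall>J\<in>Symm. continuous_on Psym (\<lambda>C. D3 f C H J)))"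

(* Lebesgue measurability on \<Omega> x Psym refers to Lebesgue measure on real^'n x Symm. As Psym is
   a null set of the space of all matrices, lebesgue_on (\<Omega> \<times> Psym) would make every function
   measurable. Instead, functions are pulled back along the orthogonal projection sym_part,
   which by Fubini neither adds nor loses measurability. *)
definition measurable_on_Psym ::
  "(real^'n) set \<Rightarrow> (real^'n \<Rightarrow> real^'n^'n \<Rightarrow> 'b::euclidean_space) \<Rightarrow> bool" where
  "measurable_on_Psym \<Omega> f \<longleftrightarrow>
     (\<lambda>(x, A). f x (sym_part A)) \<in> borel_measurable (lebesgue_on (\<Omega> \<times> {A. sym_part A \<in> Psym}))"

(* The derivatives need to exist only for almost every x, so the bounds on them are required
   only at those x for which they do exist. *)
definition stored_energy_density :: "(real^'n) set \<Rightarrow> (real^'n \<Rightarrow> real^'n^'n \<Rightarrow> real) \<Rightarrow> bool" where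
  "stored_energy_density \<Omega> \<sigma> \<longleftrightarrow>
     (\<forall>x\<in>closure \<Omega>. \<forall>C\<in>Psym. 0 \<le> \<sigma> x C) \<and>
     (AE x in lebesgue_on \<Omega>. C3_Psym (\<sigma> x)) \<and>
     (measurable_on_Psym \<Omega> \<sigma> \<and>
      measurable_on_Psym \<Omega> (\<lambda>x. D1 (\<sigma> x)) \<and>
      (\<forall>H\<in>Symm. measurable_on_Psym \<Omega> (\<lambda>x C. D2 (\<sigma> x) C H)) \<and>
      (\<forall>H\<in>Symm. \<forall>J\<in>Symm. measurable_on_Psym \<Omega> (\<lambda>x C. D3 (\<sigma> x) C H J))) \<and>
     (\<forall>K. compact K \<and> K \<noteq> {} \<and> K \<subseteq> Psym \<longrightarrow>
        (\<exists>B. \<forall>x\<in>closure \<Omega>. \<forall>C\<in>K.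
           \<bar>\<sigma> x C\<bar> \<le> B \<and>
           (C3_Psym (\<sigma> x) \<longrightarrow>
              norm (D1 (\<sigma> x) C) \<le> B \<and>
              (\<forall>H\<in>Symm. norm (D2 (\<sigma> x) C H) \<le> B * norm H) \<and>
              (\<forall>H\<in>Symm. \<forall>J\<in>Symm. norm (D3 (\<sigma> x) C H J) \<le> B * norm H * norm J))))"

definition stress_K :: "(real^'n \<Rightarrow> real^'n^'n \<Rightarrow> real) \<Rightarrow> real^'n \<Rightarrow> real^'n^'n \<Rightarrow> real^'n^'n" where
  "stress_K \<sigma> x C = 2 *\<^sub>R D1 (\<sigma> x) C"

definition stress_S :: "(real^'n \<Rightarrow> real^'n^'n \<Rightarrow> real) \<Rightarrow> real^'n \<Rightarrow> real^'n^'n \<Rightarrow> real^'n^'n" where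
  "stress_S \<sigma> x F = F ** stress_K \<sigma> x (transpose F ** F)"

definition elasticity ::
  "(real^'n \<Rightarrow> real^'n^'n \<Rightarrow> real) \<Rightarrow> real^'n \<Rightarrow> real^'n^'n \<Rightarrow> real^'n^'n \<Rightarrow> real^'n^'n" where
  "elasticity \<sigma> x C H = 4 *\<^sub>R D2 (\<sigma> x) C H"

section \<open>Deformations, energy and equilibrium\<close>

definition boundary_partition :: "(real^'n) set \<Rightarrow> (real^'n) set \<Rightarrow> (real^'n) set \<Rightarrow> bool" where
  "boundary_partition \<Omega> \<D> \<S> \<longleftrightarrow>
     openin (top_of_set (frontier \<Omega>)) \<D> \<and> openin (top_of_set (frontier \<Omega>)) \<S> \<and>
     frontier \<Omega> = closure \<D> \<union> closure \<S> \<and> \<D> \<inter> \<S> = {} \<and> \<D> \<noteq> {}"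

definition cauchy_green :: "(real^'n) set \<Rightarrow> (real^'n \<Rightarrow> real^'n) \<Rightarrow> real^'n \<Rightarrow> real^'n^'n" where
  "cauchy_green \<Omega> u x = transpose (wgrad \<Omega> u x) ** wgrad \<Omega> u x"

(* On a bounded Lipschitz domain each class in W^{1,\<infinity>} has exactly one representative on the
   closure that is continuous there. It is the one used here, so that the boundary values of an
   admissible u are simply its values at boundary points. *)
definition AD ::
  "(real^'n) set \<Rightarrow> (real^'n) set \<Rightarrow> (real^'n \<Rightarrow> real^'n) \<Rightarrow> (real^'n \<Rightarrow> real^'n) set" where
  "AD \<Omega> \<D> d = {u. continuous_on (closure \<Omega>) u \<and> W1inf \<Omega> u \<and>
     (AE x in lebesgue_on \<Omega>. det (wgrad \<Omega> u x) > 0) \<and> (\<forall>x\<in>\<D>. u x = d x)}"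

definition Var :: "(real^'n) set \<Rightarrow> (real^'n) set \<Rightarrow> (real^'n \<Rightarrow> real^'n) set" where
  "Var \<Omega> \<D> = {w. W1p \<Omega> 2 w \<and> trace_eq_on \<Omega> \<D> w (\<lambda>x. 0)}"

(* The energy may be +\<infinity>: for u in AD the non-negative function \<sigma>(x, C_u(x)) need not be
   integrable. The force terms are always finite. *)
definition energy ::
  "(real^'n) set \<Rightarrow> (real^'n) set \<Rightarrow> (real^'n \<Rightarrow> real^'n^'n \<Rightarrow> real) \<Rightarrow> (real^'n \<Rightarrow> real^'n) \<Rightarrow>
   (real^'n \<Rightarrow> real^'n) \<Rightarrow> (real^'n \<Rightarrow> real^'n) \<Rightarrow> ereal" where
  "energy \<Omega> \<S> \<sigma> b s u =
     enn2ereal (\<integral>\<^sup>+x. ennreal (\<sigma> x (cauchy_green \<Omega> u x)) \<partial>(lebesgue_on \<Omega>))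
     - ereal (\<integral>x. b x \<bullet> u x \<partial>(lebesgue_on \<Omega>))
     - ereal (\<integral>x. s x \<bullet> u x \<partial>(surface_on \<S>))"

(* In the surface integral w stands for its trace g. Integrability of the volume term is part of
   the definition, since a non-integrable function has Bochner integral 0. *)
definition weak_solution ::
  "(real^'n) set \<Rightarrow> (real^'n) set \<Rightarrow> (real^'n) set \<Rightarrow> (real^'n \<Rightarrow> real^'n) \<Rightarrow>
   (real^'n \<Rightarrow> real^'n^'n \<Rightarrow> real) \<Rightarrow> (real^'n \<Rightarrow> real^'n) \<Rightarrow> (real^'n \<Rightarrow> real^'n) \<Rightarrow>
   (real^'n \<Rightarrow> real^'n) \<Rightarrow> bool" where
  "weak_solution \<Omega> \<D> \<S> d \<sigma> b s u \<longleftrightarrow> u \<in> AD \<Omega> \<D> d \<and>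
     (\<forall>w\<in>Var \<Omega> \<D>. \<forall>g. has_trace \<Omega> w g \<longrightarrow>
        integrable (lebesgue_on \<Omega>)
          (\<lambda>x. stress_S \<sigma> x (wgrad \<Omega> u x) \<bullet> wgrad \<Omega> w x - b x \<bullet> w x) \<and>
        (\<integral>x. stress_S \<sigma> x (wgrad \<Omega> u x) \<bullet> wgrad \<Omega> w x - b x \<bullet> w x \<partial>(lebesgue_on \<Omega>))
        - (\<integral>x. s x \<bullet> g x \<partial>(surface_on \<S>)) = 0)"

definition ciarlet_mardare_const :: "(real^'n) set \<Rightarrow> (real^'n) set \<Rightarrow> real \<Rightarrow> bool" where
  "ciarlet_mardare_const \<Omega> \<D> C\<^sub>M \<longleftrightarrow> C\<^sub>M > 0 \<and>
     (\<forall>u. W1p \<Omega> 4 u \<and> (AE x in lebesgue_on \<Omega>. det (wgrad \<Omega> u x) > 0) \<and>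
          trace_eq_on \<Omega> \<D> u (\<lambda>x. x) \<longrightarrow>
        (\<integral>x. (norm (cauchy_green \<Omega> u x - mat 1))\<^sup>2 \<partial>(lebesgue_on \<Omega>))
          \<ge> C\<^sub>M * (W12_norm \<Omega> (\<lambda>x. u x - x))\<^sup>2)"

end

theory Submission
  imports Defs
begin

text \<open>Write \<open>E = C\<^sub>v - I\<close> and \<open>H = \<nabla>v - I\<close>. In the Taylor expansion of \<open>\<sigma>\<close> at \<open>I\<close>, the equilibrium
  equation of the identity removes the terms linear in \<open>H\<close>; the lower bounds on the stress and on the
  elasticity tensor and the constant \<open>C\<^sub>M\<close> then bound the energy difference below by
  \<open>k \<integral>|E|\<^sup>2 - c \<integral>|E|\<^sup>3\<close>. Testing both equilibrium equations with \<open>v - id\<close> gives a bound of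
  the same form in the second part. It remains to show \<open>\<integral>|E|\<^sup>3 \<le> \<eta> \<integral>|E|\<^sup>2\<close> if the mean
  oscillation and the mean of \<open>E\<close> are small, for which it suffices to estimate the measure of
  \<open>{|E| > 2t}\<close>.

  Every point \<open>y\<close> of the domain is the apex of an interior cone. Follow the averages of \<open>E\<close> over
  cubes shrinking to \<open>y\<close> inside its cone. At a fixed scale they are at most \<open>t\<close>, since \<open>\<Omega>\<close> is connected.
  If an average exceeds \<open>t\<close> for the first time on a cube \<open>Q\<close>, then the preceding cube, to which all
  cubes of a tent around \<open>y\<close> can be linked by chains of bounded length, shows that \<open>{|E| > 2t}\<close>
  occupies only a small fraction of the tent, while \<open>t\<^sup>2 |Q| \<le> \<integral>\<^sub>Q |E|\<^sup>2\<close>; a Vitali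
  covering sums these estimates. Points of \<open>{|E| > 2t}\<close> where no average exceeds \<open>t\<close> form a
  set of density less than one at each of its points, hence a null set.\<close>

section \<open>Interior cones\<close>

text \<open>The seminorm only sees cubes in compact subsets of \<open>\<Omega>\<close>, so it says
  nothing directly about the mean over \<open>\<Omega>\<close> or about points near the boundary. A
  chain of cubes has a length independent of the scale only if its cubes keep away from the boundary
  by a fixed fraction of that scale; the strip left over has to be controlled by its volume, which
  the cone condition makes small. Joint Lebesgue measurability of the derivatives of
  \<open>\<sigma>\<close> in x and C does not by itself make their composition with
  \<open>cauchy_green\<close> measurable. Integrability is taken from elsewhere: from coercivity for
  the elasticity term and from the equilibrium equation for the stress term, while the energy itself
  is treated as a lower integral. The hypotheses leave a margin: the elasticity term yields 2 k
  times the integral of |E|^2, the stress term takes away at most k times it, and the cubic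
  remainder less than what is left. In the second part 4 k stands against 3/2 k and 1/2 k.\<close>

text \<open>One direction \<open>e\<close> serves every point of the closure near \<open>y\<close>,
  so that neighbouring points, boundary points included, can be pushed into the domain in parallel.
  For fixed \<open>z\<close> the balls fill a truncated cone with apex \<open>z\<close>.\<close>

definition interior_cone :: "'a::euclidean_space set \<Rightarrow> 'a \<Rightarrow> real \<Rightarrow> real \<Rightarrow> 'a \<Rightarrow> bool" where
  "interior_cone \<Omega> y \<rho> \<kappa> e \<longleftrightarrow> norm e = 1 \<and>
     (\<forall>z\<in>closure \<Omega> \<inter> ball y \<rho>. \<forall>\<tau>. 0 < \<tau> \<and> \<tau> < \<rho> \<longrightarrow> ball (z + \<tau> *\<^sub>R e) (\<kappa> * \<tau>) \<subseteq> \<Omega>)"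

lemma interior_cone_mono:
  assumes "interior_cone \<Omega> y \<rho> \<kappa> e" "\<rho>' \<le> \<rho>" "\<kappa>' \<le> \<kappa>" "ball y' \<rho>' \<subseteq> ball y \<rho>"
  shows "interior_cone \<Omega> y' \<rho>' \<kappa>' e"
  unfolding interior_cone_def
proof (intro conjI ballI allI impI)
  show "norm e = 1" using assms by (simp add: interior_cone_def)
  fix z \<tau> assume z: "z \<in> closure \<Omega> \<inter> ball y' \<rho>'" and \<tau>: "0 < \<tau> \<and> \<tau> < \<rho>'"
  have "ball (z + \<tau> *\<^sub>R e) (\<kappa>' * \<tau>) \<subseteq> ball (z + \<tau> *\<^sub>R e) (\<kappa> * \<tau>)"
    by (rule subset_ball) (use assms \<tau> in \<open>simp add: mult_right_mono\<close>)
  also have "\<dots> \<subseteq> \<Omega>"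
    using assms z \<tau> unfolding interior_cone_def
    by (metis IntD1 IntD2 IntI order_less_le_trans subsetD)
  finally show "ball (z + \<tau> *\<^sub>R e) (\<kappa>' * \<tau>) \<subseteq> \<Omega>" .
qed

lemma interior_coneD:
  assumes "interior_cone \<Omega> y \<rho> \<kappa> e" "z \<in> closure \<Omega>" "dist y z < \<rho>" "0 < \<tau>" "\<tau> < \<rho>"
  shows "ball (z + \<tau> *\<^sub>R e) (\<kappa> * \<tau>) \<subseteq> \<Omega>"
  using assms unfolding interior_cone_def by auto

lemma interior_cone_norm: "interior_cone \<Omega> y \<rho> \<kappa> e \<Longrightarrow> norm e = 1"
  by (simp add: interior_cone_def)

text \<open>Near a boundary point the domain lies above a graph with Lipschitz constant L. Moving by
  \<tau> along \<open>e\<close> and then by u raises the height over the graph by at least \<tau> -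
  (L + 1) |u|, whence \<open>\<kappa>\<close> = 1/(L + 1). At an interior point any direction works,
  with a third of the radius of a ball in the domain.\<close>

lemma local_interior_cone:
  fixes \<Omega> :: "(real^'n) set"
  assumes "lipschitz_domain \<Omega>" "y \<in> closure \<Omega>"
  obtains \<rho> \<kappa> e where "\<rho> > 0" "\<kappa> > 0" "\<kappa> \<le> 1" "interior_cone \<Omega> y \<rho> \<kappa> e"
proof (cases "y \<in> \<Omega>")
  case True
  have "open \<Omega>" using assms by (simp add: lipschitz_domain_def)
  then obtain R where R: "R > 0" "ball y R \<subseteq> \<Omega>"
    using True open_contains_ball by blast
  obtain e :: "real^'n" where e: "norm e = 1"
    using vector_choose_size[of 1] by auto
  have "interior_cone \<Omega> y (R/3) 1 e"
    unfolding interior_cone_def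
  proof (intro conjI ballI allI impI subsetI e)
    fix z \<tau> w assume z: "z \<in> closure \<Omega> \<inter> ball y (R/3)" and \<tau>: "0 < \<tau> \<and> \<tau> < R/3"
      and w: "w \<in> ball (z + \<tau> *\<^sub>R e) (1 * \<tau>)"
    have "dist y w \<le> dist y z + dist z (z + \<tau> *\<^sub>R e) + dist (z + \<tau> *\<^sub>R e) w"
      by (metis add_right_mono dist_triangle dist_triangle_le order_trans)
    also have "dist z (z + \<tau> *\<^sub>R e) = \<tau>" using \<tau> e by (simp add: dist_norm)
    finally have "dist y w < R" using z w \<tau> by auto
    then show "w \<in> \<Omega>" using R by auto
  qed
  then show ?thesis using R by (intro that[of "R/3" 1 e]) auto
next
  case False
  then have "y \<in> frontier \<Omega>"
    using assms by (simp add: frontier_def lipschitz_domain_def interior_open)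
  then obtain e g L r where e: "norm e = 1" and r: "r > 0" and L: "L-lipschitz_on {z. z \<bullet> e = 0} g"
    and graph: "\<And>w. w \<in> ball y r \<Longrightarrow> w \<in> \<Omega> \<longleftrightarrow> g (w - (w \<bullet> e) *\<^sub>R e) < w \<bullet> e"
    using assms unfolding lipschitz_domain_def strongly_lipschitz_boundary_def by metis
  have L0: "L \<ge> 0" using L by (simp add: lipschitz_on_def)
  define \<kappa> where "\<kappa> = 1 / (L + 1)"
  have \<kappa>: "0 < \<kappa>" "\<kappa> \<le> 1" using L0 by (auto simp: \<kappa>_def field_simps)
  have inner: "z + \<tau> *\<^sub>R e + u \<in> \<Omega>"
    if z: "z \<in> \<Omega>" "dist y z < r/4" and \<tau>: "0 < \<tau>" "\<tau> < r/4" and u: "norm u < \<kappa> * \<tau>" for z \<tau> u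
  proof -
    let ?w = "z + \<tau> *\<^sub>R e + u"
    have ur: "norm u \<le> \<tau>"
      using u \<kappa> \<tau> mult_right_mono[of \<kappa> 1 \<tau>] by linarith
    have "norm (\<tau> *\<^sub>R e + u) \<le> \<tau> + norm u"
      using norm_triangle_ineq[of "\<tau> *\<^sub>R e" u] e \<tau> by simp
    moreover have "dist y ?w \<le> dist y z + norm (\<tau> *\<^sub>R e + u)"
      using norm_triangle_ineq4[of "y - z" "\<tau> *\<^sub>R e + u"] by (simp add: dist_norm algebra_simps)
    ultimately have wr: "?w \<in> ball y r" using z \<tau> ur by auto
    have zr: "z \<in> ball y r" using z r by auto
    have ee: "e \<bullet> e = 1" using e by (simp add: dot_square_norm)
    let ?p = "\<lambda>w::real^'n. w - (w \<bullet> e) *\<^sub>R e"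
    have p0: "?p w \<in> {z. z \<bullet> e = 0}" for w
      by (simp add: inner_diff_left ee)
    have pp: "?p ?w - ?p z = ?p u"
      by (simp add: inner_add_left ee algebra_simps)
    have "norm (?p u) \<le> norm u"
    proof -
      have "(norm (?p u))\<^sup>2 = (norm u)\<^sup>2 - (u \<bullet> e)\<^sup>2"
        unfolding power2_norm_eq_inner
        by (simp add: inner_diff_left inner_diff_right ee power2_eq_square inner_commute[of e u])
      also have "\<dots> \<le> (norm u)\<^sup>2" by simp
      finally show ?thesis by (simp add: power2_le_iff_abs_le)
    qed
    then have "dist (g (?p ?w)) (g (?p z)) \<le> L * norm u"
    proof -
      assume *: "norm (?p u) \<le> norm u"
      have "dist (g (?p ?w)) (g (?p z)) \<le> L * norm (?p u)"
        using lipschitz_onD[OF L p0 p0, of ?w z] unfolding dist_norm pp .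
      also have "\<dots> \<le> L * norm u" using * L0 by (rule mult_left_mono)
      finally show ?thesis .
    qed
    then have "g (?p ?w) \<le> g (?p z) + L * norm u" by (simp add: dist_real_def)
    also have "g (?p z) < z \<bullet> e" using graph[OF zr] z by simp
    also have "z \<bullet> e + L * norm u \<le> ?w \<bullet> e"
    proof -
      have "- (u \<bullet> e) \<le> norm u" using Cauchy_Schwarz_ineq2[of u e] e by auto
      moreover have "(L + 1) * norm u \<le> \<tau>"
        using u L0 by (simp add: \<kappa>_def field_simps)
      ultimately show ?thesis by (simp add: inner_add_left ee algebra_simps)
    qed
    finally show ?thesis using graph[OF wr] by simp
  qed
  have "interior_cone \<Omega> y (r/4) \<kappa> e"
    unfolding interior_cone_def
  proof (intro conjI ballI allI impI subsetI e)
    fix z \<tau> w assume z: "z \<in> closure \<Omega> \<inter> ball y (r/4)" and \<tau>: "0 < \<tau> \<and> \<tau> < r/4"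
      and w: "w \<in> ball (z + \<tau> *\<^sub>R e) (\<kappa> * \<tau>)"
    \<comment> \<open>A point of the closure is replaced by a domain point \<open>z'\<close> so
      close that neither strict inequality is lost, the one for the distance to \<open>y\<close> nor
      the one for the distance to the centre of the ball.\<close>
    let ?\<epsilon> = "min (r/4 - dist y z) (\<kappa> * \<tau> - dist (z + \<tau> *\<^sub>R e) w)"
    have "?\<epsilon> > 0" using z w by auto
    then obtain z' where z': "z' \<in> \<Omega>" "dist z' z < ?\<epsilon>"
      using z closure_approachable[of z \<Omega>] by blast
    have "dist y z' < r/4" using z' dist_triangle[of y z' z] by (simp add: dist_commute)
    moreover have "norm (w - (z' + \<tau> *\<^sub>R e)) < \<kappa> * \<tau>"
    proof -
      have "norm (w - (z' + \<tau> *\<^sub>R e)) \<le> dist (z + \<tau> *\<^sub>R e) w + dist z' z"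
        using norm_triangle_ineq[of "w - (z + \<tau> *\<^sub>R e)" "z - z'"]
        by (simp add: dist_norm norm_minus_commute algebra_simps)
      then show ?thesis using z' by auto
    qed
    ultimately have "z' + \<tau> *\<^sub>R e + (w - (z' + \<tau> *\<^sub>R e)) \<in> \<Omega>"
      using inner z' \<tau> by blast
    then show "w \<in> \<Omega>" by simp
  qed
  then show ?thesis using r \<kappa> by (intro that[of "r/4" \<kappa> e]) auto
qed

text \<open>Compactness of the closure. The covering balls have half the radius of validity, so that
  a ball of the smallest such half radius about any point of the closure stays inside one of the
  full balls.\<close>

lemma uniform_interior_cone:
  fixes \<Omega> :: "(real^'n) set"
  assumes "lipschitz_domain \<Omega>"
  obtains \<rho> \<kappa> where "\<rho> > 0" "\<kappa> > 0" "\<kappa> \<le> 1" "\<And>y. y \<in> closure \<Omega> \<Longrightarrow> \<exists>e. interior_cone \<Omega> y \<rho> \<kappa> e"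
proof -
  have "\<forall>y\<in>closure \<Omega>. \<exists>\<rho> \<kappa> e. \<rho> > 0 \<and> \<kappa> > 0 \<and> \<kappa> \<le> 1 \<and> interior_cone \<Omega> y \<rho> \<kappa> e"
    using local_interior_cone[OF assms] by metis
  then obtain \<rho> \<kappa> e where loc: "\<And>y. y \<in> closure \<Omega> \<Longrightarrow>
      \<rho> y > 0 \<and> \<kappa> y > 0 \<and> \<kappa> y \<le> 1 \<and> interior_cone \<Omega> y (\<rho> y) (\<kappa> y) (e y)"
    by metis
  have "compact (closure \<Omega>)" using assms by (simp add: lipschitz_domain_def)
  then obtain F where F: "F \<subseteq> closure \<Omega>" "finite F" "closure \<Omega> \<subseteq> (\<Union>y\<in>F. ball y (\<rho> y / 2))"
    by (rule compactE_image[of _ "closure \<Omega>" "\<lambda>y. ball y (\<rho> y / 2)"])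
       (use loc in \<open>force+\<close>)
  have "F \<noteq> {}" using F assms by (auto simp: lipschitz_domain_def)
  define r where "r = Min ((\<lambda>y. \<rho> y / 2) ` F)"
  define k where "k = Min (\<kappa> ` F)"
  have r: "r > 0" "r \<le> \<rho> y / 2" if "y \<in> F" for y
  proof -
    have "\<And>y. y \<in> F \<Longrightarrow> \<rho> y > 0" using F loc by blast
    then show "r > 0" using F \<open>F \<noteq> {}\<close> by (simp add: r_def)
    show "r \<le> \<rho> y / 2" unfolding r_def using F that by (intro Min_le) auto
  qed
  have k: "k > 0" "k \<le> \<kappa> y" if "y \<in> F" for y
  proof -
    have "\<And>y. y \<in> F \<Longrightarrow> \<kappa> y > 0" using F loc by blast
    then show "k > 0" using F \<open>F \<noteq> {}\<close> by (simp add: k_def)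
    show "k \<le> \<kappa> y" unfolding k_def using F that by (intro Min_le) auto
  qed
  show ?thesis
  proof
    obtain x where "x \<in> F" using \<open>F \<noteq> {}\<close> by blast
    then have "\<kappa> x \<le> 1" "k \<le> \<kappa> x" using k F loc by auto
    then show "k \<le> 1" by simp
    show "r > 0" "k > 0" using r k \<open>x \<in> F\<close> by auto
    fix y assume "y \<in> closure \<Omega>"
    then obtain x where x: "x \<in> F" "dist x y < \<rho> x / 2" using F by auto
    have "\<rho> x > 0" using loc x F by blast
    then have "r \<le> \<rho> x" using r(2)[OF x(1)] by linarith
    moreover have "ball y r \<subseteq> ball x (\<rho> x)"
      using x r(2)[OF x(1)] by (intro ball_subset_ball_iff[THEN iffD2]) (auto simp: dist_commute)
    moreover have "interior_cone \<Omega> x (\<rho> x) (\<kappa> x) (e x)" using loc x F by blast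
    ultimately show "\<exists>e. interior_cone \<Omega> y r k e"
      using interior_cone_mono[OF _ _ k(2)[OF x(1)]] by blast
  qed
qed

section \<open>Boundary strips and coverings\<close>

lemma disjoint_translates_measure_le:
  fixes T :: "'a::euclidean_space set"
  assumes T: "T \<in> lmeasurable" and U: "U \<in> lmeasurable"
    and sub: "\<And>m. m < N \<Longrightarrow> (+) (a m) ` T \<subseteq> U"
    and disj: "\<And>m m'. m < m' \<Longrightarrow> m' < N \<Longrightarrow> (+) (a m) ` T \<inter> (+) (a m') ` T = {}"
  shows "real N * measure lebesgue T \<le> measure lebesgue U"
proof -
  have "measure lebesgue (\<Union>m<N. (+) (a m) ` T) = (\<Sum>m<N. measure lebesgue ((+) (a m) ` T))"
  proof (rule measure_UNION')
    show "pairwise (\<lambda>i j. disjnt ((+) (a i) ` T) ((+) (a j) ` T)) {..<N}"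
      unfolding pairwise_def disjnt_def using disj by (metis inf_commute lessThan_iff linorder_neqE_nat)
  qed (use T in \<open>auto simp: measurable_translation\<close>)
  also have "\<dots> = real N * measure lebesgue T"
    by (simp add: measure_translation)
  finally have "real N * measure lebesgue T = measure lebesgue (\<Union>m<N. (+) (a m) ` T)" by simp
  also have "\<dots> \<le> measure lebesgue U"
    using T U sub by (intro measure_mono_fmeasurable) (auto intro!: sets.finite_UN fmeasurableD measurable_translation)
  finally show ?thesis .
qed

text \<open>Translates of the strip by different multiples of \<open>(3 \<epsilon> / \<kappa>) e\<close> are disjoint.\<close>

lemma boundary_strip_measure:
  fixes \<Omega> :: "'a::euclidean_space set"
  assumes cone: "interior_cone \<Omega> y \<rho> \<kappa> e" and "open \<Omega>" "frontier \<Omega> \<noteq> {}"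
    and \<kappa>: "0 < \<kappa>" and \<epsilon>: "0 < \<epsilon>" "\<epsilon> < r" and r: "2 * r \<le> \<rho>"
  shows "measure lebesgue (ball y r \<inter> {z. infdist z (frontier \<Omega>) \<le> \<epsilon>})
           \<le> 3 * \<epsilon> / (\<kappa> * r) * measure lebesgue (ball y (2 * r))"
proof -
  let ?T = "ball y r \<inter> {z. infdist z (frontier \<Omega>) \<le> \<epsilon>}"
  \<comment> \<open>If a point and its translate by a positive multiple of \<open>\<tau>\<close>
    were both in the strip, the boundary point near the translate would lie within 2 \<epsilon> of
    the shifted boundary point near the original. The cone keeps the boundary at distance at least
    \<open>\<kappa> * \<tau>\<close> = 3 \<epsilon> from there.\<close>
  define \<tau> where "\<tau> = 3 * \<epsilon> / \<kappa>"
  have \<tau>: "\<tau> > 0" "\<kappa> * \<tau> = 3 * \<epsilon>" using \<kappa> \<epsilon> by (auto simp: \<tau>_def)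
  have e: "norm e = 1" using cone by (rule interior_cone_norm)
  have T: "?T \<in> lmeasurable"
    by (intro fmeasurable_Int_fmeasurable lmeasurable_ball sets_completionI_sets)
       (simp add: borel_closed closed_Collect_le continuous_on_infdist)
  \<comment> \<open>As many translates as keep the shift below \<open>r\<close>, so that all of them
    stay in the ball of radius \<open>2 * r\<close>.\<close>
  define N where "N = nat \<lceil>r / \<tau>\<rceil>"
  have Nr: "r / \<tau> \<le> real N" unfolding N_def by linarith
  have m: "real m * \<tau> < r" if "m < N" for m
  proof -
    have "real m < r / \<tau>" using that unfolding N_def by linarith
    then show ?thesis using \<tau> by (simp add: field_simps)
  qed
  have shift: "z + (real m * \<tau>) *\<^sub>R e \<notin> ?T" if z: "z \<in> ?T" and "0 < m" "m < N" for z m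
  proof
    assume "z + (real m * \<tau>) *\<^sub>R e \<in> ?T"
    then have le: "infdist (z + (real m * \<tau>) *\<^sub>R e) (frontier \<Omega>) \<le> \<epsilon>" by simp
    obtain p where p: "p \<in> frontier \<Omega>" "dist z p \<le> \<epsilon>"
      using infdist_attains_inf[of "frontier \<Omega>" z] assms z by (metis IntE frontier_closed mem_Collect_eq)
    obtain q where q: "q \<in> frontier \<Omega>" "dist (z + (real m * \<tau>) *\<^sub>R e) q \<le> \<epsilon>"
      using infdist_attains_inf[of "frontier \<Omega>" "z + (real m * \<tau>) *\<^sub>R e"] assms le by (metis frontier_closed)
    have "dist y p < \<rho>" using z p \<epsilon> r dist_triangle[of y p z] by (auto simp: dist_commute)
    moreover have "0 < real m * \<tau>" using \<tau> that by simp
    moreover have "real m * \<tau> < \<rho>" using m[OF that(3)] r \<epsilon> by linarith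
    ultimately have sub: "ball (p + (real m * \<tau>) *\<^sub>R e) (\<kappa> * (real m * \<tau>)) \<subseteq> \<Omega>"
      using interior_coneD[OF cone] p by (simp add: frontier_def)
    have "q \<notin> \<Omega>" using q assms by (simp add: frontier_def interior_open)
    then have "\<kappa> * (real m * \<tau>) \<le> dist (p + (real m * \<tau>) *\<^sub>R e) q" using sub by force
    also have "\<dots> \<le> dist (p + (real m * \<tau>) *\<^sub>R e) (z + (real m * \<tau>) *\<^sub>R e) + dist (z + (real m * \<tau>) *\<^sub>R e) q"
      by (rule dist_triangle)
    also have "\<dots> \<le> 2 * \<epsilon>" using p q by (simp add: dist_commute)
    finally have "real m * (\<kappa> * \<tau>) \<le> 2 * \<epsilon>" by (simp add: algebra_simps)
    then have "real m * (3 * \<epsilon>) \<le> 2 * \<epsilon>" using \<tau> by simp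
    then show False using that \<epsilon> by (simp add: field_simps) 
  qed
  have "real N * measure lebesgue ?T \<le> measure lebesgue (ball y (2 * r))"
  proof (rule disjoint_translates_measure_le[where a = "\<lambda>m. (real m * \<tau>) *\<^sub>R e"])
    fix i assume i: "i < N"
    show "(+) ((real i * \<tau>) *\<^sub>R e) ` ?T \<subseteq> ball y (2 * r)"
    proof clarify
      fix z assume "z \<in> ball y r"
      then show "(real i * \<tau>) *\<^sub>R e + z \<in> ball y (2 * r)"
        using m[OF i] e \<tau> norm_triangle_ineq4[of "y - z" "(real i * \<tau>) *\<^sub>R e"]
        by (simp add: dist_norm algebra_simps)
    qed
  next
    fix i j assume ij: "i < j" "j < N"
    show "(+) ((real i * \<tau>) *\<^sub>R e) ` ?T \<inter> (+) ((real j * \<tau>) *\<^sub>R e) ` ?T = {}"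
    proof (rule ccontr)
      assume "(+) ((real i * \<tau>) *\<^sub>R e) ` ?T \<inter> (+) ((real j * \<tau>) *\<^sub>R e) ` ?T \<noteq> {}"
      then obtain z z' where z: "z \<in> ?T" "z' \<in> ?T" "(real i * \<tau>) *\<^sub>R e + z = (real j * \<tau>) *\<^sub>R e + z'"
        by blast
      then have "z = z' + (real (j - i) * \<tau>) *\<^sub>R e"
        using ij by (simp add: of_nat_diff algebra_simps)
      moreover have "0 < j - i" "j - i < N" using ij by auto
      ultimately show False using shift[OF z(2)] z(1) by metis
    qed
  qed (use T in auto)
  moreover have "r / \<tau> * measure lebesgue ?T \<le> real N * measure lebesgue ?T"
    using Nr by (intro mult_right_mono) auto
  ultimately have "r / \<tau> * measure lebesgue ?T \<le> measure lebesgue (ball y (2 * r))" by linarith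
  then show ?thesis using \<kappa> \<epsilon> by (simp add: \<tau>_def field_simps)
qed

text \<open>A separated subset of maximal cardinality is a net, since a point left uncovered could
  be added. It exists because the balls of half the radius are disjoint and lie in \<open>U\<close>,
  which bounds the cardinality by a ratio of volumes.\<close>

lemma separated_covering:
  fixes A :: "'a::euclidean_space set"
  assumes U: "U \<in> lmeasurable" and \<epsilon>: "\<epsilon> > 0" and sub: "\<And>a. a \<in> A \<Longrightarrow> ball a (\<epsilon>/2) \<subseteq> U"
  obtains F where "finite F" "F \<subseteq> A" "A \<subseteq> (\<Union>a\<in>F. ball a \<epsilon>)"
    "real (card F) * measure lebesgue (ball (0::'a) (\<epsilon>/2)) \<le> measure lebesgue U"
proof -
  define sep where "sep F \<longleftrightarrow> finite F \<and> F \<subseteq> A \<and> pairwise (\<lambda>a b. \<epsilon> \<le> dist a b) F" for F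
  have bound: "real (card F) * measure lebesgue (ball (0::'a) (\<epsilon>/2)) \<le> measure lebesgue U" if "sep F" for F
  proof -
    have "(\<Sum>a\<in>F. measure lebesgue (ball a (\<epsilon>/2))) = measure lebesgue (\<Union>a\<in>F. ball a (\<epsilon>/2))"
    proof (rule measure_UNION'[symmetric])
      have "disjnt (ball a (\<epsilon>/2)) (ball b (\<epsilon>/2))" if "\<epsilon> \<le> dist a b" for a b :: 'a
        using that disjoint_ballI[of "\<epsilon>/2" "\<epsilon>/2" a b] by (simp add: disjnt_def)
      then show "pairwise (\<lambda>i j. disjnt (ball i (\<epsilon>/2)) (ball j (\<epsilon>/2))) F"
        using that unfolding sep_def pairwise_def by blast
    qed (use that in \<open>auto simp: sep_def\<close>)
    also have "\<dots> \<le> measure lebesgue U"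
      using that U sub by (intro measure_mono_fmeasurable) (auto simp: sep_def)
    finally show ?thesis
      using \<epsilon> by (simp add: content_ball)
  qed
  have pos: "measure lebesgue (ball (0::'a) (\<epsilon>/2)) > 0" using \<epsilon> by (simp add: content_ball_pos)
  define B where "B = nat \<lceil>measure lebesgue U / measure lebesgue (ball (0::'a) (\<epsilon>/2))\<rceil>"
  have "card F \<le> B" if "sep F" for F
  proof -
    have "real (card F) \<le> measure lebesgue U / measure lebesgue (ball (0::'a) (\<epsilon>/2))"
      using bound[OF that] pos by (simp add: field_simps)
    then show ?thesis unfolding B_def by linarith
  qed
  then have "\<forall>F. sep F \<longrightarrow> card F < Suc B" by (simp add: le_imp_less_Suc)
  moreover have "sep {}" by (simp add: sep_def)
  ultimately obtain F where F: "sep F" "\<And>G. sep G \<Longrightarrow> card G \<le> card F"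
    using ex_has_greatest_nat[of sep "{}" card "Suc B"] by blast
  have "\<exists>b\<in>F. dist b a < \<epsilon>" if a: "a \<in> A" for a
  proof (rule ccontr)
    assume n: "\<not> (\<exists>b\<in>F. dist b a < \<epsilon>)"
    then have "a \<notin> F" using \<epsilon> by auto
    have "sep (insert a F)"
      using F(1) n a by (auto simp: sep_def pairwise_insert dist_commute not_less)
    then show False using F(2)[of "insert a F"] \<open>a \<notin> F\<close> F(1) by (simp add: sep_def)
  qed
  then have "A \<subseteq> (\<Union>a\<in>F. ball a \<epsilon>)" by auto
  then show ?thesis using F(1) bound[OF F(1)] by (intro that[of F]) (auto simp: sep_def)
qed

section \<open>Functions of small mean oscillation on a domain\<close>

definition cube :: "real^'n \<Rightarrow> real \<Rightarrow> (real^'n) set" where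
  "cube p h = box (p - vec h) (p + vec h)"

lemma mem_cube: "x \<in> cube p h \<longleftrightarrow> (\<forall>i. \<bar>x $ i - p $ i\<bar> < h)"
  unfolding cube_def mem_box_cart by (simp add: abs_less_iff) (metis add.commute diff_less_eq less_diff_eq minus_diff_eq)

lemma measure_cube:
  fixes p :: "real^'n"
  assumes "h \<ge> 0" shows "measure lebesgue (cube p h) = (2 * h) ^ CARD('n)"
proof -
  have *: "(vec c :: real^'n) \<bullet> b = c" if "b \<in> Basis" for b c
    using that by (auto simp: Basis_vec_def inner_axis)
  have diff: "p + vec h - (p - vec h) = vec (2 * h)" by (simp add: vec_eq_iff)
  have "measure lebesgue (cube p h) = (\<Prod>b\<in>(Basis::(real^'n) set). vec (2 * h) \<bullet> b)"
    using assms by (simp add: cube_def measure_lborel_box_eq * inner_diff_left inner_add_left flip: diff)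
  also have "\<dots> = (\<Prod>b\<in>(Basis::(real^'n) set). 2 * h)"
    by (rule prod.cong) (simp_all only: *)
  finally show ?thesis by simp
qed

lemma cube_lmeasurable [simp, intro]: "cube p h \<in> lmeasurable"
  by (simp add: cube_def)

lemma cube_sets [simp, intro]: "cube p h \<in> sets lebesgue"
  by (simp add: cube_def)

text \<open>Bounding the norm by the sum of the coordinates gives the dimension as factor; this is
  the origin of the factors \<open>CARD('n)\<close> in all sizes of cubes below. The ball is closed,
  hence compact, as the seminorm asks of the sets that contain its cubes.\<close>

lemma cube_subset_cball:
  fixes p :: "real^'n" and h :: real
  shows "cube p h \<subseteq> cball p (CARD('n) * h)"
proof
  fix x assume "x \<in> cube p h"
  then have "(\<Sum>i\<in>UNIV. \<bar>(x - p) $ i\<bar>) \<le> (\<Sum>i\<in>(UNIV::'n set). h)"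
    by (intro sum_mono) (auto simp: mem_cube less_imp_le)
  then show "x \<in> cball p (CARD('n) * h)"
    using norm_le_l1_cart[of "x - p"] by (simp add: dist_norm norm_minus_commute)
qed

lemma ball_subset_cube: "ball p h \<subseteq> cube p h"
proof
  fix x assume "x \<in> ball p h"
  then have "\<bar>(x - p) $ i\<bar> < h" for i
    using component_le_norm_cart[of "x - p" i] by (simp add: dist_norm norm_minus_commute)
  then show "x \<in> cube p h" by (simp add: mem_cube)
qed

lemma cube_subset_cube:
  assumes "dist p q + h \<le> h'" shows "cube p h \<subseteq> cube q h'"
proof
  fix x assume x: "x \<in> cube p h"
  have "\<bar>x $ i - q $ i\<bar> < h'" for i
    using x component_le_norm_cart[of "p - q" i] assms unfolding mem_cube dist_norm
    by (smt (verit, ccfv_SIG) vector_minus_component)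
  then show "x \<in> cube q h'" by (simp add: mem_cube)
qed

section \<open>Averages and mean oscillation over cubes\<close>

definition average :: "(real^'n) set \<Rightarrow> (real^'n \<Rightarrow> 'b::euclidean_space) \<Rightarrow> 'b" where
  "average S \<psi> = (1 / measure lebesgue S) *\<^sub>R (LINT x:S|lebesgue. \<psi> x)"

text \<open>Any constant may stand in for the average. This at most doubles the bound, and it lets a
  constant be subtracted from the function without computing averages again. The cubes enter through
  closed balls, so that each lies in a compact subset of \<open>\<Omega>\<close>.\<close>

definition mean_osc_le :: "(real^'n) set \<Rightarrow> real \<Rightarrow> (real^'n \<Rightarrow> 'b::euclidean_space) \<Rightarrow> bool" where
  "mean_osc_le \<Omega> \<delta> \<psi> \<longleftrightarrow> integrable lebesgue \<psi> \<and>
     (\<forall>p. \<forall>h::real. h > 0 \<longrightarrow> cball p (CARD('n) * h) \<subseteq> \<Omega> \<longrightarrow>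
        (\<exists>c. (LINT x:cube p h|lebesgue. norm (\<psi> x - c)) \<le> \<delta> * measure lebesgue (cube p h)))"

lemma mean_osc_leD:
  fixes \<psi> :: "real^'n \<Rightarrow> 'b::euclidean_space" and h :: real
  assumes "mean_osc_le \<Omega> \<delta> \<psi>" "h > 0" "cball p (CARD('n) * h) \<subseteq> \<Omega>"
  obtains c where "(LINT x:cube p h|lebesgue. norm (\<psi> x - c)) \<le> \<delta> * measure lebesgue (cube p h)"
  using assms unfolding mean_osc_le_def by metis

lemma integrable_imp_set_integrable:
  fixes f :: "'a \<Rightarrow> 'b::{banach, second_countable_topology}"
  shows "integrable M f \<Longrightarrow> S \<in> sets M \<Longrightarrow> set_integrable M S f"
  unfolding set_integrable_def by (rule integrable_mult_indicator)

lemma set_integrable_const: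
  fixes c :: "'b::{banach, second_countable_topology}"
  shows "S \<in> fmeasurable M \<Longrightarrow> set_integrable M S (\<lambda>x. c)"
  unfolding set_integrable_def by (intro integrable_scaleR_left) (auto simp: fmeasurable_def)

lemma set_integral_const:
  fixes c :: "'b::{banach, second_countable_topology}"
  shows "S \<in> fmeasurable M \<Longrightarrow> (LINT x:S|M. c) = measure M S *\<^sub>R c"
  unfolding set_lebesgue_integral_def
  by (subst integral_scaleR_left) (auto simp: fmeasurable_def)

lemma set_integrable_norm_diff:
  fixes \<psi> :: "'a \<Rightarrow> 'b::{banach, second_countable_topology}"
  assumes "integrable M \<psi>" "S \<in> fmeasurable M"
  shows "set_integrable M S (\<lambda>x. norm (\<psi> x - c))"
  using assms by (intro set_integrable_norm set_integral_diff integrable_imp_set_integrable set_integrable_const) auto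

lemma set_integral_le_cover:
  fixes f :: "'a \<Rightarrow> real"
  assumes "finite I" "\<And>i. i \<in> I \<Longrightarrow> set_integrable M (B i) f" "set_integrable M A f"
    and "\<And>x. f x \<ge> 0" "A \<subseteq> (\<Union>i\<in>I. B i)"
  shows "(LINT x:A|M. f x) \<le> (\<Sum>i\<in>I. LINT x:B i|M. f x)"
proof -
  have "(LINT x:A|M. f x) \<le> (LINT x|M. (\<Sum>i\<in>I. indicator (B i) x *\<^sub>R f x))"
    unfolding set_lebesgue_integral_def
  proof (rule integral_mono)
    show "integrable M (\<lambda>x. \<Sum>i\<in>I. indicat_real (B i) x *\<^sub>R f x)"
      using assms by (intro Bochner_Integration.integrable_sum) (auto simp: set_integrable_def)
    fix x
    show "indicat_real A x *\<^sub>R f x \<le> (\<Sum>i\<in>I. indicat_real (B i) x *\<^sub>R f x)"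
    proof (cases "x \<in> A")
      case True
      then obtain i where "i \<in> I" "x \<in> B i" using assms by blast
      then show ?thesis
        using assms True member_le_sum[of i I "\<lambda>i. indicat_real (B i) x *\<^sub>R f x"] by simp
    qed (use assms in \<open>auto intro!: sum_nonneg\<close>)
  qed (use assms in \<open>auto simp: set_integrable_def\<close>)
  also have "\<dots> = (\<Sum>i\<in>I. LINT x:B i|M. f x)"
    using assms by (subst Bochner_Integration.integral_sum) (auto simp: set_integrable_def set_lebesgue_integral_def)
  finally show ?thesis .
qed

lemma set_integral_mono_set:
  fixes f :: "'a \<Rightarrow> real"
  assumes "set_integrable M A f" "set_integrable M B f" "\<And>x. f x \<ge> 0" "A \<subseteq> B"
  shows "(LINT x:A|M. f x) \<le> (LINT x:B|M. f x)"
  using set_integral_le_cover[of "{()}" M "\<lambda>_. B" f A] assms by simp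

lemma average_diff_le:
  fixes \<psi> :: "real^'n \<Rightarrow> 'b::euclidean_space"
  assumes "integrable lebesgue \<psi>" "S \<in> lmeasurable" "measure lebesgue S > 0"
  shows "norm (average S \<psi> - c) \<le> (LINT x:S|lebesgue. norm (\<psi> x - c)) / measure lebesgue S"
proof -
  have i: "set_integrable lebesgue S \<psi>" "set_integrable lebesgue S (\<lambda>x. c)"
    using assms by (auto intro!: integrable_imp_set_integrable set_integrable_const)
  have "average S \<psi> - c = (1 / measure lebesgue S) *\<^sub>R (LINT x:S|lebesgue. \<psi> x - c)"
    using assms i by (simp add: average_def set_integral_const scaleR_diff_right)
  then have "norm (average S \<psi> - c) = norm (LINT x:S|lebesgue. \<psi> x - c) / measure lebesgue S"
    using assms by simp
  also have "\<dots> \<le> (LINT x:S|lebesgue. norm (\<psi> x - c)) / measure lebesgue S"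
    using i assms by (intro divide_right_mono set_integral_norm_bound) auto
  finally show ?thesis .
qed

text \<open>The average is within \<delta> of the constant \<open>c\<close> that realises the bound,
  which accounts for the factor 2.\<close>

lemma mean_osc_le_cube:
  fixes \<psi> :: "real^'n \<Rightarrow> 'b::euclidean_space" and h :: real
  assumes \<psi>: "mean_osc_le \<Omega> \<delta> \<psi>" and h: "h > 0" and adm: "cball p (CARD('n) * h) \<subseteq> \<Omega>"
  shows "(LINT x:cube p h|lebesgue. norm (\<psi> x - average (cube p h) \<psi>)) \<le> 2 * \<delta> * measure lebesgue (cube p h)"
proof -
  let ?Q = "cube p h"
  have \<mu>: "measure lebesgue ?Q > 0" using h by (simp add: measure_cube)
  have int: "integrable lebesgue \<psi>" using \<psi> by (simp add: mean_osc_le_def)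
  obtain c where c: "(LINT x:?Q|lebesgue. norm (\<psi> x - c)) \<le> \<delta> * measure lebesgue ?Q"
    using mean_osc_leD[OF assms] .
  have "norm (average ?Q \<psi> - c) \<le> (LINT x:?Q|lebesgue. norm (\<psi> x - c)) / measure lebesgue ?Q"
    using int \<mu> by (intro average_diff_le) auto
  also have "\<dots> \<le> \<delta>" using c \<mu> by (simp add: field_simps)
  finally have d: "norm (c - average ?Q \<psi>) \<le> \<delta>" by (simp add: norm_minus_commute)
  have "(LINT x:?Q|lebesgue. norm (\<psi> x - average ?Q \<psi>)) \<le> (LINT x:?Q|lebesgue. norm (\<psi> x - c) + \<delta>)"
  proof (rule set_integral_mono)
    show "set_integrable lebesgue ?Q (\<lambda>x. norm (\<psi> x - c) + \<delta>)"
      using int by (intro set_integral_add set_integrable_norm_diff set_integrable_const) auto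
    fix x show "norm (\<psi> x - average ?Q \<psi>) \<le> norm (\<psi> x - c) + \<delta>"
      using norm_triangle_ineq[of "\<psi> x - c" "c - average ?Q \<psi>"] d by simp
  qed (use int in \<open>auto intro: set_integrable_norm_diff\<close>)
  also have "\<dots> = (LINT x:?Q|lebesgue. norm (\<psi> x - c)) + \<delta> * measure lebesgue ?Q"
    using int by (subst set_integral_add) (auto intro!: set_integrable_norm_diff set_integrable_const simp: set_integral_const)
  finally show ?thesis using c by simp
qed

lemma mean_osc_le_mono:
  fixes \<psi> :: "real^'n \<Rightarrow> 'b::euclidean_space"
  assumes "mean_osc_le \<Omega> \<delta> \<psi>" "\<delta> \<le> \<delta>'" shows "mean_osc_le \<Omega> \<delta>' \<psi>"
  using assms unfolding mean_osc_le_def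
  by (meson measure_nonneg mult_right_mono order_trans)

section \<open>Comparing averages along chains of cubes\<close>

text \<open>The bound holds for all functions at once, so that \<open>N\<close> depends on the geometry only; the type
  argument fixes their codomain.\<close>

definition linked :: "'b::euclidean_space itself \<Rightarrow> (real^'n) set \<Rightarrow> real \<Rightarrow> (real^'n) set \<Rightarrow> (real^'n) set \<Rightarrow> bool" where
  "linked _ \<Omega> N S T \<longleftrightarrow> (\<forall>\<delta> (\<psi> :: real^'n \<Rightarrow> 'b). \<delta> \<ge> 0 \<longrightarrow> mean_osc_le \<Omega> \<delta> \<psi> \<longrightarrow>
      norm (average S \<psi> - average T \<psi>) \<le> N * \<delta>)"

lemma linkedD:
  fixes \<psi> :: "real^'n \<Rightarrow> 'b::euclidean_space"
  assumes "linked TYPE('b) \<Omega> N S T" "mean_osc_le \<Omega> \<delta> \<psi>" "\<delta> \<ge> 0"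
  shows "norm (average S \<psi> - average T \<psi>) \<le> N * \<delta>"
  using assms unfolding linked_def by blast

lemma linked_refl: "linked t \<Omega> 0 S S"
  by (simp add: linked_def)

lemma linked_sym: "linked t \<Omega> N S T \<Longrightarrow> linked t \<Omega> N T S"
  by (simp add: linked_def norm_minus_commute)

lemma linked_trans:
  fixes t :: "'b::euclidean_space itself" and S :: "(real^'n) set"
  assumes "linked t \<Omega> N S T" "linked t \<Omega> N' T U" shows "linked t \<Omega> (N + N') S U"
  unfolding linked_def
proof (intro allI impI)
  fix \<delta> :: real and \<psi> :: "real^'n \<Rightarrow> 'b"
  assume \<psi>: "\<delta> \<ge> 0" "mean_osc_le \<Omega> \<delta> \<psi>"
  have "norm (average S \<psi> - average U \<psi>) \<le> norm (average S \<psi> - average T \<psi>) + norm (average T \<psi> - average U \<psi>)"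
    using norm_triangle_ineq[of "average S \<psi> - average T \<psi>" "average T \<psi> - average U \<psi>"] by simp
  moreover have "norm (average S \<psi> - average T \<psi>) \<le> N * \<delta>" "norm (average T \<psi> - average U \<psi>) \<le> N' * \<delta>"
    using assms \<psi> unfolding linked_def by blast+
  ultimately show "norm (average S \<psi> - average U \<psi>) \<le> (N + N') * \<delta>"
    by (simp add: algebra_simps)
qed

lemma linked_mono: "linked t \<Omega> N S T \<Longrightarrow> N \<le> N' \<Longrightarrow> linked t \<Omega> N' S T"
  unfolding linked_def by (meson mult_right_mono order_trans)

text \<open>Passing from the mean over the larger cube to the mean over the smaller one costs at
  most the ratio of the volumes; it is applied to the distance from the average of the larger
  cube.\<close>

lemma linked_subcube:
  fixes p q :: "real^'n" and h h' :: real and t :: "'b::euclidean_space itself"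
  assumes h: "0 < h" "h \<le> h'" and adm: "cball q (CARD('n) * h') \<subseteq> \<Omega>" and sub: "cube p h \<subseteq> cube q h'"
  shows "linked t \<Omega> (2 * (h' / h) ^ CARD('n)) (cube p h) (cube q h')"
  unfolding linked_def
proof (intro allI impI)
  fix \<delta> :: real and \<psi> :: "real^'n \<Rightarrow> 'b"
  assume \<delta>: "\<delta> \<ge> 0" and \<psi>: "mean_osc_le \<Omega> \<delta> \<psi>"
  let ?S = "cube p h" and ?T = "cube q h'" and ?a = "average (cube q h') \<psi>"
  have \<mu>: "measure lebesgue ?S > 0" using h by (simp add: measure_cube)
  have int: "integrable lebesgue \<psi>" using \<psi> by (simp add: mean_osc_le_def)
  have "norm (average ?S \<psi> - ?a) \<le> (LINT x:?S|lebesgue. norm (\<psi> x - ?a)) / measure lebesgue ?S"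
    using int \<mu> by (intro average_diff_le) auto
  also have "\<dots> \<le> (LINT x:?T|lebesgue. norm (\<psi> x - ?a)) / measure lebesgue ?S"
    using int sub by (intro divide_right_mono set_integral_mono_set set_integrable_norm_diff) auto
  also have "\<dots> \<le> 2 * \<delta> * measure lebesgue ?T / measure lebesgue ?S"
    using mean_osc_le_cube[OF \<psi> _ adm] h by (intro divide_right_mono) auto
  also have "\<dots> = 2 * (h' / h) ^ CARD('n) * \<delta>"
    using h by (simp add: measure_cube power_divide power_mult_distrib)
  finally show "norm (average ?S \<psi> - ?a) \<le> 2 * (h' / h) ^ CARD('n) * \<delta>" .
qed

text \<open>Both cubes lie in the cube of half side \<open>2 * k\<close> about \<open>p\<close>, and
  each is compared with it.\<close>

lemma linked_adjacent:
  fixes p q :: "real^'n" and k :: real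
  assumes h: "0 < h" "0 < h'" "h \<le> 2 * k" "h' \<le> 2 * k" and adm: "cball p (CARD('n) * (2 * k)) \<subseteq> \<Omega>"
    and sub: "dist q p + h' \<le> 2 * k"
  shows "linked t \<Omega> (2 * (2 * k / h) ^ CARD('n) + 2 * (2 * k / h') ^ CARD('n)) (cube p h) (cube q h')"
proof (rule linked_trans)
  show "linked t \<Omega> (2 * (2 * k / h) ^ CARD('n)) (cube p h) (cube p (2 * k))"
    using h adm by (intro linked_subcube cube_subset_cube) auto
  show "linked t \<Omega> (2 * (2 * k / h') ^ CARD('n)) (cube p (2 * k)) (cube q h')"
    using h adm sub by (intro linked_sym[OF linked_subcube] cube_subset_cube) auto
qed

text \<open>Cubes whose centres are at most \<open>h\<close> apart share a cube of half side
  \<open>2 * h\<close>. In dimension n one such step costs 2 * 2^n + 2 * 2^n = 2^(n + 2), and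
  rounding up the number of steps adds the 1.\<close>

lemma linked_segment:
  fixes p q :: "real^'n" and h :: real
  assumes h: "0 < h" and adm: "\<And>x. x \<in> closed_segment p q \<Longrightarrow> cball x (CARD('n) * (2 * h)) \<subseteq> \<Omega>"
  shows "linked t \<Omega> (2 ^ (CARD('n) + 2) * (dist p q / h + 1)) (cube p h) (cube q h)"
proof (cases "p = q")
  case True
  then show ?thesis by (auto intro!: linked_mono[OF linked_refl])
next
  case False
  define m where "m = nat \<lceil>dist p q / h\<rceil>"
  define P where "P = (\<lambda>i. p + (real i / real m) *\<^sub>R (q - p))"
  have m: "m > 0" "dist p q / h \<le> real m" "real m \<le> dist p q / h + 1"
    using False h by (auto simp: m_def of_nat_ceiling)
  have step: "dist (P (Suc i)) (P i) \<le> h" for i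
  proof -
    have "P (Suc i) - P i = (1 / real m) *\<^sub>R (q - p)"
      by (simp add: P_def add_divide_distrib algebra_simps)
    then have "dist (P (Suc i)) (P i) = dist p q / real m"
      using m by (simp add: dist_norm norm_minus_commute)
    also have "\<dots> \<le> h" using m h by (simp add: field_simps)
    finally show ?thesis .
  qed
  have "linked t \<Omega> (real i * 2 ^ (CARD('n) + 2)) (cube p h) (cube (P i) h)" if "i \<le> m" for i
    using that
  proof (induction i)
    case 0 then show ?case by (simp add: P_def linked_refl)
  next
    case (Suc i)
    have "P i = (1 - real i / real m) *\<^sub>R p + (real i / real m) *\<^sub>R q"
      by (simp add: P_def algebra_simps)
    then have "P i \<in> closed_segment p q"
      unfolding closed_segment_def using Suc.prems m by (auto intro!: exI[of _ "real i / real m"])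
    then have "linked t \<Omega> (2 * (2 * h / h) ^ CARD('n) + 2 * (2 * h / h) ^ CARD('n)) (cube (P i) h) (cube (P (Suc i)) h)"
      using adm h step[of i] by (intro linked_adjacent) auto
    moreover have "2 * (2 * h / h) ^ CARD('n) + 2 * (2 * h / h) ^ CARD('n) = (2::real) ^ (CARD('n) + 2)"
      using h by simp
    ultimately show ?case
      using linked_trans[OF Suc.IH] Suc.prems by (fastforce simp: algebra_simps)
  qed
  from this[of m] have "linked t \<Omega> (real m * 2 ^ (CARD('n) + 2)) (cube p h) (cube q h)"
    using m by (simp add: P_def)
  then show ?thesis
    by (rule linked_mono) (use m in \<open>simp add: mult.commute[of "real m"]\<close>)
qed

subsection \<open>Whitney cubes\<close>

text \<open>A ball is connected, so one that leaves the set would have to meet the frontier.\<close>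

lemma ball_infdist_frontier_subset:
  fixes \<Omega> :: "'a::euclidean_space set"
  assumes "x \<in> \<Omega>" shows "ball x (infdist x (frontier \<Omega>)) \<subseteq> \<Omega>"
proof (rule ccontr)
  assume n: "\<not> ball x (infdist x (frontier \<Omega>)) \<subseteq> \<Omega>"
  then have "x \<in> ball x (infdist x (frontier \<Omega>))"
    by (metis ball_eq_empty centre_in_ball empty_subsetI linorder_not_less)
  then have "ball x (infdist x (frontier \<Omega>)) \<inter> frontier \<Omega> \<noteq> {}"
    using assms n by (intro connected_Int_frontier connected_ball; blast)
  then show False using infdist_le[of _ "frontier \<Omega>" x] by (force simp: not_le)
qed

lemma infdist_frontier_pos:
  fixes \<Omega> :: "'a::euclidean_space set"
  assumes "open \<Omega>" "frontier \<Omega> \<noteq> {}" "x \<in> \<Omega>" shows "infdist x (frontier \<Omega>) > 0"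
  using assms by (intro infdist_pos_not_in_closed) (auto simp: frontier_def interior_open)

lemma infdist_frontier_ge:
  fixes \<Omega> :: "'a::euclidean_space set"
  assumes "open \<Omega>" "frontier \<Omega> \<noteq> {}" "ball x r \<subseteq> \<Omega>" shows "infdist x (frontier \<Omega>) \<ge> r"
proof -
  obtain p where p: "p \<in> frontier \<Omega>" "infdist x (frontier \<Omega>) = dist x p"
    using infdist_attains_inf[of "frontier \<Omega>" x] assms by (metis frontier_closed)
  then have "p \<notin> \<Omega>" using assms by (simp add: frontier_def interior_open)
  then show ?thesis using p assms by (force simp: subset_iff not_le)
qed

text \<open>A Whitney cube at every point instead of a dyadic selection: all that matters is that
  its size is proportional to the distance from the frontier. The factor 4 leaves room for the
  doubled cube inside the domain.\<close>

definition whitney :: "(real^'n) set \<Rightarrow> real^'n \<Rightarrow> (real^'n) set" where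
  "whitney \<Omega> x = cube x (infdist x (frontier \<Omega>) / (4 * CARD('n)))"

context
  fixes \<Omega> :: "(real^'n) set"
  assumes op: "open \<Omega>" and fr: "frontier \<Omega> \<noteq> {}"
begin

lemma whitney_admissible:
  assumes "x \<in> \<Omega>" "0 < c" "c < 1"
  shows "cball x (CARD('n) * (c * infdist x (frontier \<Omega>) / CARD('n))) \<subseteq> \<Omega>"
proof -
  have "cball x (CARD('n) * (c * infdist x (frontier \<Omega>) / CARD('n))) \<subseteq> ball x (infdist x (frontier \<Omega>))"
    using mult_strict_right_mono[OF assms(3) infdist_frontier_pos[OF op fr assms(1)]] by auto
  then show ?thesis using ball_infdist_frontier_subset[OF assms(1)] by blast
qed

text \<open>The distance to the frontier is 1-Lipschitz, so between points this close it changes by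
  at most an eighth and the half sides are comparable. Both cubes lie in the doubled cube at
  \<open>x\<close>, which is still admissible.\<close>

lemma whitney_linked_near:
  assumes x: "x \<in> \<Omega>" and y: "dist y x < infdist x (frontier \<Omega>) / (8 * CARD('n))"
  shows "linked t \<Omega> (4 ^ (CARD('n) + 1)) (whitney \<Omega> x) (whitney \<Omega> y)"
proof -
  let ?d = "infdist x (frontier \<Omega>)" and ?d' = "infdist y (frontier \<Omega>)" and ?n = "real CARD('n)"
  have d: "?d > 0" using infdist_frontier_pos[OF op fr x] .
  have n: "?n \<ge> 1" by (simp add: Suc_leI)
  have "?d / (8 * ?n) \<le> ?d / 8" using d n by (intro divide_left_mono) auto
  then have y8: "dist y x < ?d / 8" using y by linarith
  have d': "?d' \<ge> ?d * 7 / 8" "?d' \<le> ?d * 9 / 8"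
    using infdist_triangle[of x "frontier \<Omega>" y] infdist_triangle[of y "frontier \<Omega>" x] y8
    by (auto simp: dist_commute)
  define k where "k = ?d / (4 * ?n)"
  define k' where "k' = ?d' / (4 * ?n)"
  have k: "k > 0" "k' \<ge> k * 7 / 8" "k' \<le> k * 9 / 8"
    using d d' n by (auto simp: k_def k'_def field_simps)
  have yk: "dist y x < k / 2" using y by (simp add: k_def field_simps)
  have adm: "cball x (?n * (2 * k)) \<subseteq> \<Omega>"
    using whitney_admissible[OF x, of "1/2"] n by (simp add: k_def field_simps)
  have "linked t \<Omega> (2 * (2 * k / k) ^ CARD('n) + 2 * (2 * k / k') ^ CARD('n)) (cube x k) (cube y k')"
    using k yk adm by (intro linked_adjacent) auto
  moreover have "2 * (2 * k / k) ^ CARD('n) + 2 * (2 * k / k') ^ CARD('n) \<le> 4 ^ (CARD('n) + 1)"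
  proof -
    have "(2 * k / k) ^ CARD('n) \<le> 4 ^ CARD('n)" "(2 * k / k') ^ CARD('n) \<le> 4 ^ CARD('n)"
      using k by (intro power_mono; simp add: field_simps)+
    then have "2 * (2 * k / k) ^ CARD('n) + 2 * (2 * k / k') ^ CARD('n) \<le> 2 * 4 ^ CARD('n) + 2 * 4 ^ CARD('n)"
      by linarith
    then show ?thesis by simp
  qed
  ultimately have "linked t \<Omega> (4 ^ (CARD('n) + 1)) (cube x k) (cube y k')" by (rule linked_mono)
  then show ?thesis by (simp add: whitney_def k_def k'_def)
qed

text \<open>Being linked with some constant is an equivalence relation between points that holds
  near each point, so that connectedness leaves a single class.\<close>

lemma whitney_linked:
  assumes "connected \<Omega>" "x \<in> \<Omega>" "y \<in> \<Omega>"
  shows "\<exists>N. linked t \<Omega> N (whitney \<Omega> x) (whitney \<Omega> y)"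
proof (rule connected_equivalence_relation[OF assms, where R = "\<lambda>x y. \<exists>N. linked t \<Omega> N (whitney \<Omega> x) (whitney \<Omega> y)"])
  fix a assume a: "a \<in> \<Omega>"
  let ?r = "infdist a (frontier \<Omega>) / (8 * CARD('n))"
  have "?r > 0" using infdist_frontier_pos[OF op fr a] by simp
  then show "\<exists>T. openin (top_of_set \<Omega>) T \<and> a \<in> T \<and> (\<forall>x\<in>T. \<exists>N. linked t \<Omega> N (whitney \<Omega> a) (whitney \<Omega> x))"
  proof (intro exI[of _ "\<Omega> \<inter> ball a ?r"] conjI ballI)
    fix x assume "x \<in> \<Omega> \<inter> ball a ?r"
    then have "dist x a < ?r" by (simp add: dist_commute)
    then show "\<exists>N. linked t \<Omega> N (whitney \<Omega> a) (whitney \<Omega> x)"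
      using whitney_linked_near[OF a] by blast
  qed (use a in \<open>auto simp: openin_open_Int\<close>)
qed (use linked_sym linked_trans in blast)+

text \<open>A finite subcover by balls to which \<open>whitney_linked_near\<close> applies makes the
  constant uniform. These balls lie in the Whitney cubes of their centres, so the same centres
  provide the cover by cubes.\<close>

lemma whitney_linked_compact:
  assumes con: "connected \<Omega>" and x0: "x0 \<in> \<Omega>" and K: "compact K" "K \<subseteq> \<Omega>"
  obtains N F where "finite F" "F \<subseteq> K" "K \<subseteq> (\<Union>x\<in>F. whitney \<Omega> x)" "N \<ge> 0"
    "\<forall>x\<in>K. linked t \<Omega> N (whitney \<Omega> x) (whitney \<Omega> x0)"
proof -
  define r where "r x = infdist x (frontier \<Omega>) / (8 * CARD('n))" for x
  have r: "r x > 0" if "x \<in> K" for x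
    using infdist_frontier_pos[OF op fr, of x] that K by (auto simp: r_def)
  obtain F where F: "F \<subseteq> K" "finite F" "K \<subseteq> (\<Union>x\<in>F. ball x (r x))"
    by (rule compactE_image[OF K(1), of K "\<lambda>x. ball x (r x)"]) (use r in \<open>force+\<close>)
  obtain N where N: "\<And>x. x \<in> F \<Longrightarrow> linked t \<Omega> (N x) (whitney \<Omega> x) (whitney \<Omega> x0)"
    using whitney_linked[OF con _ x0] F K by (metis subsetD)
  define B where "B = 4 ^ (CARD('n) + 1) + (\<Sum>x\<in>F. \<bar>N x\<bar>)"
  show ?thesis
  proof
    have "ball x (r x) \<subseteq> whitney \<Omega> x" for x
    proof -
      have "ball x (r x) \<subseteq> cube x (r x)" by (rule ball_subset_cube)
      also have "\<dots> \<subseteq> whitney \<Omega> x" unfolding whitney_def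
        by (rule cube_subset_cube) (auto simp: r_def field_simps infdist_nonneg)
      finally show ?thesis .
    qed
    then show "K \<subseteq> (\<Union>x\<in>F. whitney \<Omega> x)" using F by blast
    show "B \<ge> 0" by (simp add: B_def sum_nonneg)
    show "\<forall>x\<in>K. linked t \<Omega> B (whitney \<Omega> x) (whitney \<Omega> x0)"
    proof
      fix x assume "x \<in> K"
      then obtain y where y: "y \<in> F" "dist y x < r y" using F by auto
      then have "linked t \<Omega> (4 ^ (CARD('n) + 1)) (whitney \<Omega> y) (whitney \<Omega> x)"
        using F K by (intro whitney_linked_near) (auto simp: r_def dist_commute)
      then have "linked t \<Omega> (4 ^ (CARD('n) + 1) + N y) (whitney \<Omega> x) (whitney \<Omega> x0)"
        using linked_trans linked_sym N[OF y(1)] by blast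
      moreover have "N y \<le> (\<Sum>x\<in>F. \<bar>N x\<bar>)"
        using member_le_sum[of y F "\<lambda>x. \<bar>N x\<bar>"] y F by auto
      ultimately show "linked t \<Omega> B (whitney \<Omega> x) (whitney \<Omega> x0)"
        using linked_mono unfolding B_def by fastforce
    qed
  qed (use F in auto)
qed

end

section \<open>Averages at a fixed distance from the boundary\<close>

text \<open>Finitely many Whitney cubes, all linked to the one at \<open>x0\<close>, cover a compact
  part of \<open>\<Omega>\<close>, and the bound \<open>M\<close> takes care of the rest, whose
  measure is small. So the function is close in mean to the constant \<open>c\<close>, which must
  then be close to the average over all of \<open>\<Omega>\<close>.\<close>

lemma whitney_average_small:
  fixes \<Omega> :: "(real^'n) set"
  assumes op: "open \<Omega>" and fr: "frontier \<Omega> \<noteq> {}" and con: "connected \<Omega>" and bd: "bounded \<Omega>"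
    and x0: "x0 \<in> \<Omega>" and \<eta>: "\<eta> > 0" and M: "M \<ge> 0"
  obtains \<delta> where "\<delta> > 0" "\<And>\<psi> :: real^'n \<Rightarrow> 'b::euclidean_space. mean_osc_le \<Omega> \<delta> \<psi> \<Longrightarrow> AE x in lebesgue. norm (\<psi> x) \<le> M \<Longrightarrow>
      norm (average \<Omega> \<psi>) \<le> \<delta> \<Longrightarrow> norm (average (whitney \<Omega> x0) \<psi>) \<le> \<eta>"
proof -
  have \<Omega>m: "\<Omega> \<in> lmeasurable" using op bd by (simp add: lmeasurable_open)
  have \<mu>: "measure lebesgue \<Omega> > 0"
    using op x0 \<Omega>m by (metis empty_iff negligible_iff_measure0 open_not_negligible zero_less_measure_iff)
  \<comment> \<open>The part outside \<open>K\<close> contributes at most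
    \<open>2 * (M + 1) * \<mu>0\<close>, that is half of \<eta> per unit of volume of
    \<open>\<Omega>\<close>.\<close>
  define \<mu>0 where "\<mu>0 = measure lebesgue \<Omega> * \<eta> / (4 * (M + 1))"
  have \<mu>0: "\<mu>0 > 0" using \<mu> \<eta> M by (simp add: \<mu>0_def)
  obtain K where K: "closed K" "K \<subseteq> \<Omega>" "\<Omega> - K \<in> lmeasurable" "emeasure lebesgue (\<Omega> - K) < ennreal \<mu>0"
    using sets_lebesgue_inner_closed[of \<Omega> \<mu>0] \<Omega>m \<mu>0 by (auto simp: fmeasurableD)
  have \<mu>K: "measure lebesgue (\<Omega> - K) \<le> \<mu>0"
    using K by (metis emeasure_eq_measure2 ennreal_less_iff less_eq_real_def measure_nonneg)
  have cK: "compact K" using K bd by (simp add: compact_eq_bounded_closed bounded_subset)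
  obtain F N where F: "finite F" "F \<subseteq> K" "K \<subseteq> (\<Union>x\<in>F. whitney \<Omega> x)" "N \<ge> 0"
      and N: "\<forall>x\<in>K. linked TYPE('b) \<Omega> N (whitney \<Omega> x) (whitney \<Omega> x0)"
    by (rule whitney_linked_compact[OF op fr con x0 cK K(2), where t = "TYPE('b)"]) (rule that)
  define S where "S = (\<Sum>x\<in>F. measure lebesgue (whitney \<Omega> x))"
  have S: "S \<ge> 0" by (simp add: S_def sum_nonneg)
  \<comment> \<open>The solution of \<delta> (1 + (2 + N) S / |\<Omega>|) = \<eta> / 2. The 1
    accounts for the average over \<open>\<Omega>\<close>, the rest for the Whitney cubes: 2 for the
    oscillation in each of them and \<open>N\<close> for its link to \<open>x0\<close>.\<close>
  define \<delta> where "\<delta> = (\<eta> / 2) / (1 + (2 + N) * S / measure lebesgue \<Omega>)"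
  have den: "1 + (2 + N) * S / measure lebesgue \<Omega> > 0"
    using S F \<mu> by (intro add_pos_nonneg divide_nonneg_pos mult_nonneg_nonneg) auto
  have \<delta>: "\<delta> > 0" using den \<eta> by (simp add: \<delta>_def)
  show ?thesis
  proof (rule that[OF \<delta>])
    fix \<psi> :: "real^'n \<Rightarrow> 'b"
    assume \<psi>: "mean_osc_le \<Omega> \<delta> \<psi>" and bdd: "AE x in lebesgue. norm (\<psi> x) \<le> M" and mean: "norm (average \<Omega> \<psi>) \<le> \<delta>"
    define c where "c = average (whitney \<Omega> x0) \<psi>"
    have int: "integrable lebesgue \<psi>" using \<psi> by (simp add: mean_osc_le_def)
    have Wm: "whitney \<Omega> x \<in> lmeasurable" for x by (simp add: whitney_def)
    have W\<mu>: "measure lebesgue (whitney \<Omega> x) > 0" if "x \<in> \<Omega>" for x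
      using infdist_frontier_pos[OF op fr that] by (simp add: whitney_def measure_cube)
    have bd_int: "(LINT x:A|lebesgue. norm (\<psi> x - d)) \<le> (M + norm d) * measure lebesgue A" if "A \<in> lmeasurable" for A d
    proof -
      have "(LINT x:A|lebesgue. norm (\<psi> x - d)) \<le> (LINT x:A|lebesgue. M + norm d)"
      proof (rule set_integral_mono_AE)
        show "AE x \<in> A in lebesgue. norm (\<psi> x - d) \<le> M + norm d"
          using bdd by eventually_elim (metis add_right_mono norm_triangle_ineq4 order_trans)
      qed (use int that in \<open>auto intro: set_integrable_norm_diff set_integrable_const\<close>)
      then show ?thesis using that by (simp add: set_integral_const algebra_simps)
    qed
    have cM: "norm c \<le> M"
    proof -
      have "norm (average (whitney \<Omega> x0) \<psi> - 0) \<le> (LINT x:whitney \<Omega> x0|lebesgue. norm (\<psi> x - 0)) / measure lebesgue (whitney \<Omega> x0)"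
        by (rule average_diff_le) (use int Wm W\<mu> x0 in auto)
      also have "\<dots> \<le> M" using bd_int[of "whitney \<Omega> x0" 0] Wm W\<mu>[OF x0] by (simp add: field_simps)
      finally show ?thesis by (simp add: c_def)
    qed
    have W: "(LINT y:whitney \<Omega> x|lebesgue. norm (\<psi> y - c)) \<le> (2 + N) * \<delta> * measure lebesgue (whitney \<Omega> x)" if "x \<in> F" for x
    proof -
      let ?W = "whitney \<Omega> x"
      have x: "x \<in> \<Omega>" "x \<in> K" using that F K by auto
      have adm: "cball x (CARD('n) * (infdist x (frontier \<Omega>) / (4 * CARD('n)))) \<subseteq> \<Omega>"
        using whitney_admissible[OF op fr x(1), of "1/4"] by (simp add: field_simps)
      have n: "norm (average ?W \<psi> - c) \<le> N * \<delta>"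
        using linkedD[OF bspec[OF N x(2)] \<psi>] \<delta> unfolding c_def by auto
      have "(LINT y:?W|lebesgue. norm (\<psi> y - c)) \<le> (LINT y:?W|lebesgue. norm (\<psi> y - average ?W \<psi>) + N * \<delta>)"
      proof (rule set_integral_mono)
        show "set_integrable lebesgue ?W (\<lambda>y. norm (\<psi> y - average ?W \<psi>) + N * \<delta>)"
          using int Wm by (intro set_integral_add set_integrable_norm_diff set_integrable_const) auto
        fix y show "norm (\<psi> y - c) \<le> norm (\<psi> y - average ?W \<psi>) + N * \<delta>"
          using norm_triangle_ineq[of "\<psi> y - average ?W \<psi>" "average ?W \<psi> - c"] n by simp
      qed (use int Wm in \<open>auto intro: set_integrable_norm_diff\<close>)
      also have "\<dots> = (LINT y:?W|lebesgue. norm (\<psi> y - average ?W \<psi>)) + N * \<delta> * measure lebesgue ?W"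
        using int Wm by (subst set_integral_add) (auto intro!: set_integrable_norm_diff set_integrable_const simp: set_integral_const)
      also have "(LINT y:?W|lebesgue. norm (\<psi> y - average ?W \<psi>)) \<le> 2 * \<delta> * measure lebesgue ?W"
        using mean_osc_le_cube[OF \<psi> _ adm] infdist_frontier_pos[OF op fr x(1)] by (simp add: whitney_def)
      finally show ?thesis by (simp add: algebra_simps)
    qed
    have "(LINT x:\<Omega>|lebesgue. norm (\<psi> x - c)) \<le> (\<Sum>i\<in>F. LINT x:whitney \<Omega> i|lebesgue. norm (\<psi> x - c)) + (LINT x:\<Omega>-K|lebesgue. norm (\<psi> x - c))"
    proof -
      let ?B = "\<lambda>i. case i of None \<Rightarrow> \<Omega> - K | Some x \<Rightarrow> whitney \<Omega> x"
      have "(LINT x:\<Omega>|lebesgue. norm (\<psi> x - c)) \<le> (\<Sum>i\<in>insert None (Some ` F). LINT x:?B i|lebesgue. norm (\<psi> x - c))"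
        by (rule set_integral_le_cover)
           (use F K Wm int \<Omega>m in \<open>auto intro!: set_integrable_norm_diff split: option.splits\<close>)
      also have "\<dots> = (LINT x:\<Omega>-K|lebesgue. norm (\<psi> x - c)) + (\<Sum>x\<in>F. LINT x:whitney \<Omega> x|lebesgue. norm (\<psi> x - c))"
        using F by (simp add: sum.reindex)
      finally show ?thesis by simp
    qed
    also have "(\<Sum>i\<in>F. LINT x:whitney \<Omega> i|lebesgue. norm (\<psi> x - c)) \<le> (\<Sum>x\<in>F. (2 + N) * \<delta> * measure lebesgue (whitney \<Omega> x))"
      by (rule sum_mono[OF W])
    also have "\<dots> = (2 + N) * \<delta> * S" by (simp add: S_def sum_distrib_left)
    also have "(LINT x:\<Omega>-K|lebesgue. norm (\<psi> x - c)) \<le> (M + norm c) * measure lebesgue (\<Omega> - K)"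
      by (rule bd_int[OF K(3)])
    also have "\<dots> \<le> (2 * (M + 1)) * \<mu>0"
      using cM M \<mu>K by (intro mult_mono) auto
    also have "\<dots> = measure lebesgue \<Omega> * \<eta> / 2" using M by (simp add: \<mu>0_def field_simps)
    finally have le: "(LINT x:\<Omega>|lebesgue. norm (\<psi> x - c)) \<le> (2 + N) * \<delta> * S + measure lebesgue \<Omega> * \<eta> / 2" by simp
    have "norm c \<le> norm (average \<Omega> \<psi> - c) + norm (average \<Omega> \<psi>)"
      using norm_triangle_ineq4[of "average \<Omega> \<psi>" "average \<Omega> \<psi> - c"] by simp
    also have "norm (average \<Omega> \<psi> - c) \<le> (LINT x:\<Omega>|lebesgue. norm (\<psi> x - c)) / measure lebesgue \<Omega>"
      by (rule average_diff_le[OF int \<Omega>m \<mu>])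
    also have "\<dots> \<le> ((2 + N) * \<delta> * S + measure lebesgue \<Omega> * \<eta> / 2) / measure lebesgue \<Omega>"
      using le \<mu> by (intro divide_right_mono) auto
    also have "\<dots> = \<delta> * ((2 + N) * S / measure lebesgue \<Omega>) + \<eta> / 2"
      using \<mu> by (simp add: field_simps)
    finally have "norm c \<le> \<delta> * (1 + (2 + N) * S / measure lebesgue \<Omega>) + \<eta> / 2"
      using mean by (simp add: algebra_simps)
    also have "\<delta> * (1 + (2 + N) * S / measure lebesgue \<Omega>) = \<eta> / 2"
      using den nonzero_divide_eq_eq[of "1 + (2 + N) * S / measure lebesgue \<Omega>" "\<eta> / 2" \<delta>]
      unfolding \<delta>_def by linarith
    finally show "norm (average (whitney \<Omega> x0) \<psi>) \<le> \<eta>" by (simp add: c_def field_simps)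
  qed
qed

text \<open>The centres stay in the compact set of points at distance at least \<open>r\<close> from
  the frontier, so one constant links all Whitney cubes there to the base cube. The cube of fixed
  size is compared with the Whitney cube at \<open>p\<close> through the doubled Whitney cube, which
  contains both.\<close>

lemma linked_inner_cubes:
  fixes \<Omega> :: "(real^'n) set" and t :: "'b::euclidean_space itself"
  assumes op: "open \<Omega>" and fr: "frontier \<Omega> \<noteq> {}" and con: "connected \<Omega>" and bd: "bounded \<Omega>"
    and x0: "x0 \<in> \<Omega>" and r: "r > 0"
  obtains N where "N \<ge> 0"
    "\<And>p. ball p r \<subseteq> \<Omega> \<Longrightarrow> linked t \<Omega> N (cube p (r / (2 * real CARD('n)))) (whitney \<Omega> x0)"
proof -
  let ?d = "\<lambda>x. infdist x (frontier \<Omega>)" and ?n = "real CARD('n)"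
  define K where "K = closure \<Omega> \<inter> {x. r \<le> ?d x}"
  have KO: "K \<subseteq> \<Omega>"
  proof
    fix x assume x: "x \<in> K"
    then have "x \<notin> frontier \<Omega>" using r by (auto simp: K_def infdist_zero)
    then show "x \<in> \<Omega>" using x op by (simp add: K_def frontier_def interior_open)
  qed
  have cK: "compact K" unfolding K_def
    using bd by (intro compact_Int_closed closed_Collect_le continuous_intros) auto
  obtain F N where F: "finite F" "F \<subseteq> K" "K \<subseteq> (\<Union>x\<in>F. whitney \<Omega> x)" "N \<ge> 0"
      and N: "\<forall>x\<in>K. linked t \<Omega> N (whitney \<Omega> x) (whitney \<Omega> x0)"
    by (rule whitney_linked_compact[OF op fr con x0 cK KO, where t = t]) (rule that)
  obtain B where B: "\<And>x. x \<in> closure \<Omega> \<Longrightarrow> ?d x \<le> B" "B > 0"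
  proof -
    have "compact (closure \<Omega>)" using bd by simp
    then have "bounded (?d ` closure \<Omega>)"
      by (intro compact_imp_bounded compact_continuous_image continuous_intros)
    then obtain B where "\<forall>y\<in>?d ` closure \<Omega>. norm y \<le> B" "B > 0" by (metis bounded_pos)
    then show ?thesis using that[of B] by force
  qed
  show ?thesis
  proof (rule that[of "2 * (B / r) ^ CARD('n) + 2 * 2 ^ CARD('n) + N"])
    fix p assume p: "ball p r \<subseteq> \<Omega>"
    have d: "r \<le> ?d p" by (rule infdist_frontier_ge[OF op fr p])
    have pO: "p \<in> \<Omega>" using p r by auto
    then have pK: "p \<in> K" using d closure_subset by (auto simp: K_def)
    have dB: "?d p \<le> B" using B pO closure_subset by blast
    define h where "h = ?d p / (2 * ?n)"
    have h: "h > 0" "r / (2 * ?n) \<le> h" "?d p / (4 * ?n) = h / 2"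
      using d r by (auto simp: h_def divide_right_mono)
    have adm: "cball p (?n * h) \<subseteq> \<Omega>"
      using whitney_admissible[OF op fr pO, of "1/2"] by (simp add: h_def field_simps)
    have "linked t \<Omega> (2 * (h / (r / (2 * ?n))) ^ CARD('n)) (cube p (r / (2 * ?n))) (cube p h)"
      using h r adm by (intro linked_subcube cube_subset_cube) auto
    moreover have "(h / (r / (2 * ?n))) ^ CARD('n) \<le> (B / r) ^ CARD('n)"
      using d r dB by (intro power_mono) (auto simp: h_def field_simps)
    ultimately have 1: "linked t \<Omega> (2 * (B / r) ^ CARD('n)) (cube p (r / (2 * ?n))) (cube p h)"
      by (elim linked_mono) simp
    have "linked t \<Omega> (2 * (h / (h/2)) ^ CARD('n)) (cube p (h/2)) (cube p h)"
      using h adm by (intro linked_subcube cube_subset_cube) auto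
    then have 2: "linked t \<Omega> (2 * 2 ^ CARD('n)) (cube p h) (whitney \<Omega> p)"
      using h linked_sym by (fastforce simp: whitney_def)
    show "linked t \<Omega> (2 * (B / r) ^ CARD('n) + 2 * 2 ^ CARD('n) + N) (cube p (r / (2 * ?n))) (whitney \<Omega> x0)"
      by (rule linked_trans[OF linked_trans[OF 1 2] bspec[OF N pK]])
  qed (use B r F in auto)
qed

lemma inner_averages_small:
  fixes \<Omega> :: "(real^'n) set"
  assumes op: "open \<Omega>" and ne: "\<Omega> \<noteq> {}" and con: "connected \<Omega>" and bd: "bounded \<Omega>"
    and r: "r > 0" and \<eta>: "\<eta> > 0" and M: "M \<ge> 0"
  obtains \<delta> where "\<delta> > 0" "\<And>(\<psi> :: real^'n \<Rightarrow> 'b::euclidean_space) p. mean_osc_le \<Omega> \<delta> \<psi> \<Longrightarrow> AE x in lebesgue. norm (\<psi> x) \<le> M \<Longrightarrow>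
      norm (average \<Omega> \<psi>) \<le> \<delta> \<Longrightarrow> ball p r \<subseteq> \<Omega> \<Longrightarrow> norm (average (cube p (r / (2 * real CARD('n)))) \<psi>) \<le> \<eta>"
proof -
  obtain x0 where x0: "x0 \<in> \<Omega>" using ne by auto
  have fr: "frontier \<Omega> \<noteq> {}" using ne bd by (auto simp: frontier_eq_empty)
  obtain \<delta>1 where \<delta>1: "\<delta>1 > 0" "\<And>\<psi> :: real^'n \<Rightarrow> 'b. mean_osc_le \<Omega> \<delta>1 \<psi> \<Longrightarrow> AE x in lebesgue. norm (\<psi> x) \<le> M \<Longrightarrow>
      norm (average \<Omega> \<psi>) \<le> \<delta>1 \<Longrightarrow> norm (average (whitney \<Omega> x0) \<psi>) \<le> \<eta> / 2"
    using whitney_average_small[OF op fr con bd x0 half_gt_zero[OF \<eta>] M] by metis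
  obtain N where N: "N \<ge> 0"
    "\<And>p. ball p r \<subseteq> \<Omega> \<Longrightarrow> linked TYPE('b) \<Omega> N (cube p (r / (2 * real CARD('n)))) (whitney \<Omega> x0)"
    using linked_inner_cubes[OF op fr con bd x0 r] by metis
  define \<delta> where "\<delta> = min \<delta>1 (\<eta> / (2 * (N + 1)))"
  have \<delta>: "\<delta> > 0" "\<delta> \<le> \<delta>1" using \<delta>1 \<eta> N by (auto simp: \<delta>_def)
  have N\<delta>: "N * \<delta> \<le> \<eta> / 2"
  proof -
    have "N * \<delta> \<le> (N + 1) * (\<eta> / (2 * (N + 1)))"
      using N \<delta> by (intro mult_mono) (auto simp: \<delta>_def)
    also have "\<dots> = \<eta> / 2" using N by (simp add: divide_simps)
    finally show ?thesis .
  qed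
  show ?thesis
  proof (rule that[OF \<delta>(1)])
    fix \<psi> :: "real^'n \<Rightarrow> 'b" and p
    assume \<psi>: "mean_osc_le \<Omega> \<delta> \<psi>" "AE x in lebesgue. norm (\<psi> x) \<le> M" "norm (average \<Omega> \<psi>) \<le> \<delta>" and p: "ball p r \<subseteq> \<Omega>"
    let ?a = "average (cube p (r / (2 * real CARD('n)))) \<psi>"
    have "norm (average (whitney \<Omega> x0) \<psi>) \<le> \<eta> / 2"
      using \<delta>1(2)[OF mean_osc_le_mono[OF \<psi>(1) \<delta>(2)] \<psi>(2)] \<psi>(3) \<delta> by simp
    moreover have "norm (?a - average (whitney \<Omega> x0) \<psi>) \<le> N * \<delta>"
      using linkedD[OF N(2)[OF p] \<psi>(1)] \<delta> by simp
    ultimately show "norm ?a \<le> \<eta>"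
      using N\<delta> norm_triangle_ineq[of "?a - average (whitney \<Omega> x0) \<psi>" "average (whitney \<Omega> x0) \<psi>"] by simp
  qed
qed

section \<open>Tents at the boundary and the level sets in them\<close>

text \<open>The chain climbs from \<open>z\<close> in direction \<open>e\<close> to a height where
  the domain is wide, crosses over to the axis of \<open>y\<close>, descends along it to height
  \<open>s\<close>, and finally passes to the larger cube there. The constant adds the costs of
  these four legs; the scale \<open>s\<close> cancels from each.\<close>

lemma linked_tent:
  fixes \<Omega> :: "(real^'n) set" and y z e :: "real^'n"
  defines "n \<equiv> real CARD('n)"
  assumes cone: "interior_cone \<Omega> y \<rho> \<kappa> e" and \<kappa>: "0 < \<kappa>" "\<kappa> \<le> 1" and s: "0 < s" "40 * s \<le> \<kappa> * \<rho>"
    and \<theta>: "0 < \<theta>" "\<theta> \<le> 1" and y: "y \<in> \<Omega>"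
    and z: "z \<in> \<Omega>" "dist y z < 10 * s" "\<theta> * s < infdist z (frontier \<Omega>)"
  shows "linked t \<Omega> (2 ^ (CARD('n) + 2) * (320 * n / (\<kappa>\<^sup>2 * \<theta>) + 80 * n / (\<kappa> * \<theta>) + 3) + 2 * (4 / \<theta>) ^ CARD('n))
    (cube z (\<kappa> * \<theta> * s / (8 * n))) (cube (y + s *\<^sub>R e) (\<kappa> * s / (2 * n)))"
proof -
  \<comment> \<open>Chosen so that the cube of half side \<open>2 * h\<close> lies in a closed ball
    of radius \<kappa> \<theta> s / 4, for which both the cone above height \<theta> s / 2 and the
    distance of \<open>z\<close> from the frontier leave room.\<close>
  define h where "h = \<kappa> * \<theta> * s / (8 * n)"
  \<comment> \<open>At height \<open>K\<close> the ball about the axis point has radius 20 s, enough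
    to cross from above \<open>z\<close> to above \<open>y\<close>, less than 10 s apart, with 10 s
    to spare. The restriction on the scale gives \<open>2 * K\<close> \<le>
    \<open>\<rho>\<close>.\<close>
  define K where "K = 20 * s / \<kappa>"
  have n: "n \<ge> 1" by (simp add: n_def Suc_leI)
  have e: "norm e = 1" using cone by (rule interior_cone_norm)
  have h: "h > 0" "n * (2 * h) = \<kappa> * \<theta> * s / 4" using \<kappa> \<theta> s n by (auto simp: h_def)
  have \<kappa>\<theta>: "0 < \<kappa> * \<theta> * s" "\<kappa> * \<theta> * s \<le> \<theta> * s" "\<kappa> * \<theta> * s \<le> \<kappa> * s" "\<kappa> * \<theta> * s \<le> s"
  proof -
    show "0 < \<kappa> * \<theta> * s" using \<kappa> \<theta> s by simp
    show "\<kappa> * \<theta> * s \<le> \<theta> * s" using \<kappa> \<theta> s mult_right_mono[of \<kappa> 1 "\<theta> * s"] by (simp add: mult.assoc)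
    show *: "\<kappa> * \<theta> * s \<le> \<kappa> * s" using \<kappa> \<theta> s mult_left_mono[of "\<theta> * s" s \<kappa>] by (simp add: mult.assoc)
    show "\<kappa> * \<theta> * s \<le> s" using * mult_right_mono[OF \<kappa>(2), of s] s by linarith
  qed
  have "\<kappa> * \<rho> \<ge> \<kappa> * K * 2" using s \<kappa> by (simp add: K_def)
  then have "K * 2 \<le> \<rho>" using \<kappa> by (metis mult.assoc mult_le_cancel_left_pos)
  moreover have "20 * s \<le> K" using s \<kappa> by (simp add: K_def field_simps)
  ultimately have K: "K > 0" "K < \<rho>" "10 * s < \<rho>" "s < K" "\<kappa> * K = 20 * s"
    using s \<kappa> by (auto simp: K_def)
  have yc: "y \<in> closure \<Omega>" "z \<in> closure \<Omega>" using y z closure_subset by blast+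
  have cb: "cball x (n * (2 * h)) \<subseteq> \<Omega>" if "ball x r \<subseteq> \<Omega>" "\<kappa> * \<theta> * s / 4 < r" for x r
    using that h by (auto simp: subset_iff)
  have ratio: "c / h = 8 * n * c / (\<kappa> * \<theta> * s)" for c using \<kappa> \<theta> s n by (simp add: h_def)
  have 1: "linked t \<Omega> (2 ^ (CARD('n) + 2) * (160 * n / (\<kappa>\<^sup>2 * \<theta>) + 1)) (cube z h) (cube (z + K *\<^sub>R e) h)"
  proof -
    have "linked t \<Omega> (2 ^ (CARD('n) + 2) * (dist z (z + K *\<^sub>R e) / h + 1)) (cube z h) (cube (z + K *\<^sub>R e) h)"
    proof (rule linked_segment[OF h(1)])
      fix x assume "x \<in> closed_segment z (z + K *\<^sub>R e)"
      then obtain u where u: "0 \<le> u" "u \<le> 1" "x = (1 - u) *\<^sub>R z + u *\<^sub>R (z + K *\<^sub>R e)"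
        unfolding closed_segment_def by auto
      define \<tau> where "\<tau> = u * K"
      have x: "x = z + \<tau> *\<^sub>R e" using u by (simp add: \<tau>_def algebra_simps)
      have \<tau>: "0 \<le> \<tau>" "\<tau> \<le> K" using u K by (auto simp: \<tau>_def mult_left_le_one_le)
      show "cball x (real CARD('n) * (2 * h)) \<subseteq> \<Omega>"
      \<comment> \<open>High up the cone provides the room. Below height \<theta> s / 2 it is too
        thin, but there the point is still close to \<open>z\<close>, whose distance from the
        frontier exceeds \<theta> s.\<close>
      proof (cases "\<theta> * s / 2 \<le> \<tau>")
        case True
        then have "\<tau> > 0" using \<theta> s by (smt (verit, best) half_gt_zero mult_pos_pos)
        then have "ball x (\<kappa> * \<tau>) \<subseteq> \<Omega>" unfolding x
          using z \<tau> K yc by (intro interior_coneD[OF cone]) auto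
        moreover have "\<kappa> * \<theta> * s / 4 < \<kappa> * \<tau>"
          using mult_left_mono[OF True, of \<kappa>] \<kappa> \<kappa>\<theta> by (simp add: mult.assoc)
        ultimately show ?thesis using cb unfolding n_def by blast
      next
        case False
        have "ball x (\<theta> * s / 2) \<subseteq> ball z (infdist z (frontier \<Omega>))"
        proof (rule ball_subset_ball_iff[THEN iffD2], rule disjI1)
          show "dist x z + \<theta> * s / 2 \<le> infdist z (frontier \<Omega>)"
            using False z \<tau> e by (simp add: x dist_norm)
        qed
        then have "ball x (\<theta> * s / 2) \<subseteq> \<Omega>"
          using ball_infdist_frontier_subset[OF z(1)] by blast
        moreover have "\<kappa> * \<theta> * s / 4 < \<theta> * s / 2" using \<kappa>\<theta> by linarith
        ultimately show ?thesis using cb unfolding n_def by blast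
      qed
    qed
    moreover have "dist z (z + K *\<^sub>R e) / h = 160 * n / (\<kappa>\<^sup>2 * \<theta>)"
      using K e s \<kappa> \<theta> by (simp add: dist_norm ratio) (simp add: K_def power2_eq_square)
    ultimately show ?thesis by simp
  qed
  have 2: "linked t \<Omega> (2 ^ (CARD('n) + 2) * (80 * n / (\<kappa> * \<theta>) + 1)) (cube (z + K *\<^sub>R e) h) (cube (y + K *\<^sub>R e) h)"
  proof -
    have "linked t \<Omega> (2 ^ (CARD('n) + 2) * (dist (z + K *\<^sub>R e) (y + K *\<^sub>R e) / h + 1)) (cube (z + K *\<^sub>R e) h) (cube (y + K *\<^sub>R e) h)"
    proof (rule linked_segment[OF h(1)])
      fix x assume x: "x \<in> closed_segment (z + K *\<^sub>R e) (y + K *\<^sub>R e)"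
      have "dist (y + K *\<^sub>R e) x \<le> dist (y + K *\<^sub>R e) (z + K *\<^sub>R e)"
        using segment_bound(2)[OF x] by (simp add: dist_norm norm_minus_commute)
      then have "dist (y + K *\<^sub>R e) x < 10 * s" using z by simp
      moreover have "ball (y + K *\<^sub>R e) (\<kappa> * K) \<subseteq> \<Omega>"
        using K yc by (intro interior_coneD[OF cone]) auto
      moreover have "ball x (10 * s) \<subseteq> ball (y + K *\<^sub>R e) (\<kappa> * K)"
      proof (rule ball_subset_ball_iff[THEN iffD2], rule disjI1)
        show "dist x (y + K *\<^sub>R e) + 10 * s \<le> \<kappa> * K"
          using \<open>dist (y + K *\<^sub>R e) x < 10 * s\<close> K by (simp add: dist_commute)
      qed
      moreover have "\<kappa> * \<theta> * s / 4 < 10 * s" using \<kappa>\<theta> s by linarith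
      ultimately show "cball x (real CARD('n) * (2 * h)) \<subseteq> \<Omega>" using cb unfolding n_def by blast
    qed
    moreover have "dist (z + K *\<^sub>R e) (y + K *\<^sub>R e) / h \<le> 80 * n / (\<kappa> * \<theta>)"
    proof -
      have "dist (z + K *\<^sub>R e) (y + K *\<^sub>R e) / h \<le> 10 * s / h"
        using z h by (intro divide_right_mono) (auto simp: dist_commute)
      also have "\<dots> = 80 * n / (\<kappa> * \<theta>)" using s \<kappa> \<theta> unfolding ratio by simp
      finally show ?thesis .
    qed
    ultimately show ?thesis by (elim linked_mono) (simp add: mult_left_mono)
  qed
  have 3: "linked t \<Omega> (2 ^ (CARD('n) + 2) * (160 * n / (\<kappa>\<^sup>2 * \<theta>) + 1)) (cube (y + K *\<^sub>R e) h) (cube (y + s *\<^sub>R e) h)"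
  proof -
    have "linked t \<Omega> (2 ^ (CARD('n) + 2) * (dist (y + K *\<^sub>R e) (y + s *\<^sub>R e) / h + 1)) (cube (y + K *\<^sub>R e) h) (cube (y + s *\<^sub>R e) h)"
    proof (rule linked_segment[OF h(1)])
      fix x assume "x \<in> closed_segment (y + K *\<^sub>R e) (y + s *\<^sub>R e)"
      then obtain u where u: "0 \<le> u" "u \<le> 1" "x = (1 - u) *\<^sub>R (y + K *\<^sub>R e) + u *\<^sub>R (y + s *\<^sub>R e)"
        unfolding closed_segment_def by auto
      define \<tau> where "\<tau> = (1 - u) * K + u * s"
      have x: "x = y + \<tau> *\<^sub>R e" using u by (simp add: \<tau>_def algebra_simps)
      have \<tau>: "s \<le> \<tau>" "\<tau> \<le> K"
        using mult_left_mono[of s K "1 - u"] mult_left_mono[of s K u] u K by (auto simp: \<tau>_def algebra_simps)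
      have "ball x (\<kappa> * \<tau>) \<subseteq> \<Omega>" unfolding x
        using \<tau> s K yc by (intro interior_coneD[OF cone]) auto
      moreover have "\<kappa> * \<theta> * s / 4 < \<kappa> * \<tau>"
        using mult_left_mono[OF \<tau>(1), of \<kappa>] \<kappa> \<kappa>\<theta> by linarith
      ultimately show "cball x (real CARD('n) * (2 * h)) \<subseteq> \<Omega>" using cb unfolding n_def by blast
    qed
    moreover have "dist (y + K *\<^sub>R e) (y + s *\<^sub>R e) / h \<le> 160 * n / (\<kappa>\<^sup>2 * \<theta>)"
    proof -
      have "dist (y + K *\<^sub>R e) (y + s *\<^sub>R e) = K - s"
      proof -
        have "K *\<^sub>R e - s *\<^sub>R e = (K - s) *\<^sub>R e" by (simp add: algebra_simps)
        then show ?thesis using K e by (simp add: dist_norm)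
      qed
      then have "dist (y + K *\<^sub>R e) (y + s *\<^sub>R e) / h \<le> K / h"
        using s h by (intro divide_right_mono) auto
      also have "\<dots> = 160 * n / (\<kappa>\<^sup>2 * \<theta>)" using s \<kappa> \<theta> unfolding ratio by (simp add: K_def power2_eq_square)
      finally show ?thesis .
    qed
    ultimately show ?thesis by (elim linked_mono) (simp add: mult_left_mono)
  qed
  have 4: "linked t \<Omega> (2 * (4 / \<theta>) ^ CARD('n)) (cube (y + s *\<^sub>R e) h) (cube (y + s *\<^sub>R e) (\<kappa> * s / (2 * n)))"
  proof -
    have "h \<le> \<kappa> * s / (2 * n)"
      using \<kappa>\<theta> n \<kappa> s by (simp add: h_def field_simps)
    moreover have "cball (y + s *\<^sub>R e) (real CARD('n) * (\<kappa> * s / (2 * n))) \<subseteq> \<Omega>"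
    proof -
      have "cball (y + s *\<^sub>R e) (n * (\<kappa> * s / (2 * n))) \<subseteq> ball (y + s *\<^sub>R e) (\<kappa> * s)"
        using mult_pos_pos[OF \<kappa>(1) s(1)] n by auto
      also have "\<dots> \<subseteq> \<Omega>" using s K yc by (intro interior_coneD[OF cone]) auto
      finally show ?thesis by (simp add: n_def)
    qed
    ultimately have "linked t \<Omega> (2 * ((\<kappa> * s / (2 * n)) / h) ^ CARD('n)) (cube (y + s *\<^sub>R e) h) (cube (y + s *\<^sub>R e) (\<kappa> * s / (2 * n)))"
      using h by (intro linked_subcube cube_subset_cube) auto
    moreover have "(\<kappa> * s / (2 * n)) / h = 4 / \<theta>" using \<kappa> s n \<theta> by (simp add: h_def)
    ultimately show ?thesis by simp
  qed
  show ?thesis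
    unfolding h_def[symmetric]
    by (rule linked_mono[OF linked_trans[OF linked_trans[OF linked_trans[OF 1 2] 3] 4]])
       (simp add: algebra_simps)
qed

text \<open>Chebyshev's inequality: where the norm exceeds \<open>a + t\<close>, the function
  differs from its average by more than \<open>t\<close>.\<close>

lemma cube_level_set_measure:
  fixes \<psi> :: "real^'n \<Rightarrow> 'b::euclidean_space" and h :: real
  assumes \<psi>: "mean_osc_le \<Omega> \<delta> \<psi>" and h: "h > 0" "cball p (CARD('n) * h) \<subseteq> \<Omega>" and t: "t > 0"
    and avg: "norm (average (cube p h) \<psi>) \<le> a"
  shows "measure lebesgue (cube p h \<inter> {z. a + t < norm (\<psi> z)}) \<le> 2 * \<delta> / t * (2 * h) ^ CARD('n)"
proof -
  let ?S = "cube p h \<inter> {z. a + t < norm (\<psi> z)}" and ?a = "average (cube p h) \<psi>"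
  have int: "integrable lebesgue \<psi>" using \<psi> by (simp add: mean_osc_le_def)
  have [measurable]: "\<psi> \<in> borel_measurable lebesgue" using int by auto
  have "{z. a + t < norm (\<psi> z)} \<in> sets lebesgue"
  proof -
    have "{z \<in> space lebesgue. a + t < norm (\<psi> z)} \<in> sets lebesgue" by measurable
    then show ?thesis by simp
  qed
  then have S: "?S \<in> lmeasurable" by (intro fmeasurable_Int_fmeasurable) auto
  have "t * measure lebesgue ?S = (LINT z:?S|lebesgue. t)"
    using S by (simp add: set_integral_const)
  also have "\<dots> \<le> (LINT z:?S|lebesgue. norm (\<psi> z - ?a))"
  proof (rule set_integral_mono)
    fix z assume "z \<in> ?S"
    then show "t \<le> norm (\<psi> z - ?a)" using avg norm_triangle_ineq2[of "\<psi> z" ?a] by simp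
  qed (use S int in \<open>auto intro: set_integrable_const set_integrable_norm_diff\<close>)
  also have "\<dots> \<le> (LINT z:cube p h|lebesgue. norm (\<psi> z - ?a))"
    using S int by (intro set_integral_mono_set set_integrable_norm_diff) auto
  also have "\<dots> \<le> 2 * \<delta> * measure lebesgue (cube p h)"
    by (rule mean_osc_le_cube[OF \<psi> h])
  finally show ?thesis using t h by (simp add: measure_cube field_simps)
qed

text \<open>The tent splits into the strip within \<theta> s of the boundary, small in volume, and a
  rest covered by boundedly many cubes that are linked to the cube at height \<open>s\<close>. The
  order of choice matters: \<theta> depends on \<epsilon>, the chain constant \<open>N\<close> on
  \<theta>, and \<delta> on \<open>N\<close>.\<close>

lemma level_set_in_tent:
  fixes \<Omega> :: "(real^'n) set"
  assumes op: "open \<Omega>" and fr: "frontier \<Omega> \<noteq> {}" and \<kappa>: "0 < \<kappa>" "\<kappa> \<le> 1" and t: "t > 0" and \<epsilon>: "\<epsilon> > 0"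
  obtains \<delta> where "\<delta> > 0" "\<And>(\<psi> :: real^'n \<Rightarrow> 'b::euclidean_space) y \<rho> e s. mean_osc_le \<Omega> \<delta> \<psi> \<Longrightarrow> y \<in> \<Omega> \<Longrightarrow>
      interior_cone \<Omega> y \<rho> \<kappa> e \<Longrightarrow> 0 < s \<Longrightarrow> 40 * s \<le> \<kappa> * \<rho> \<Longrightarrow>
      norm (average (cube (y + s *\<^sub>R e) (\<kappa> * s / (2 * real CARD('n)))) \<psi>) \<le> t \<Longrightarrow>
      measure lebesgue (\<Omega> \<inter> ball y (10 * s) \<inter> {z. 2 * t < norm (\<psi> z)}) \<le> \<epsilon> * s ^ CARD('n)"
proof -
  define n where "n = real CARD('n)"
  have n: "n \<ge> 1" by (simp add: n_def Suc_leI)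
  define \<omega> where "\<omega> = unit_ball_vol (real CARD('n))"
  have \<omega>: "\<omega> > 0" by (simp add: \<omega>_def)
  have vol: "measure lebesgue (ball (c::real^'n) r) = \<omega> * r ^ CARD('n)" if "r \<ge> 0" for c r
    using that by (simp add: content_ball \<omega>_def)
  \<comment> \<open>Makes the estimate of the strip, applied with radius 10 s and hence with a ball
    of radius 20 s, at most \<epsilon> / 2 times s^n, where n is the dimension.\<close>
  define \<theta> where "\<theta> = min 1 (\<epsilon> * 10 * \<kappa> / (6 * \<omega> * 20 ^ CARD('n)))"
  have \<theta>: "0 < \<theta>" "\<theta> \<le> 1" "\<theta> * (6 * \<omega> * 20 ^ CARD('n)) \<le> \<epsilon> * 10 * \<kappa>"
    using \<epsilon> \<kappa> \<omega> by (auto simp: \<theta>_def min_def field_simps)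
  define N where "N = 2 ^ (CARD('n) + 2) * (320 * n / (\<kappa>\<^sup>2 * \<theta>) + 80 * n / (\<kappa> * \<theta>) + 3) + 2 * (4 / \<theta>) ^ CARD('n)"
  have N: "N > 0" using n \<kappa> \<theta> by (auto simp: N_def intro!: add_pos_pos mult_pos_pos)
  \<comment> \<open>The first bound keeps the averages of the linked cubes close to
    \<open>t\<close>, the second makes the sum of the Chebyshev bounds at most \<epsilon> / 2 times
    s^n. The base 44 is 4 * 11: the cubes have side \<open>2 * h\<close>, four times the radius of
    the disjoint balls, and these lie in a ball of radius 11 s.\<close>
  define \<delta> where "\<delta> = min (t / (4 * N)) (\<epsilon> * t / (16 * 44 ^ CARD('n)))"
  have \<delta>: "\<delta> > 0" "N * \<delta> \<le> t / 4" "\<delta> * (16 * 44 ^ CARD('n)) \<le> \<epsilon> * t"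
    using t N \<epsilon> by (auto simp: \<delta>_def min_def field_simps)
  show ?thesis
  proof (rule that[OF \<delta>(1)])
    fix \<psi> :: "real^'n \<Rightarrow> 'b" and y \<rho> e s
    assume \<psi>: "mean_osc_le \<Omega> \<delta> \<psi>" and y: "y \<in> \<Omega>" and cone: "interior_cone \<Omega> y \<rho> \<kappa> e"
      and s: "0 < s" "40 * s \<le> \<kappa> * \<rho>"
      and avg: "norm (average (cube (y + s *\<^sub>R e) (\<kappa> * s / (2 * real CARD('n)))) \<psi>) \<le> t"
    let ?L = "{z. 2 * t < norm (\<psi> z)}"
    let ?T = "ball y (10 * s) \<inter> {z. infdist z (frontier \<Omega>) \<le> \<theta> * s}"
    define h where "h = \<kappa> * \<theta> * s / (8 * n)"
    have h: "h > 0" using \<kappa> \<theta> s n by (simp add: h_def)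
    have hs: "h \<le> s"
    proof -
      have "\<kappa> * \<theta> \<le> 1" using \<kappa> \<theta> by (simp add: mult_le_one)
      then have "\<kappa> * \<theta> * s \<le> 1 * s" using s by (intro mult_right_mono) auto
      also have "\<dots> \<le> s * (8 * n)" using n s by simp
      finally show ?thesis using n by (simp add: h_def field_simps)
    qed
    define A where "A = {z \<in> \<Omega>. dist y z < 10 * s \<and> \<theta> * s < infdist z (frontier \<Omega>)}"
    have sub: "ball a (h/2) \<subseteq> ball y (11 * s)" if "a \<in> A" for a
      using that hs s by (intro ball_subset_ball_iff[THEN iffD2]) (auto simp: A_def dist_commute)
    obtain F where F: "finite F" "F \<subseteq> A" "A \<subseteq> (\<Union>a\<in>F. ball a h)"
      "real (card F) * measure lebesgue (ball (0::real^'n) (h/2)) \<le> measure lebesgue (ball y (11 * s))"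
      by (rule separated_covering[OF lmeasurable_ball h sub])
    have cF: "real (card F) * (h/2) ^ CARD('n) \<le> (11 * s) ^ CARD('n)"
    proof -
      have "\<omega> * (real (card F) * (h/2) ^ CARD('n)) \<le> \<omega> * (11 * s) ^ CARD('n)"
        using F(4) vol[of "h/2" 0] vol[of "11 * s" y] h s by (simp add: mult_ac)
      then show ?thesis using \<omega> by (simp only: mult_le_cancel_left_pos)
    qed
    have [measurable]: "\<psi> \<in> borel_measurable lebesgue" using \<psi> by (auto simp: mean_osc_le_def)
    have Lm: "?L \<in> sets lebesgue"
    proof -
      have "{z \<in> space lebesgue. 2 * t < norm (\<psi> z)} \<in> sets lebesgue" by measurable
      then show ?thesis by simp
    qed
    have Tm: "?T \<in> sets lebesgue"
      by (intro sets.Int sets_completionI_sets) (auto simp: borel_closed closed_Collect_le continuous_on_infdist)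
    have cubem: "measure lebesgue (cube a h \<inter> ?L) \<le> 8 * \<delta> / t * (2 * h) ^ CARD('n)" if "a \<in> F" for a
    proof -
      have a: "a \<in> \<Omega>" "dist y a < 10 * s" "\<theta> * s < infdist a (frontier \<Omega>)" using that F by (auto simp: A_def)
      have "linked TYPE('b) \<Omega> N (cube a h) (cube (y + s *\<^sub>R e) (\<kappa> * s / (2 * n)))"
        unfolding N_def h_def n_def by (rule linked_tent[OF cone \<kappa> s \<theta>(1,2) y a])
      then have "norm (average (cube a h) \<psi> - average (cube (y + s *\<^sub>R e) (\<kappa> * s / (2 * n))) \<psi>) \<le> N * \<delta>"
        using \<psi> \<delta> by (intro linkedD) auto
      then have "norm (average (cube a h) \<psi>) \<le> t + t / 4"
        using avg \<delta> norm_triangle_ineq2[of "average (cube a h) \<psi>" "average (cube (y + s *\<^sub>R e) (\<kappa> * s / (2 * n))) \<psi>"]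
        unfolding n_def by linarith
      \<comment> \<open>With an excess of t / 4 this level adds up to the threshold 2 t.\<close>
      then have avg': "norm (average (cube a h) \<psi>) \<le> 7 / 4 * t" using t by simp
      have adm: "cball a (CARD('n) * h) \<subseteq> \<Omega>"
      proof -
        have "\<kappa> * \<theta> * s / 8 < \<theta> * s"
          using mult_right_mono[OF \<kappa>(2), of "\<theta> * s"] \<theta> s by (simp add: mult.assoc)
        then have "cball a (n * h) \<subseteq> ball a (infdist a (frontier \<Omega>))"
          using a n by (auto simp: h_def)
        then show ?thesis using ball_infdist_frontier_subset[OF a(1)] unfolding n_def by blast
      qed
      have "measure lebesgue (cube a h \<inter> {z. 7 / 4 * t + t / 4 < norm (\<psi> z)}) \<le> 2 * \<delta> / (t / 4) * (2 * h) ^ CARD('n)"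
        using t by (intro cube_level_set_measure[OF \<psi> h adm _ avg']) auto
      then show ?thesis by simp
    qed
    have "measure lebesgue (\<Omega> \<inter> ball y (10 * s) \<inter> ?L) \<le> measure lebesgue (?T \<union> (\<Union>a\<in>F. cube a h \<inter> ?L))"
    proof (rule measure_mono_fmeasurable)
      show "\<Omega> \<inter> ball y (10 * s) \<inter> ?L \<subseteq> ?T \<union> (\<Union>a\<in>F. cube a h \<inter> ?L)"
      proof
        fix z assume z: "z \<in> \<Omega> \<inter> ball y (10 * s) \<inter> ?L"
        show "z \<in> ?T \<union> (\<Union>a\<in>F. cube a h \<inter> ?L)"
        proof (cases "z \<in> ?T")
          case False
          then have "z \<in> A" using z by (auto simp: A_def)
          then obtain a where "a \<in> F" "z \<in> ball a h" using F by blast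
          then show ?thesis using z ball_subset_cube by blast
        qed auto
      qed
      show "\<Omega> \<inter> ball y (10 * s) \<inter> ?L \<in> sets lebesgue"
        using op Lm by (intro sets.Int) auto
      have "ball y (10 * s) \<inter> {z. infdist z (frontier \<Omega>) \<le> \<theta> * s} \<in> lmeasurable"
        by (rule fmeasurableI2[OF lmeasurable_ball _ Tm]) auto
      moreover have "cube a h \<inter> ?L \<in> lmeasurable" for a
        by (rule fmeasurableI2[of "cube a h"]) (auto intro: Lm)
      ultimately show "?T \<union> (\<Union>a\<in>F. cube a h \<inter> ?L) \<in> lmeasurable"
        using F by (intro fmeasurable.Un fmeasurable.finite_UN) auto
    qed
    also have "\<dots> \<le> measure lebesgue ?T + measure lebesgue (\<Union>a\<in>F. cube a h \<inter> ?L)"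
      using Tm Lm F by (intro measure_Un_le sets.finite_UN) auto
    also have "measure lebesgue ?T \<le> 3 * (\<theta> * s) / (\<kappa> * (10 * s)) * measure lebesgue (ball y (2 * (10 * s)))"
    proof (rule boundary_strip_measure[OF cone op fr \<kappa>(1)])
      show "0 < \<theta> * s" using \<theta> s by simp
      show "\<theta> * s < 10 * s" using \<theta> s mult_right_mono[of \<theta> 1 s] by simp
      show "2 * (10 * s) \<le> \<rho>"
      proof -
        have "\<rho> > 0" by (rule zero_less_mult_pos[OF _ \<kappa>(1)]) (use s in linarith)
        then have "\<kappa> * \<rho> \<le> \<rho>" using \<kappa> by simp
        then show ?thesis using s by linarith
      qed
    qed
    also have "\<dots> = \<theta> * (6 * \<omega> * 20 ^ CARD('n)) / (20 * \<kappa>) * s ^ CARD('n)"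
      using s \<kappa> vol[of "2 * (10 * s)" y] by (simp add: power_mult_distrib divide_simps mult_ac)
    also have "\<dots> \<le> \<epsilon> * 10 * \<kappa> / (20 * \<kappa>) * s ^ CARD('n)"
      using \<theta> \<kappa> s by (intro mult_right_mono divide_right_mono) auto
    also have "\<dots> = \<epsilon> / 2 * s ^ CARD('n)" using \<kappa> by simp
    also have "measure lebesgue (\<Union>a\<in>F. cube a h \<inter> ?L) \<le> (\<Sum>a\<in>F. measure lebesgue (cube a h \<inter> ?L))"
      using F Lm by (intro measure_UNION_le) auto
    also have "\<dots> \<le> (\<Sum>a\<in>F. 8 * \<delta> / t * (2 * h) ^ CARD('n))" by (rule sum_mono[OF cubem])
    also have "\<dots> = 8 * \<delta> / t * 4 ^ CARD('n) * (real (card F) * (h/2) ^ CARD('n))"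
    proof -
      have "(2 * h) ^ CARD('n) = (4 * (h/2)) ^ CARD('n)" by simp
      also have "\<dots> = 4 ^ CARD('n) * (h/2) ^ CARD('n)" by (rule power_mult_distrib)
      finally show ?thesis by simp
    qed
    also have "\<dots> \<le> 8 * \<delta> / t * 4 ^ CARD('n) * (11 * s) ^ CARD('n)"
      using cF \<delta> t by (intro mult_left_mono) auto
    also have "\<dots> = 8 * \<delta> / t * 44 ^ CARD('n) * s ^ CARD('n)"
    proof -
      have "(44::real) ^ CARD('n) = (4 * 11) ^ CARD('n)" by simp
      then show ?thesis by (simp only: power_mult_distrib mult.assoc)
    qed
    also have "\<dots> \<le> \<epsilon> / 2 * s ^ CARD('n)"
      using \<delta>(3) t s by (intro mult_right_mono) (auto simp: field_simps)
    finally show "measure lebesgue (\<Omega> \<inter> ball y (10 * s) \<inter> ?L) \<le> \<epsilon> * s ^ CARD('n)" by simp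
  qed
qed

section \<open>Sets of small density and the stopping argument\<close>

text \<open>An argument with outer measure: the set to which it is applied depends on chosen cone
  directions, so only its covers are measurable. A Vitali covering by balls inside an open superset
  \<open>G\<close> yields a measurable cover of at most half the measure of \<open>G\<close>; taking
  \<open>G\<close> close to the infimum of the measures of all covers forces that infimum to be
  0.\<close>

lemma half_density_negligible:
  fixes S :: "'a::euclidean_space set"
  assumes bd: "bounded S"
    and half: "\<And>x r. x \<in> S \<Longrightarrow> r > 0 \<Longrightarrow> \<exists>d U. 0 < d \<and> d < r \<and> S \<inter> ball x d \<subseteq> U \<and> U \<in> lmeasurable \<and>
        measure lebesgue U \<le> measure lebesgue (ball x d) / 2"
  shows "negligible S"
proof -
  let ?\<mu> = "measure lebesgue"
  have step: "\<exists>V. S \<subseteq> V \<and> V \<in> lmeasurable \<and> ?\<mu> V \<le> ?\<mu> G / 2"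
    if G: "open G" "S \<subseteq> G" "G \<in> lmeasurable" for G
  proof -
    define K where "K = {(x,d). x \<in> S \<and> 0 < d \<and> ball x d \<subseteq> G \<and>
        (\<exists>U. S \<inter> ball x d \<subseteq> U \<and> U \<in> lmeasurable \<and> ?\<mu> U \<le> ?\<mu> (ball x d) / 2)}"
    obtain C where C: "countable C" "C \<subseteq> K"
      "pairwise (\<lambda>i j. disjnt (ball (fst i) (snd i)) (ball (fst j) (snd j))) C"
      "negligible (S - (\<Union>i \<in> C. ball (fst i) (snd i)))"
    proof (rule Vitali_covering_theorem_balls[of S K fst snd])
      fix x and d :: real
      assume x: "x \<in> S" and d: "d > 0"
      obtain k where k: "k > 0" "ball x k \<subseteq> G" using G x by (meson openE subsetD)
      obtain r U where r: "0 < r" "r < min d k" "S \<inter> ball x r \<subseteq> U" "U \<in> lmeasurable" "?\<mu> U \<le> ?\<mu> (ball x r) / 2"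
        using half[OF x, of "min d k"] d k by auto
      moreover have "ball x r \<subseteq> G" using r k by (meson dual_order.trans less_imp_le min.strict_boundedE subset_ball)
      ultimately show "\<exists>i. i \<in> K \<and> x \<in> ball (fst i) (snd i) \<and> snd i < d"
        by (intro exI[of _ "(x, r)"]) (use x in \<open>auto simp: K_def\<close>)
    qed
    have "\<forall>p\<in>C. \<exists>U. S \<inter> ball (fst p) (snd p) \<subseteq> U \<and> U \<in> lmeasurable \<and> ?\<mu> U \<le> ?\<mu> (ball (fst p) (snd p)) / 2"
    proof
      fix p assume "p \<in> C"
      then have "p \<in> K" using C(2) by blast
      then show "\<exists>U. S \<inter> ball (fst p) (snd p) \<subseteq> U \<and> U \<in> lmeasurable \<and> ?\<mu> U \<le> ?\<mu> (ball (fst p) (snd p)) / 2"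
        unfolding K_def by (simp add: case_prod_unfold)
    qed
    then obtain U where U: "\<And>p. p \<in> C \<Longrightarrow> S \<inter> ball (fst p) (snd p) \<subseteq> U p"
        "\<And>p. p \<in> C \<Longrightarrow> U p \<in> lmeasurable" "\<And>p. p \<in> C \<Longrightarrow> ?\<mu> (U p) \<le> ?\<mu> (ball (fst p) (snd p)) / 2"
      by metis
    have fin: "?\<mu> (\<Union>p\<in>I. U p) \<le> ?\<mu> G / 2" if I: "I \<subseteq> C" "finite I" for I
    proof -
      have "?\<mu> (\<Union>p\<in>I. U p) \<le> (\<Sum>p\<in>I. ?\<mu> (U p))"
        using I U by (intro measure_UNION_le) (auto dest: fmeasurableD)
      also have "\<dots> \<le> (\<Sum>p\<in>I. ?\<mu> (ball (fst p) (snd p)) / 2)"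
        using I U by (intro sum_mono) auto
      also have "\<dots> = (\<Sum>p\<in>I. ?\<mu> (ball (fst p) (snd p))) / 2" by (simp add: sum_divide_distrib)
      also have "(\<Sum>p\<in>I. ?\<mu> (ball (fst p) (snd p))) = ?\<mu> (\<Union>p\<in>I. ball (fst p) (snd p))"
        using I C(3) by (intro measure_UNION'[symmetric]) (auto intro: pairwise_mono)
      also have "\<dots> \<le> ?\<mu> G"
      proof (rule measure_mono_fmeasurable)
        have "ball (fst p) (snd p) \<subseteq> G" if "p \<in> I" for p
        proof -
          have "p \<in> K" using I C(2) that by blast
          then show ?thesis unfolding K_def by (simp add: case_prod_unfold)
        qed
        then show "(\<Union>p\<in>I. ball (fst p) (snd p)) \<subseteq> G" by blast
      qed (use I G in auto)
      finally show ?thesis by simp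
    qed
    have UC: "(\<Union>p\<in>C. U p) \<in> lmeasurable" "?\<mu> (\<Union>p\<in>C. U p) \<le> ?\<mu> G / 2"
      using fmeasurable_UN_bound[OF C(1) U(2) fin] measure_UN_bound[OF C(1) U(2) fin] by blast+
    let ?N = "S - (\<Union>i \<in> C. ball (fst i) (snd i))"
    have N: "?N \<in> lmeasurable" "?\<mu> ?N = 0"
      using C(4) by (auto simp: negligible_imp_measurable negligible_imp_measure0)
    have "?\<mu> (?N \<union> (\<Union>p\<in>C. U p)) \<le> ?\<mu> ?N + ?\<mu> (\<Union>p\<in>C. U p)"
      using N UC by (intro measure_Un_le) (auto dest: fmeasurableD)
    then have "?\<mu> (?N \<union> (\<Union>p\<in>C. U p)) \<le> ?\<mu> G / 2" using N UC by linarith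
    moreover have "S \<subseteq> ?N \<union> (\<Union>p\<in>C. U p)" using U(1) by blast
    ultimately show ?thesis using N UC by (intro exI[of _ "?N \<union> (\<Union>p\<in>C. U p)"]) auto
  qed
  define W where "W = {V. S \<subseteq> V \<and> V \<in> lmeasurable}"
  define m where "m = Inf (?\<mu> ` W)"
  have "cbox (-a) a \<in> W" if "S \<subseteq> cbox (-a) a" for a using that by (simp add: W_def)
  then have ne: "?\<mu> ` W \<noteq> {}" using bounded_subset_cbox_symmetric[OF bd] by blast
  have bb: "bdd_below (?\<mu> ` W)" by (intro bdd_belowI[of _ 0]) auto
  have m0: "m \<ge> 0" unfolding m_def using ne by (intro cInf_greatest) auto
  have "m = 0"
  proof (rule ccontr)
    assume "m \<noteq> 0"
    then have m: "m > 0" using m0 by simp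
    \<comment> \<open>The open set \<open>G\<close> below adds less than m / 3, and half of 4/3 m +
      m / 3 is still less than m.\<close>
    then obtain V where V: "V \<in> W" "?\<mu> V < 4/3 * m"
      using cInf_lessD[OF ne, of "4/3 * m"] by (auto simp: m_def)
    obtain G where G: "open G" "V \<subseteq> G" "G - V \<in> lmeasurable" "emeasure lebesgue (G - V) < ennreal (m/3)"
      using sets_lebesgue_outer_open[of V "m/3"] V m by (auto simp: W_def fmeasurableD)
    have "?\<mu> (G - V) < m/3"
      using G m by (metis emeasure_eq_measure2 ennreal_less_iff measure_nonneg)
    moreover have GV: "G = V \<union> (G - V)" using G by blast
    then have Gm: "G \<in> lmeasurable" using V G by (metis (no_types, lifting) W_def fmeasurable.Un mem_Collect_eq)
    have "?\<mu> G \<le> ?\<mu> V + ?\<mu> (G - V)"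
      using V G GV by (metis (no_types, lifting) W_def fmeasurableD measure_Un_le mem_Collect_eq)
    ultimately have "?\<mu> G / 2 < m" using V m by linarith
    moreover obtain V' where "S \<subseteq> V'" "V' \<in> lmeasurable" "?\<mu> V' \<le> ?\<mu> G / 2"
      using step[OF G(1) _ Gm] V G by (auto simp: W_def)
    ultimately show False
      using cInf_lower[OF _ bb, of "?\<mu> V'"] by (force simp: W_def m_def)
  qed
  have "\<exists>T. S \<subseteq> T \<and> T \<in> lmeasurable \<and> ?\<mu> T \<le> e" if "e > 0" for e
  proof -
    obtain V where "V \<in> W" "?\<mu> V < e"
      using cInf_lessD[OF ne, of e] \<open>e > 0\<close> \<open>m = 0\<close> by (auto simp: m_def)
    then show ?thesis by (auto simp: W_def intro!: exI[of _ V])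
  qed
  then show ?thesis by (simp add: negligible_outer_le)
qed

text \<open>Integration of 2 t |\<psi>| - t^2 \<le> |\<psi>|^2, which takes the place of the
  Cauchy-Schwarz inequality.\<close>

lemma average_norm_le_L2:
  fixes \<psi> :: "real^'n \<Rightarrow> 'b::euclidean_space"
  assumes int: "integrable lebesgue \<psi>" "integrable lebesgue (\<lambda>x. (norm (\<psi> x))\<^sup>2)"
    and S: "S \<in> lmeasurable" "measure lebesgue S > 0" and t: "t > 0" "t \<le> norm (average S \<psi>)"
  shows "t\<^sup>2 * measure lebesgue S \<le> (LINT x:S|lebesgue. (norm (\<psi> x))\<^sup>2)"
proof -
  let ?\<mu> = "measure lebesgue S"
  have sint: "set_integrable lebesgue S (\<lambda>x. norm (\<psi> x))" "set_integrable lebesgue S (\<lambda>x. (norm (\<psi> x))\<^sup>2)"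
    using int S by (auto intro!: integrable_imp_set_integrable)
  have "norm (average S \<psi> - 0) \<le> (LINT x:S|lebesgue. norm (\<psi> x - 0)) / ?\<mu>"
    by (rule average_diff_le[OF int(1) S])
  then have "t * ?\<mu> \<le> (LINT x:S|lebesgue. norm (\<psi> x))"
    using t S by (simp add: field_simps) (smt (verit) mult_right_mono mult.commute)
  moreover have "(LINT x:S|lebesgue. 2 * t * norm (\<psi> x) - t\<^sup>2) \<le> (LINT x:S|lebesgue. (norm (\<psi> x))\<^sup>2)"
  proof (rule set_integral_mono)
    show "set_integrable lebesgue S (\<lambda>x. 2 * t * norm (\<psi> x) - t\<^sup>2)"
      using sint S by (intro set_integral_diff set_integrable_mult_right set_integrable_const) auto
    fix x show "2 * t * norm (\<psi> x) - t\<^sup>2 \<le> (norm (\<psi> x))\<^sup>2"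
      using zero_le_power2[of "norm (\<psi> x) - t"] by (simp add: power2_diff algebra_simps)
  qed (use sint in auto)
  moreover have "(LINT x:S|lebesgue. 2 * t * norm (\<psi> x) - t\<^sup>2) = 2 * t * (LINT x:S|lebesgue. norm (\<psi> x)) - t\<^sup>2 * ?\<mu>"
    using sint S by (subst set_integral_diff) (auto intro!: set_integrable_mult_right set_integrable_const simp: set_integral_const)
  moreover have "2 * t * (t * ?\<mu>) \<le> 2 * t * (LINT x:S|lebesgue. norm (\<psi> x))"
    using calculation(1) t by (intro mult_left_mono) auto
  ultimately show ?thesis by (simp add: power2_eq_square)
qed

text \<open>A Calderon-Zygmund stopping argument in which dyadic subcubes are replaced by cubes that
  slide towards each point inside its cone, so that it works up to the boundary.\<close>

lemma level_set_measure_le: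
  fixes \<Omega> :: "(real^'n) set"
  assumes dom: "lipschitz_domain \<Omega>" and t: "t > 0" and \<epsilon>: "\<epsilon> > 0" and M: "M \<ge> 0"
  obtains \<delta> where "\<delta> > 0" "\<And>\<psi> :: real^'n \<Rightarrow> 'b::euclidean_space. mean_osc_le \<Omega> \<delta> \<psi> \<Longrightarrow>
      AE x in lebesgue. norm (\<psi> x) \<le> M \<Longrightarrow> norm (average \<Omega> \<psi>) \<le> \<delta> \<Longrightarrow>
      integrable lebesgue (\<lambda>x. (norm (\<psi> x))\<^sup>2) \<Longrightarrow>
      measure lebesgue (\<Omega> \<inter> {z. 2 * t < norm (\<psi> z)}) \<le> \<epsilon> * (LINT x:\<Omega>|lebesgue. (norm (\<psi> x))\<^sup>2)"
proof -
  have op: "open \<Omega>" and ne: "\<Omega> \<noteq> {}" and con: "connected \<Omega>" and bd: "bounded \<Omega>"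
    using dom by (auto simp: lipschitz_domain_def)
  have fr: "frontier \<Omega> \<noteq> {}" using ne bd by (auto simp: frontier_eq_empty)
  have \<Omega>m: "\<Omega> \<in> lmeasurable" using op bd by (simp add: lmeasurable_open)
  obtain \<rho> \<kappa> where \<rho>: "\<rho> > 0" and \<kappa>: "0 < \<kappa>" "\<kappa> \<le> 1"
    and cone: "\<And>y. y \<in> closure \<Omega> \<Longrightarrow> \<exists>e. interior_cone \<Omega> y \<rho> \<kappa> e"
    using uniform_interior_cone[OF dom] by metis
  obtain e where e: "\<And>y. y \<in> \<Omega> \<Longrightarrow> interior_cone \<Omega> y \<rho> \<kappa> (e y)"
    using cone closure_subset by (metis subsetD)
  let ?n = "CARD('n)"
  define n where "n = real CARD('n)"
  have n: "n \<ge> 1" by (simp add: n_def Suc_leI)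
  \<comment> \<open>The largest scale that the estimate in tents admits.\<close>
  define s0 where "s0 = \<kappa> * \<rho> / 40"
  have s0: "s0 > 0" using \<kappa> \<rho> by (simp add: s0_def)
  have s0\<rho>: "s0 < \<rho>"
  proof -
    have "\<kappa> * \<rho> \<le> 1 * \<rho>" using \<kappa> \<rho> by (intro mult_right_mono) auto
    then show ?thesis using \<rho> by (simp add: s0_def)
  qed
  \<comment> \<open>The cube at height \<open>s\<close> in the cone of \<open>y\<close>. It lies in
    a closed ball of half the radius of the ball that the cone provides at this height.\<close>
  define Q where "Q = (\<lambda>y s. cube (y + s *\<^sub>R e y) (\<kappa> * s / (2 * n)))"
  \<comment> \<open>Halving the scale cancels the factor 2^n in the volume of a cube:
    \<open>c * s ^ ?n\<close> is the volume of the cube that follows the one at scale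
    \<open>s\<close>.\<close>
  define c where "c = (\<kappa> / (2 * n)) ^ ?n"
  have c: "c > 0" using \<kappa> n by (simp add: c_def)
  have Q\<mu>: "measure lebesgue (Q y s) = 2 ^ ?n * c * s ^ ?n" if "s > 0" for y s
    using that \<kappa> n unfolding Q_def by (subst measure_cube) (auto simp: c_def power_mult_distrib power_divide)
  \<comment> \<open>The first term makes the level set fill at most half of a ball of radius 10 s,
    for the density argument. The second bounds it by \<epsilon> t^2 times the volume of the next
    cube, for the sum over the covering.\<close>
  define \<epsilon>1 where "\<epsilon>1 = min (unit_ball_vol n * 10 ^ ?n / 2) (\<epsilon> * t\<^sup>2 * c)"
  have \<epsilon>1: "\<epsilon>1 > 0" "\<epsilon>1 \<le> unit_ball_vol n * 10 ^ ?n / 2" "\<epsilon>1 \<le> \<epsilon> * t\<^sup>2 * c"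
    using \<epsilon> t c by (auto simp: \<epsilon>1_def n_def)
  obtain \<delta>1 where \<delta>1: "\<delta>1 > 0" and tent: "\<And>(\<psi> :: real^'n \<Rightarrow> 'b) y \<rho> e s. mean_osc_le \<Omega> \<delta>1 \<psi> \<Longrightarrow> y \<in> \<Omega> \<Longrightarrow>
      interior_cone \<Omega> y \<rho> \<kappa> e \<Longrightarrow> 0 < s \<Longrightarrow> 40 * s \<le> \<kappa> * \<rho> \<Longrightarrow>
      norm (average (cube (y + s *\<^sub>R e) (\<kappa> * s / (2 * real CARD('n)))) \<psi>) \<le> t \<Longrightarrow>
      measure lebesgue (\<Omega> \<inter> ball y (10 * s) \<inter> {z. 2 * t < norm (\<psi> z)}) \<le> \<epsilon>1 * s ^ CARD('n)"
    using level_set_in_tent[OF op fr \<kappa> t \<epsilon>1(1)] by metis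
  have \<kappa>s0: "\<kappa> * s0 > 0" using \<kappa> s0 by simp
  obtain \<delta>2 where \<delta>2: "\<delta>2 > 0" and init: "\<And>(\<psi> :: real^'n \<Rightarrow> 'b) p. mean_osc_le \<Omega> \<delta>2 \<psi> \<Longrightarrow> AE x in lebesgue. norm (\<psi> x) \<le> M \<Longrightarrow>
      norm (average \<Omega> \<psi>) \<le> \<delta>2 \<Longrightarrow> ball p (\<kappa> * s0) \<subseteq> \<Omega> \<Longrightarrow>
      norm (average (cube p (\<kappa> * s0 / (2 * real CARD('n)))) \<psi>) \<le> t"
    using inner_averages_small[OF op ne con bd \<kappa>s0 t M] by metis
  define \<delta> where "\<delta> = min \<delta>1 \<delta>2"
  have \<delta>: "\<delta> > 0" "\<delta> \<le> \<delta>1" "\<delta> \<le> \<delta>2" using \<delta>1 \<delta>2 by (auto simp: \<delta>_def)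
  show ?thesis
  proof (rule that[OF \<delta>(1)])
    fix \<psi> :: "real^'n \<Rightarrow> 'b"
    assume \<psi>: "mean_osc_le \<Omega> \<delta> \<psi>" and bdd: "AE x in lebesgue. norm (\<psi> x) \<le> M"
      and mean: "norm (average \<Omega> \<psi>) \<le> \<delta>" and sq: "integrable lebesgue (\<lambda>x. (norm (\<psi> x))\<^sup>2)"
    have int: "integrable lebesgue \<psi>" using \<psi> by (simp add: mean_osc_le_def)
    define Z where "Z = \<Omega> \<inter> {z. 2 * t < norm (\<psi> z)}"
    have Zm: "Z \<in> lmeasurable"
    proof -
      have [measurable]: "\<psi> \<in> borel_measurable lebesgue" using int by auto
      have "{z \<in> space lebesgue. 2 * t < norm (\<psi> z)} \<in> sets lebesgue" by measurable
      then show ?thesis unfolding Z_def using \<Omega>m by (intro fmeasurable_Int_fmeasurable) auto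
    qed
    define s where "s = (\<lambda>j::nat. s0 / 2 ^ j)"
    have s: "s j > 0" "s j \<le> s0" "s (Suc j) = s j / 2" for j
      using s0 by (auto simp: s_def field_simps)
    have in_cone: "ball (y + r *\<^sub>R e y) (\<kappa> * r) \<subseteq> \<Omega>" if "y \<in> \<Omega>" "0 < r" "r \<le> s0" for y r
      using that s0\<rho> \<rho> closure_subset by (intro interior_coneD[OF e[OF that(1)]]) auto
    have level: "measure lebesgue (Z \<inter> ball y (10 * s j)) \<le> \<epsilon>1 * s j ^ ?n"
      if "y \<in> \<Omega>" "norm (average (Q y (s j)) \<psi>) \<le> t" for y j
    proof -
      have "measure lebesgue (\<Omega> \<inter> ball y (10 * s j) \<inter> {z. 2 * t < norm (\<psi> z)}) \<le> \<epsilon>1 * s j ^ ?n"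
        using that s[of j] unfolding Q_def n_def
        by (intro tent[OF mean_osc_le_mono[OF \<psi> \<delta>(2)] _ e]) (auto simp: s0_def)
      then show ?thesis by (simp add: Z_def Int_ac)
    qed
    \<comment> \<open>At the points of \<open>Z1\<close> the averages step above \<open>t\<close>.
      At all other points of \<open>Z\<close> they start at or below \<open>t\<close> and, by
      induction on the scale, remain there.\<close>
    define Z1 where "Z1 = {y \<in> Z. \<exists>j. norm (average (Q y (s j)) \<psi>) \<le> t \<and> t < norm (average (Q y (s (Suc j))) \<psi>)}"
    have small: "norm (average (Q y (s j)) \<psi>) \<le> t" if y: "y \<in> Z - Z1" for y j
    proof (induction j)
      case 0
      have "y \<in> \<Omega>" using y by (simp add: Z_def)
      then have "norm (average (cube (y + s0 *\<^sub>R e y) (\<kappa> * s0 / (2 * real CARD('n)))) \<psi>) \<le> t"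
        using mean \<delta> s0 by (intro init[OF mean_osc_le_mono[OF \<psi> \<delta>(3)] bdd _ in_cone]) auto
      then show ?case by (simp add: Q_def s_def n_def)
    next
      case (Suc j)
      then show ?case using y unfolding Z1_def by force
    qed
    have null: "negligible (Z - Z1)"
    proof (rule half_density_negligible)
      show "bounded (Z - Z1)" using bd by (rule bounded_subset) (auto simp: Z_def)
      fix x :: "real^'n" and r :: real assume x: "x \<in> Z - Z1" and r: "r > 0"
      obtain j where j: "10 * s j < r"
      proof -
        have "(\<lambda>j. 10 * s j) \<longlonglongrightarrow> 10 * 0"
          unfolding s_def by (intro tendsto_intros LIMSEQ_divide_realpow_zero) auto
        then have "eventually (\<lambda>j. 10 * s j < r) sequentially"
          using r by (intro order_tendstoD(2)) auto
        then show ?thesis using that by (metis eventually_happens' sequentially_bot)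
      qed
      have xO: "x \<in> \<Omega>" using x by (simp add: Z_def)
      have "measure lebesgue (Z \<inter> ball x (10 * s j)) \<le> \<epsilon>1 * s j ^ ?n"
        by (rule level[OF xO small[OF x]])
      also have "\<dots> \<le> (unit_ball_vol n * 10 ^ ?n / 2) * s j ^ ?n"
        using \<epsilon>1 s[of j] by (intro mult_right_mono) auto
      also have "\<dots> = measure lebesgue (ball x (10 * s j)) / 2"
        using s[of j] by (simp add: content_ball n_def power_mult_distrib)
      finally show "\<exists>d U. 0 < d \<and> d < r \<and> (Z - Z1) \<inter> ball x d \<subseteq> U \<and> U \<in> lmeasurable \<and>
          measure lebesgue U \<le> measure lebesgue (ball x d) / 2"
        using j s[of j] Zm by (intro exI[of _ "10 * s j"] exI[of _ "Z \<inter> ball x (10 * s j)"])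
          (auto intro: fmeasurable.Int)
    qed
    have "\<forall>y\<in>Z1. \<exists>j. norm (average (Q y (s j)) \<psi>) \<le> t \<and> t < norm (average (Q y (s (Suc j))) \<psi>)"
      by (simp add: Z1_def)
    then obtain J where J: "\<And>y. y \<in> Z1 \<Longrightarrow> norm (average (Q y (s (J y))) \<psi>) \<le> t"
        "\<And>y. y \<in> Z1 \<Longrightarrow> t < norm (average (Q y (s (Suc (J y)))) \<psi>)"
      by metis
    have Z1O: "y \<in> \<Omega>" if "y \<in> Z1" for y using that by (simp add: Z1_def Z_def)
    \<comment> \<open>A ball of radius \<open>s (J y)\<close> contains the next cube, so that
      disjoint balls give disjoint cubes. The fivefold balls lie in the balls of radius
      \<open>10 * s (J y)\<close> in which the level set has been estimated.\<close>
    obtain C where C: "countable C" "C \<subseteq> Z1"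
      "pairwise (\<lambda>i j. disjnt (cball i (s (J i))) (cball j (s (J j)))) C"
      "Z1 \<subseteq> (\<Union>i\<in>C. cball i (5 * s (J i)))"
    proof (rule Vitali_covering_lemma_cballs[of Z1 "\<lambda>y. y" "\<lambda>y. s (J y)" Z1 s0])
      show "Z1 \<subseteq> (\<Union>i\<in>Z1. cball i (s (J i)))"
      proof
        fix y assume "y \<in> Z1"
        then show "y \<in> (\<Union>i\<in>Z1. cball i (s (J i)))" using s(1)[of "J y"] by (intro UN_I[of y]) auto
      qed
    qed (use s in auto)
    define E where "E = (LINT x:\<Omega>|lebesgue. (norm (\<psi> x))\<^sup>2)"
    have QJ: "Q y (s (Suc (J y))) \<subseteq> cball y (s (J y))" "Q y (s (Suc (J y))) \<subseteq> \<Omega>" if "y \<in> Z1" for y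
    proof -
      let ?s = "s (Suc (J y))"
      have en: "norm (e y) = 1" using e[OF Z1O[OF that]] by (rule interior_cone_norm)
      have "Q y ?s \<subseteq> cball (y + ?s *\<^sub>R e y) (\<kappa> * ?s / 2)"
        using cube_subset_cball[of "y + ?s *\<^sub>R e y" "\<kappa> * ?s / (2 * n)"] n by (simp add: Q_def n_def)
      moreover have \<kappa>s: "\<kappa> * ?s \<le> ?s" "0 < \<kappa> * ?s" using \<kappa> s[of "Suc (J y)"] by auto
      have "?s + \<kappa> * ?s / 2 \<le> s (J y)"
        using \<kappa>s s(1)[of "J y"] s(3)[of "J y"] by linarith
      then have "cball (y + ?s *\<^sub>R e y) (\<kappa> * ?s / 2) \<subseteq> cball y (s (J y))"
        using en s(1)[of "Suc (J y)"]
        by (intro cball_subset_cball_iff[THEN iffD2] disjI1) (simp add: dist_norm)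
      moreover have "cball (y + ?s *\<^sub>R e y) (\<kappa> * ?s / 2) \<subseteq> \<Omega>"
        using in_cone[OF Z1O[OF that], of ?s] s[of "Suc (J y)"] \<kappa>s by (force simp: subset_iff)
      ultimately show "Q y ?s \<subseteq> cball y (s (J y))" "Q y ?s \<subseteq> \<Omega>" by blast+
    qed
    have fin: "measure lebesgue (\<Union>y\<in>I. Z \<inter> ball y (10 * s (J y))) \<le> \<epsilon> * E" if I: "I \<subseteq> C" "finite I" for I
    proof -
      have IZ: "y \<in> Z1" if "y \<in> I" for y using that I C by blast
      have "measure lebesgue (\<Union>y\<in>I. Z \<inter> ball y (10 * s (J y))) \<le> (\<Sum>y\<in>I. measure lebesgue (Z \<inter> ball y (10 * s (J y))))"
        using I Zm by (intro measure_UNION_le) (auto intro!: fmeasurableD fmeasurable.Int)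
      also have "\<dots> \<le> (\<Sum>y\<in>I. \<epsilon> * (LINT x:Q y (s (Suc (J y)))|lebesgue. (norm (\<psi> x))\<^sup>2))"
      proof (rule sum_mono)
        fix y assume y: "y \<in> I"
        let ?s = "s (Suc (J y))"
        have "measure lebesgue (Z \<inter> ball y (10 * s (J y))) \<le> \<epsilon>1 * s (J y) ^ ?n"
          by (rule level[OF Z1O[OF IZ[OF y]] J(1)[OF IZ[OF y]]])
        also have "\<dots> \<le> (\<epsilon> * t\<^sup>2 * c) * s (J y) ^ ?n"
          using \<epsilon>1 s[of "J y"] by (intro mult_right_mono) auto
        also have "\<dots> = \<epsilon> * (t\<^sup>2 * measure lebesgue (Q y ?s))"
        proof -
          have "s (J y) = 2 * ?s" using s(3)[of "J y"] by simp
          then have "s (J y) ^ ?n = 2 ^ ?n * ?s ^ ?n" by (simp only: power_mult_distrib)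
          then show ?thesis unfolding Q\<mu>[OF s(1)] by simp
        qed
        also have "\<dots> \<le> \<epsilon> * (LINT x:Q y ?s|lebesgue. (norm (\<psi> x))\<^sup>2)"
          using J(2)[OF IZ[OF y]] \<epsilon> c s[of "Suc (J y)"] Q\<mu>[of ?s y] t
          by (intro mult_left_mono average_norm_le_L2[OF int sq]) (auto simp: Q_def)
        finally show "measure lebesgue (Z \<inter> ball y (10 * s (J y))) \<le> \<epsilon> * (LINT x:Q y ?s|lebesgue. (norm (\<psi> x))\<^sup>2)" .
      qed
      also have "\<dots> = \<epsilon> * (\<Sum>y\<in>I. LINT x:Q y (s (Suc (J y)))|lebesgue. (norm (\<psi> x))\<^sup>2)"
        by (simp add: sum_distrib_left)
      also have "(\<Sum>y\<in>I. LINT x:Q y (s (Suc (J y)))|lebesgue. (norm (\<psi> x))\<^sup>2)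
          = (LINT x:(\<Union>y\<in>I. Q y (s (Suc (J y))))|lebesgue. (norm (\<psi> x))\<^sup>2)"
      proof (rule set_integral_finite_UN_AE[symmetric])
        fix y z assume yz: "y \<in> I" "z \<in> I"
        have "Q y (s (Suc (J y))) \<inter> Q z (s (Suc (J z))) = {}" if "y \<noteq> z"
        proof -
          have "disjnt (cball y (s (J y))) (cball z (s (J z)))"
            using C(3) yz I that by (auto simp: pairwise_def)
          then show ?thesis using QJ(1)[OF IZ] yz unfolding disjnt_def by blast
        qed
        then show "AE x in lebesgue. x \<in> Q y (s (Suc (J y))) \<and> x \<in> Q z (s (Suc (J z))) \<longrightarrow> y = z"
          by (intro AE_I2) blast
      qed (use I sq in \<open>auto simp: Q_def intro!: integrable_imp_set_integrable\<close>)
      also have "\<dots> \<le> E" unfolding E_def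
        using QJ(2)[OF IZ] I sq \<Omega>m
        by (intro set_integral_mono_set integrable_imp_set_integrable sets.finite_UN) (auto simp: Q_def)
      finally show ?thesis using \<epsilon> by simp
    qed
    have UC: "(\<Union>y\<in>C. Z \<inter> ball y (10 * s (J y))) \<in> lmeasurable" "measure lebesgue (\<Union>y\<in>C. Z \<inter> ball y (10 * s (J y))) \<le> \<epsilon> * E"
    proof -
      have m: "Z \<inter> ball y (10 * s (J y)) \<in> lmeasurable" for y using Zm by (intro fmeasurable.Int) auto
      show "(\<Union>y\<in>C. Z \<inter> ball y (10 * s (J y))) \<in> lmeasurable" by (rule fmeasurable_UN_bound[OF C(1) m fin])
      show "measure lebesgue (\<Union>y\<in>C. Z \<inter> ball y (10 * s (J y))) \<le> \<epsilon> * E" by (rule measure_UN_bound[OF C(1) m fin])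
    qed
    have "Z \<subseteq> (Z - Z1) \<union> (\<Union>y\<in>C. Z \<inter> ball y (10 * s (J y)))"
    proof
      fix z assume z: "z \<in> Z"
      show "z \<in> (Z - Z1) \<union> (\<Union>y\<in>C. Z \<inter> ball y (10 * s (J y)))"
      proof (cases "z \<in> Z1")
        case True
        then obtain y where "y \<in> C" "dist y z \<le> 5 * s (J y)" using C(4) by auto
        then have "z \<in> ball y (10 * s (J y))" using s(1)[of "J y"] by simp
        then show ?thesis using \<open>y \<in> C\<close> z by blast
      qed (use z in auto)
    qed
    then have "measure lebesgue Z \<le> measure lebesgue ((Z - Z1) \<union> (\<Union>y\<in>C. Z \<inter> ball y (10 * s (J y))))"
      using Zm UC null by (intro measure_mono_fmeasurable fmeasurable.Un) (auto simp: negligible_imp_measurable dest: fmeasurableD)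
    also have "\<dots> \<le> measure lebesgue (Z - Z1) + measure lebesgue (\<Union>y\<in>C. Z \<inter> ball y (10 * s (J y)))"
      using UC null by (intro measure_Un_le) (auto simp: negligible_imp_sets dest: fmeasurableD)
    also have "measure lebesgue (Z - Z1) = 0" by (rule negligible_imp_measure0[OF null])
    finally show "measure lebesgue (\<Omega> \<inter> {z. 2 * t < norm (\<psi> z)}) \<le> \<epsilon> * (LINT x:\<Omega>|lebesgue. (norm (\<psi> x))\<^sup>2)"
      using UC by (simp add: Z_def E_def)
  qed
qed

text \<open>The bound \<open>M\<close> replaces the John--Nirenberg inequality; \<open>\<delta>\<close> depends on it.\<close>

proposition cube_integral_le_small_square_integral:
  fixes \<Omega> :: "(real^'n) set"
  assumes dom: "lipschitz_domain \<Omega>" and \<eta>: "\<eta> > 0" and M: "M \<ge> 0"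
  obtains \<delta> where "\<delta> > 0" "\<And>\<psi> :: real^'n \<Rightarrow> 'b::euclidean_space. mean_osc_le \<Omega> \<delta> \<psi> \<Longrightarrow>
      AE x in lebesgue. norm (\<psi> x) \<le> M \<Longrightarrow> norm (average \<Omega> \<psi>) \<le> \<delta> \<Longrightarrow>
      integrable lebesgue (\<lambda>x. (norm (\<psi> x))\<^sup>2) \<Longrightarrow> integrable lebesgue (\<lambda>x. norm (\<psi> x) ^ 3) \<Longrightarrow>
      (LINT x:\<Omega>|lebesgue. norm (\<psi> x) ^ 3) \<le> \<eta> * (LINT x:\<Omega>|lebesgue. (norm (\<psi> x))\<^sup>2)"
proof -
  \<comment> \<open>Where the norm is at most 2 t, its cube is at most \<eta> / 2 times its
    square.\<close>
  define t where "t = \<eta> / 4"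
  \<comment> \<open>The remaining set contributes at most M^3 times its measure; the added 1 covers
    \<open>M\<close> = 0.\<close>
  define \<epsilon> where "\<epsilon> = \<eta> / (2 * (M ^ 3 + 1))"
  have t: "t > 0" using \<eta> by (simp add: t_def)
  have \<epsilon>: "\<epsilon> > 0" "M ^ 3 * \<epsilon> \<le> \<eta> / 2"
  proof -
    have M3: "M ^ 3 \<ge> 0" using M by simp
    then show "\<epsilon> > 0" using \<eta> by (simp add: \<epsilon>_def add_nonneg_pos)
    then have "M ^ 3 * \<epsilon> \<le> (M ^ 3 + 1) * \<epsilon>" by simp
    also have "M ^ 3 + 1 \<noteq> 0" using M3 by linarith
    then have "(M ^ 3 + 1) * \<epsilon> = \<eta> / 2" unfolding \<epsilon>_def by (simp only: times_divide_eq_right mult_divide_mult_cancel_left_if mult.commute[of 2] nonzero_mult_divide_mult_cancel_left if_False)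
    finally show "M ^ 3 * \<epsilon> \<le> \<eta> / 2" .
  qed
  obtain \<delta> where \<delta>: "\<delta> > 0" and lev: "\<And>\<psi> :: real^'n \<Rightarrow> 'b. mean_osc_le \<Omega> \<delta> \<psi> \<Longrightarrow>
      AE x in lebesgue. norm (\<psi> x) \<le> M \<Longrightarrow> norm (average \<Omega> \<psi>) \<le> \<delta> \<Longrightarrow>
      integrable lebesgue (\<lambda>x. (norm (\<psi> x))\<^sup>2) \<Longrightarrow>
      measure lebesgue (\<Omega> \<inter> {z. 2 * t < norm (\<psi> z)}) \<le> \<epsilon> * (LINT x:\<Omega>|lebesgue. (norm (\<psi> x))\<^sup>2)"
    using level_set_measure_le[OF dom t \<epsilon>(1) M] by metis
  show ?thesis
  proof (rule that[OF \<delta>])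
    fix \<psi> :: "real^'n \<Rightarrow> 'b"
    assume \<psi>: "mean_osc_le \<Omega> \<delta> \<psi>" and bdd: "AE x in lebesgue. norm (\<psi> x) \<le> M" and mean: "norm (average \<Omega> \<psi>) \<le> \<delta>"
      and sq: "integrable lebesgue (\<lambda>x. (norm (\<psi> x))\<^sup>2)" and cu: "integrable lebesgue (\<lambda>x. norm (\<psi> x) ^ 3)"
    have \<Omega>m: "\<Omega> \<in> lmeasurable" using dom by (simp add: lmeasurable_open lipschitz_domain_def)
    define Z where "Z = \<Omega> \<inter> {z. 2 * t < norm (\<psi> z)}"
    have Zm: "Z \<in> lmeasurable"
    proof -
      have [measurable]: "\<psi> \<in> borel_measurable lebesgue" using \<psi> by (auto simp: mean_osc_le_def)
      have "{z \<in> space lebesgue. 2 * t < norm (\<psi> z)} \<in> sets lebesgue" by measurable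
      then show ?thesis unfolding Z_def using \<Omega>m by (intro fmeasurable_Int_fmeasurable) auto
    qed
    have i2: "set_integrable lebesgue \<Omega> (\<lambda>x. (norm (\<psi> x))\<^sup>2)" "set_integrable lebesgue \<Omega> (\<lambda>x. norm (\<psi> x) ^ 3)"
      using sq cu \<Omega>m by (auto intro!: integrable_imp_set_integrable)
    have iZ: "set_integrable lebesgue \<Omega> (\<lambda>x. M ^ 3 * indicator Z x)"
      using Zm \<Omega>m by (intro set_integrable_mult_right integrable_imp_set_integrable) (auto simp: fmeasurable_def)
    have "(LINT x:\<Omega>|lebesgue. norm (\<psi> x) ^ 3) \<le> (LINT x:\<Omega>|lebesgue. 2 * t * (norm (\<psi> x))\<^sup>2 + M ^ 3 * indicator Z x)"
    proof (rule set_integral_mono_AE)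
      show "set_integrable lebesgue \<Omega> (\<lambda>x. 2 * t * (norm (\<psi> x))\<^sup>2 + M ^ 3 * indicator Z x)"
        using i2 iZ by (intro set_integral_add set_integrable_mult_right) auto
      show "AE x \<in> \<Omega> in lebesgue. norm (\<psi> x) ^ 3 \<le> 2 * t * (norm (\<psi> x))\<^sup>2 + M ^ 3 * indicator Z x"
        using bdd
      proof eventually_elim
        case (elim x)
        show ?case
        proof (intro impI, cases "x \<in> Z")
          case True
          have "norm (\<psi> x) ^ 3 \<le> M ^ 3" using elim by (intro power_mono) auto
          then show "norm (\<psi> x) ^ 3 \<le> 2 * t * (norm (\<psi> x))\<^sup>2 + M ^ 3 * indicator Z x"
            using True t by simp (smt (verit) mult_nonneg_nonneg zero_le_power2)
        next
          case False
          assume "x \<in> \<Omega>"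
          then have "norm (\<psi> x) \<le> 2 * t" using False by (simp add: Z_def)
          then have "norm (\<psi> x) * (norm (\<psi> x))\<^sup>2 \<le> 2 * t * (norm (\<psi> x))\<^sup>2" by (intro mult_right_mono) auto
          then show "norm (\<psi> x) ^ 3 \<le> 2 * t * (norm (\<psi> x))\<^sup>2 + M ^ 3 * indicator Z x"
            using False by (simp add: power3_eq_cube power2_eq_square mult.assoc)
        qed
      qed
    qed (use i2 in auto)
    also have "\<dots> = 2 * t * (LINT x:\<Omega>|lebesgue. (norm (\<psi> x))\<^sup>2) + M ^ 3 * (LINT x:\<Omega>|lebesgue. indicator Z x)"
      using i2 iZ by (subst set_integral_add) auto
    also have "(LINT x:\<Omega>|lebesgue. indicator Z x) = measure lebesgue Z"
    proof -
      have "(LINT x:\<Omega>|lebesgue. indicator Z x) = (LINT x|lebesgue. indicator Z x)"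
        unfolding set_lebesgue_integral_def
        by (intro Bochner_Integration.integral_cong) (auto simp: Z_def indicator_def)
      also have "\<dots> = measure lebesgue (Z \<inter> space lebesgue)" by (rule Bochner_Integration.integral_indicator)
      finally show ?thesis by simp
    qed
    also have "M ^ 3 * measure lebesgue Z \<le> M ^ 3 * (\<epsilon> * (LINT x:\<Omega>|lebesgue. (norm (\<psi> x))\<^sup>2))"
      using lev[OF \<psi> bdd mean sq] M unfolding Z_def by (intro mult_left_mono) auto
    also have "\<dots> \<le> \<eta> / 2 * (LINT x:\<Omega>|lebesgue. (norm (\<psi> x))\<^sup>2)"
    proof -
      have "(LINT x:\<Omega>|lebesgue. (norm (\<psi> x))\<^sup>2) \<ge> 0"
        unfolding set_lebesgue_integral_def by (rule integral_nonneg_AE) auto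
      from mult_right_mono[OF \<epsilon>(2) this] show ?thesis by (simp add: mult.assoc)
    qed
    finally show "(LINT x:\<Omega>|lebesgue. norm (\<psi> x) ^ 3) \<le> \<eta> * (LINT x:\<Omega>|lebesgue. (norm (\<psi> x))\<^sup>2)"
      by (simp add: t_def)
  qed
qed

section \<open>Test functions and uniqueness of weak gradients\<close>

text \<open>For p = 1 this is the standard smooth function exp(-1/x) for x > 0, extended by 0.
  Polynomials in 1/x are included because differentiation produces them.\<close>

definition flat :: "real poly \<Rightarrow> real \<Rightarrow> real" where
  "flat p x = (if x > 0 then poly p (1 / x) * exp (- (1 / x)) else 0)"

lemma poly_times_exp_tendsto_0: "((\<lambda>y::real. poly p y * exp (- y)) \<longlongrightarrow> 0) at_top"
proof -
  have "((\<lambda>y. \<Sum>i\<le>degree p. coeff p i * (y ^ i / exp y)) \<longlongrightarrow> (\<Sum>i\<le>degree p. coeff p i * 0)) at_top"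
    by (intro tendsto_intros tendsto_power_div_exp_0)
  then show ?thesis by (simp add: poly_altdef sum_distrib_right exp_minus divide_inverse mult.assoc)
qed

text \<open>In the variable y = 1/x the derivative is -y^2 d/dy, which turns p(y) exp(-y) into y^2
  (p - p')(y) exp(-y). At 0 the exponential beats every polynomial in 1/x.\<close>

lemma flat_has_derivative: "(flat p has_real_derivative flat (monom 1 2 * (p - pderiv p)) x) (at x)"
proof (cases "x = 0")
  case True
  have "((\<lambda>h. flat p h / h) \<longlongrightarrow> 0) (at_right 0)"
  proof -
    have "((\<lambda>h. poly (pCons 0 p) (inverse h) * exp (- inverse h)) \<longlongrightarrow> 0) (at_right (0::real))"
      by (rule filterlim_compose[OF poly_times_exp_tendsto_0 filterlim_inverse_at_top_right])
    then show ?thesis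
      by (rule Lim_transform_eventually)
         (auto simp: eventually_at_right_less flat_def field_simps intro!: eventually_mono[OF eventually_at_right_less])
  qed
  moreover have "((\<lambda>h. flat p h / h) \<longlongrightarrow> 0) (at_left 0)"
    by (rule Lim_transform_eventually[OF tendsto_const])
       (simp add: flat_def eventually_at_filter)
  ultimately have "((\<lambda>h. flat p h / h) \<longlongrightarrow> 0) (at 0)" by (simp add: filterlim_split_at)
  then show ?thesis using True by (simp add: DERIV_def flat_def)
next
  case False
  show ?thesis
  proof (cases "x > 0")
    case True
    have "((\<lambda>x. poly p (1 / x) * exp (- (1 / x))) has_real_derivative flat (monom 1 2 * (p - pderiv p)) x) (at x)"
      using True by (auto intro!: derivative_eq_intros DERIV_chain'[OF _ poly_DERIV]
          simp: flat_def poly_monom power2_eq_square field_simps)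
    then show ?thesis
      by (rule DERIV_cong_ev[THEN iffD1, OF refl _ refl, rotated])
         (use True in \<open>auto simp: flat_def intro!: eventually_mono[OF eventually_nhds_in_open[of "{0<..}"]]\<close>)
  next
    case False
    then have "x < 0" using \<open>x \<noteq> 0\<close> by simp
    have "((\<lambda>x. 0) has_real_derivative flat (monom 1 2 * (p - pderiv p)) x) (at x)"
      using \<open>x < 0\<close> by (simp add: flat_def)
    then show ?thesis
      by (rule DERIV_cong_ev[THEN iffD1, OF refl _ refl, rotated])
         (use \<open>x < 0\<close> in \<open>auto simp: flat_def intro!: eventually_mono[OF eventually_nhds_in_open[of "{..<0}"]]\<close>)
  qed
qed

text \<open>Being closed under directional derivatives, this algebra consists of \<open>C\<^sup>\<infinity>\<close> functions.\<close>

inductive flat_algebra :: "('a::euclidean_space \<Rightarrow> real) \<Rightarrow> bool" where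
  const: "flat_algebra (\<lambda>x. c)"
| flat: "flat_algebra (\<lambda>x. flat p (m * (x \<bullet> e) + c))"
| add: "flat_algebra f \<Longrightarrow> flat_algebra g \<Longrightarrow> flat_algebra (\<lambda>x. f x + g x)"
| mult: "flat_algebra f \<Longrightarrow> flat_algebra g \<Longrightarrow> flat_algebra (\<lambda>x. f x * g x)"

lemma flat_algebra_derivative:
  assumes "flat_algebra f"
  shows "\<exists>D. (\<forall>x. (f has_derivative D x) (at x)) \<and> (\<forall>v. flat_algebra (\<lambda>x. D x v))"
  using assms
proof induction
  case (const c)
  show ?case by (rule exI[of _ "\<lambda>x v. 0"]) (auto intro: flat_algebra.const)
next
  case (flat p m e c)
  let ?q = "monom 1 2 * (p - pderiv p)"
  have "((\<lambda>x. flat p (m * (x \<bullet> e) + c)) has_derivative (\<lambda>v. flat ?q (m * (x \<bullet> e) + c) * (m * (v \<bullet> e)))) (at x)" for x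
    by (rule has_derivative_compose[OF _ flat_has_derivative[unfolded has_field_derivative_def], of "\<lambda>x. m * (x \<bullet> e) + c"])
       (auto intro!: derivative_eq_intros)
  then show ?case
    by (intro exI[of _ "\<lambda>x v. flat ?q (m * (x \<bullet> e) + c) * (m * (v \<bullet> e))"])
       (auto intro: flat_algebra.intros)
next
  case (add f g)
  then obtain D E where "\<forall>x. (f has_derivative D x) (at x)" "\<forall>v. flat_algebra (\<lambda>x. D x v)"
    "\<forall>x. (g has_derivative E x) (at x)" "\<forall>v. flat_algebra (\<lambda>x. E x v)" by blast
  then show ?case
    by (intro exI[of _ "\<lambda>x v. D x v + E x v"]) (auto intro!: has_derivative_add flat_algebra.add)
next
  case (mult f g)
  then obtain D E where "\<forall>x. (f has_derivative D x) (at x)" "\<forall>v. flat_algebra (\<lambda>x. D x v)"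
    "\<forall>x. (g has_derivative E x) (at x)" "\<forall>v. flat_algebra (\<lambda>x. E x v)" by blast
  then show ?case using mult.hyps
    by (intro exI[of _ "\<lambda>x v. f x * E x v + D x v * g x"]) (auto intro!: has_derivative_mult flat_algebra.intros)
qed

lemma flat_algebra_C_k: "flat_algebra f \<Longrightarrow> C_k k f"
proof (induction k arbitrary: f)
  case 0
  then obtain D where "\<forall>x. (f has_derivative D x) (at x)" using flat_algebra_derivative by blast
  then show ?case by (auto intro: has_derivative_continuous continuous_at_imp_continuous_on)
next
  case (Suc k)
  then obtain D where D: "\<forall>x. (f has_derivative D x) (at x)" "\<forall>v. flat_algebra (\<lambda>x. D x v)"
    using flat_algebra_derivative by blast
  then have "(\<lambda>x. frechet_derivative f (at x) v) = (\<lambda>x. D x v)" for v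
    by (metis frechet_derivative_at)
  then show ?case using D Suc.IH by (auto simp: differentiable_def)
qed

lemma flat_algebra_prod: "finite I \<Longrightarrow> (\<And>i. i \<in> I \<Longrightarrow> flat_algebra (f i)) \<Longrightarrow> flat_algebra (\<lambda>x. \<Prod>i\<in>I. f i x)"
  by (induction I rule: finite_induct) (auto intro: flat_algebra.intros)

section \<open>Bump functions and the fundamental lemma of the calculus of variations\<close>

text \<open>As \<open>m\<close> grows, exp(-1/(m y)) tends to 1 for every y > 0. Thus the bumps, all
  bounded by 1, converge to the indicator of the open box, while their supports stay in the closed
  one.\<close>

definition bump :: "'a::euclidean_space \<Rightarrow> 'a \<Rightarrow> nat \<Rightarrow> 'a \<Rightarrow> real" where
  "bump a b m x = (\<Prod>i\<in>Basis. flat 1 (real m * (x \<bullet> i) + - real m * (a \<bullet> i)) * flat 1 (- real m * (x \<bullet> i) + real m * (b \<bullet> i)))"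

lemma flat1_bounds: "0 \<le> flat 1 x" "flat 1 x \<le> 1"
  by (auto simp: flat_def)

lemma bump_bounds: "0 \<le> bump a b m x" "bump a b m x \<le> 1"
  unfolding bump_def by (auto intro!: prod_nonneg prod_le_1 mult_nonneg_nonneg mult_le_one flat1_bounds)

lemma bump_eq_0: "x \<notin> box a b \<Longrightarrow> bump a b m x = 0"
proof -
  assume "x \<notin> box a b"
  then obtain i where i: "i \<in> Basis" "x \<bullet> i \<le> a \<bullet> i \<or> b \<bullet> i \<le> x \<bullet> i" by (auto simp: mem_box not_less)
  then have "real m * (x \<bullet> i) + - real m * (a \<bullet> i) \<le> 0 \<or> - real m * (x \<bullet> i) + real m * (b \<bullet> i) \<le> 0"
    by (auto simp: mult_left_mono)
  then show ?thesis using i unfolding bump_def by (intro prod_zero) (auto simp: flat_def intro!: bexI[of _ i])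
qed

lemma bump_test_function:
  assumes "cbox a b \<subseteq> \<Omega>" shows "test_function \<Omega> (bump a b m)"
  unfolding test_function_def
proof (intro conjI allI exI)
  show "C_k k (bump a b m)" for k
    unfolding bump_def[abs_def]
    by (intro flat_algebra_C_k flat_algebra_prod flat_algebra.mult flat_algebra.flat) auto
  show "x \<notin> cbox a b \<longrightarrow> bump a b m x = 0" for x
    using bump_eq_0 box_subset_cbox by blast
qed (use assms in auto)

lemma bump_tendsto: "(\<lambda>m. bump a b m x) \<longlonglongrightarrow> indicator (box a b) x"
proof (cases "x \<in> box a b")
  case True
  have lim: "(\<lambda>m. flat 1 (real m * y)) \<longlonglongrightarrow> 1" if "y > 0" for y
  proof -
    have "(\<lambda>m. exp (- (inverse y * inverse (real m)))) \<longlonglongrightarrow> exp (- (inverse y * 0))"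
      by (intro tendsto_intros LIMSEQ_inverse_real_of_nat lim_inverse_n)
    then have "(\<lambda>m. exp (- (inverse y * inverse (real m)))) \<longlonglongrightarrow> 1" by simp
    then show ?thesis
      by (rule Lim_transform_eventually)
         (use that in \<open>auto simp: flat_def field_simps intro!: eventually_mono[OF eventually_gt_at_top[of 0]]\<close>)
  qed
  have "(\<lambda>m. bump a b m x) \<longlonglongrightarrow> (\<Prod>i\<in>(Basis::'a set). 1 * 1)"
    unfolding bump_def
  proof (intro tendsto_prod tendsto_mult)
    fix i :: 'a assume i: "i \<in> Basis"
    then have "0 < x \<bullet> i - a \<bullet> i" "0 < b \<bullet> i - x \<bullet> i" using True by (auto simp: mem_box)
    from lim[OF this(1)] lim[OF this(2)]
    show "(\<lambda>m. flat 1 (real m * (x \<bullet> i) + - real m * (a \<bullet> i))) \<longlonglongrightarrow> 1"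
      "(\<lambda>m. flat 1 (- real m * (x \<bullet> i) + real m * (b \<bullet> i))) \<longlonglongrightarrow> 1"
      by (simp_all add: algebra_simps)
  qed
  then show ?thesis using True by simp
qed (simp add: bump_eq_0)

text \<open>For a Borel representative of \<open>f\<close>, the Borel sets over which its integral
  vanishes form a Dynkin system, and the boxes are an intersection-stable generator. Complements
  require the integral over the whole space, which growing boxes provide.\<close>

lemma AE_zero_if_box_integrals_zero:
  fixes f :: "'a::euclidean_space \<Rightarrow> real"
  assumes int: "integrable lebesgue f" and zero: "\<And>a b. (LINT x:box a b|lebesgue. f x) = 0"
  shows "AE x in lebesgue. f x = 0"
proof -
  obtain g where g: "g \<in> borel_measurable lborel" "AE x in lborel. f x = g x"
    using completion_ex_borel_measurable_real[of f lborel] int by auto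
  have AEg: "AE x in lebesgue. f x = g x" using g(2) by (rule AE_completion)
  have gl: "g \<in> borel_measurable lebesgue" using g(1) by (rule measurable_completion)
  then have "integrable lebesgue g" using int AEg by (metis integrable_cong_AE borel_measurable_integrable)
  then have gi: "integrable lborel g" using g(1) by (simp add: integrable_completion)
  have gz: "(LINT x:A|lborel. g x) = (LINT x:A|lebesgue. f x)" if "A \<in> sets borel" for A
  proof -
    have "(LINT x:A|lborel. g x) = (LINT x:A|lebesgue. g x)"
      unfolding set_lebesgue_integral_def using g that by (intro integral_completion[symmetric]) auto
    also have "\<dots> = (LINT x:A|lebesgue. f x)"
      unfolding set_lebesgue_integral_def
    proof (rule integral_cong_AE)
      show "AE x in lebesgue. indicat_real A x *\<^sub>R g x = indicat_real A x *\<^sub>R f x" using AEg by eventually_elim simp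
      have ms: "(\<lambda>x. indicat_real A x *\<^sub>R h x) \<in> borel_measurable lebesgue" if "h \<in> borel_measurable lebesgue" for h :: "'a \<Rightarrow> real"
        using \<open>A \<in> sets borel\<close> that by (intro borel_measurable_scaleR borel_measurable_indicator) auto
      show "(\<lambda>x. indicat_real A x *\<^sub>R g x) \<in> borel_measurable lebesgue"
        "(\<lambda>x. indicat_real A x *\<^sub>R f x) \<in> borel_measurable lebesgue"
        using ms[OF gl] ms[OF borel_measurable_integrable[OF int]] .
    qed
    finally show ?thesis .
  qed
  have set_int: "set_integrable lborel A g" if "A \<in> sets borel" for A
    using gi that unfolding set_integrable_def by (intro integrable_mult_indicator) auto
  let ?E = "range (\<lambda>(a, b). box a b :: 'a set)"
  let ?A = "\<lambda>n::nat. box (- (real n *\<^sub>R One)) (real n *\<^sub>R One) :: 'a set"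
  have tot: "(LINT x:UNIV|lborel. g x) = 0"
  proof -
    have "(\<lambda>n. LINT x:?A n|lborel. g x) \<longlonglongrightarrow> (LINT x:(\<Union>n. ?A n)|lborel. g x)"
    proof (rule set_integral_cont_up)
      show "incseq ?A" by (auto simp: incseq_def mem_box) (smt (verit) of_nat_mono)+
      show "set_integrable lborel (\<Union>n. ?A n) g" by (rule set_int) auto
    qed auto
    then show ?thesis using zero gz by (simp add: UN_box_eq_UNIV LIMSEQ_unique)
  qed
  have E: "Int_stable ?E" "?E \<subseteq> Pow UNIV" by (auto simp: Int_stable_def box_Int_box)
  have "(LINT x:A|lborel. g x) = 0" if "A \<in> sigma_sets UNIV ?E" for A
    using E that
  proof (induction rule: sigma_sets_induct_disjoint)
    case (basic A) then show ?case using zero gz by auto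
  next
    case empty then show ?case by (simp add: set_lebesgue_integral_def)
  next
    case (compl A)
    then have A: "A \<in> sets borel" by (simp add: borel_eq_box)
    have "(LINT x:A \<union> (UNIV - A)|lborel. g x) = (LINT x:A|lborel. g x) + (LINT x:UNIV - A|lborel. g x)"
      using A by (intro set_integral_Un set_int) auto
    then show ?case using compl tot by simp
  next
    case (union A)
    then have A: "A i \<in> sets borel" for i by (simp add: borel_eq_box image_subset_iff)
    have "(LINT x:(\<Union>i. A i)|lborel. g x) = (\<Sum>i. LINT x:A i|lborel. g x)"
      using A union by (intro lebesgue_integral_countable_add set_int sets.countable_UN) (auto simp: disjoint_family_on_def)
    then show ?case using union by simp
  qed
  then have "(LINT x:A|lborel. g x) = 0" if "A \<in> sets lborel" for A
    using that by (simp add: borel_eq_box)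
  then have "AE x in lborel. g x = 0" by (rule sigma_finite_measure.density_zero[OF sigma_finite_lborel gi])
  then have "AE x in lebesgue. g x = 0" by (rule AE_completion)
  then show ?thesis using AEg by eventually_elim simp
qed

text \<open>By dominated convergence of the bumps, \<open>G\<close> has integral 0 over every open
  box whose closed box lies in \<open>\<Omega>\<close>. Cut off at such a closed box,
  \<open>G\<close> is integrable on the whole space and all its box integrals vanish. Countably many
  of these closed boxes fill \<open>\<Omega>\<close>.\<close>

lemma fundamental_lemma:
  fixes G :: "'a::euclidean_space \<Rightarrow> real"
  assumes op: "open \<Omega>" and G: "\<And>K. compact K \<Longrightarrow> K \<subseteq> \<Omega> \<Longrightarrow> G absolutely_integrable_on K"
    and test: "\<And>\<phi>. test_function \<Omega> \<phi> \<Longrightarrow> (\<integral>x. G x * \<phi> x \<partial>(lebesgue_on \<Omega>)) = 0"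
  shows "AE x in lebesgue_on \<Omega>. G x = 0"
proof -
  have \<Omega>s: "\<Omega> \<in> sets lebesgue" using op by simp
  have box0: "(LINT x:box a b|lebesgue. G x) = 0" if ab: "cbox a b \<subseteq> \<Omega>" for a b
  proof -
    have "(\<lambda>m. \<integral>x. indicator \<Omega> x * (G x * bump a b m x) \<partial>lebesgue) \<longlonglongrightarrow> (\<integral>x. indicator (box a b) x * G x \<partial>lebesgue)"
    proof (rule integral_dominated_convergence[where w = "\<lambda>x. norm (indicator (cbox a b) x *\<^sub>R G x)"])
      have i: "integrable lebesgue (\<lambda>x. indicator (cbox a b) x *\<^sub>R G x)"
        using G[OF compact_cbox ab] by (simp add: set_integrable_def)
      then show "integrable lebesgue (\<lambda>x. norm (indicator (cbox a b) x *\<^sub>R G x))" by (rule integrable_norm)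
      have "integrable lebesgue (\<lambda>x. indicator (box a b) x *\<^sub>R (indicator (cbox a b) x *\<^sub>R G x))"
        by (rule integrable_mult_indicator[OF _ i]) simp
      moreover have "(\<lambda>x. indicator (box a b) x *\<^sub>R (indicator (cbox a b) x *\<^sub>R G x)) = (\<lambda>x. indicator (box a b) x * G x)"
        using box_subset_cbox[of a b] by (auto simp: indicator_def fun_eq_iff)
      ultimately show "(\<lambda>x. indicator (box a b) x * G x) \<in> borel_measurable lebesgue" by auto
      fix m
      have c: "continuous_on UNIV (bump a b m)"
        using bump_test_function[OF ab] unfolding test_function_def by (metis C_k.simps(1))
      have "bump a b m \<in> borel_measurable lebesgue"
        using borel_measurable_continuous_onI[OF c] by (simp add: measurable_completion)
      then have "(\<lambda>x. (indicator (cbox a b) x *\<^sub>R G x) * bump a b m x) \<in> borel_measurable lebesgue"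
        using i by (intro borel_measurable_times) auto
      moreover have eq: "indicator \<Omega> x * (G x * bump a b m x) = (indicator (cbox a b) x *\<^sub>R G x) * bump a b m x" for x
        using ab bump_eq_0[of x a b m] box_subset_cbox[of a b] by (cases "x \<in> box a b") (auto simp: indicator_def)
      ultimately show "(\<lambda>x. indicator \<Omega> x * (G x * bump a b m x)) \<in> borel_measurable lebesgue" by (simp only: eq)
      show "AE x in lebesgue. norm (indicat_real \<Omega> x * (G x * bump a b m x)) \<le> norm (indicat_real (cbox a b) x *\<^sub>R G x)"
        unfolding eq using bump_bounds[of a b m] by (intro AE_I2) (simp add: abs_mult mult_left_le)
      show "AE x in lebesgue. (\<lambda>m. indicat_real \<Omega> x * (G x * bump a b m x)) \<longlonglongrightarrow> indicat_real (box a b) x * G x"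
      proof (rule AE_I2)
        fix x
        have "(\<lambda>m. indicat_real \<Omega> x * (G x * bump a b m x)) \<longlonglongrightarrow> indicat_real \<Omega> x * (G x * indicator (box a b) x)"
          by (intro tendsto_intros bump_tendsto)
        moreover have "indicat_real \<Omega> x * (G x * indicator (box a b) x) = indicat_real (box a b) x * G x"
          using ab box_subset_cbox by (auto simp: indicator_def)
        ultimately show "(\<lambda>m. indicat_real \<Omega> x * (G x * bump a b m x)) \<longlonglongrightarrow> indicat_real (box a b) x * G x" by simp
      qed
    qed
    moreover have "(\<integral>x. indicator \<Omega> x * (G x * bump a b m x) \<partial>lebesgue) = 0" for m
      using test[OF bump_test_function[OF ab], of m] \<Omega>s by (simp add: integral_restrict_space)
    ultimately show ?thesis by (simp add: set_lebesgue_integral_def LIMSEQ_const_iff)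
  qed
  have "AE x in lebesgue. x \<in> cbox c d \<longrightarrow> G x = 0" if cd: "cbox c d \<subseteq> \<Omega>" for c d
  proof -
    have i: "integrable lebesgue (\<lambda>x. indicator (cbox c d) x *\<^sub>R G x)"
      using G[OF compact_cbox cd] by (simp add: set_integrable_def)
    have "(LINT x:box a b|lebesgue. indicator (cbox c d) x *\<^sub>R G x) = 0" for a b
    proof -
      obtain l u where lu: "cbox a b \<inter> cbox c d = cbox l u" "box a b \<inter> box c d = box l u"
        unfolding Int_interval box_Int_box by blast
      have "(LINT x:box a b|lebesgue. indicator (cbox c d) x *\<^sub>R G x) = (LINT x:box l u|lebesgue. G x)"
        unfolding set_lebesgue_integral_def
      proof (rule integral_cong_AE)
        \<comment> \<open>The boundary of a box is a null set, so the closed box may be exchanged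
          for the open one, whose intersection with another open box is again an open box.\<close>
        have "AE x in lebesgue. x \<notin> frontier (cbox c d)"
          using negligible_frontier_interval[of c d] by (auto simp: negligible_iff_null_sets eventually_ae_filter frontier_cbox)
        then show "AE x in lebesgue. indicat_real (box a b) x *\<^sub>R indicat_real (cbox c d) x *\<^sub>R G x = indicat_real (box l u) x *\<^sub>R G x"
        proof eventually_elim
          case (elim x)
          then have "x \<in> cbox c d \<longleftrightarrow> x \<in> box c d" using box_subset_cbox[of c d] by (auto simp: frontier_cbox)
          then show ?case unfolding lu(2)[symmetric] by (auto simp: indicator_def)
        qed
        show "(\<lambda>x. indicat_real (box a b) x *\<^sub>R indicat_real (cbox c d) x *\<^sub>R G x) \<in> borel_measurable lebesgue"
          by (rule borel_measurable_scaleR[OF borel_measurable_indicator borel_measurable_integrable[OF i]]) simp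
        have "(\<lambda>x. indicat_real (box l u) x *\<^sub>R (indicat_real (cbox c d) x *\<^sub>R G x)) \<in> borel_measurable lebesgue"
          by (rule borel_measurable_scaleR[OF borel_measurable_indicator borel_measurable_integrable[OF i]]) simp
        moreover have "(\<lambda>x. indicat_real (box l u) x *\<^sub>R (indicat_real (cbox c d) x *\<^sub>R G x)) = (\<lambda>x. indicat_real (box l u) x *\<^sub>R G x)"
          unfolding lu(2)[symmetric] using box_subset_cbox[of c d] by (auto simp: indicator_def fun_eq_iff)
        ultimately show "(\<lambda>x. indicat_real (box l u) x *\<^sub>R G x) \<in> borel_measurable lebesgue" by simp
      qed
      also have "\<dots> = 0" using box0 lu(1) cd by (metis Int_lower2 order_trans)
      finally show ?thesis .
    qed
    then have "AE x in lebesgue. indicator (cbox c d) x *\<^sub>R G x = 0"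
      by (rule AE_zero_if_box_integrals_zero[OF i])
    then show ?thesis by eventually_elim (auto simp: indicator_def)
  qed
  moreover obtain \<D> where D: "countable \<D>" "\<D> \<subseteq> Pow \<Omega>" "\<And>X. X \<in> \<D> \<Longrightarrow> \<exists>a b. X = cbox a b" "\<Union>\<D> = \<Omega>"
    using open_countable_Union_open_cbox[OF op] by metis
  ultimately have "AE x in lebesgue. \<forall>X\<in>\<D>. x \<in> X \<longrightarrow> G x = 0"
    by (subst AE_ball_countable[OF D(1)]) (metis PowD subsetD)
  then have "AE x in lebesgue. x \<in> \<Omega> \<longrightarrow> G x = 0"
    by eventually_elim (use D(4) in blast)
  then show ?thesis using \<Omega>s by (simp add: AE_restrict_space_iff)
qed

section \<open>Uniqueness and measurability of weak gradients, and the gradient of the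
  identity\<close>

text \<open>Difference quotients have integral 0 by translation invariance and converge to the
  directional derivative, so dominated convergence gives the claim without iterated
  integrals.\<close>

lemma integral_directional_derivative_eq_0:
  fixes f :: "'a::euclidean_space \<Rightarrow> real"
  assumes D: "\<And>x. (f has_derivative D x) (at x)" and cont: "continuous_on UNIV (\<lambda>x. D x v)"
    and K: "compact K" "\<And>x. x \<notin> K \<Longrightarrow> f x = 0"
  shows "integral\<^sup>L lborel (\<lambda>x. D x v) = 0" "integrable lborel (\<lambda>x. D x v)"
proof -
  have D0: "D x v = 0" if "x \<notin> K" for x
  proof -
    have op: "open (- K)" using K compact_imp_closed by blast
    have "(f has_derivative (\<lambda>v. 0)) (at x)"
      by (rule has_derivative_transform_within_open[OF has_derivative_const op]) (use that K in auto)
    then show ?thesis using has_derivative_unique[OF D] by metis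
  qed
  have "bounded ((\<lambda>x. D x v) ` K)"
    using K cont by (intro compact_imp_bounded compact_continuous_image continuous_on_subset[OF cont]) auto
  then obtain B where B0: "B > 0" "\<And>x. x \<in> K \<Longrightarrow> \<bar>D x v\<bar> \<le> B" by (auto simp: bounded_pos)
  have B: "\<bar>D x v\<bar> \<le> B" for x using B0 D0[of x] by (cases "x \<in> K") auto
  have fc: "continuous_on UNIV f"
    using D by (auto intro: has_derivative_continuous continuous_at_imp_continuous_on)
  have mf: "f \<in> borel_measurable borel" and mD: "(\<lambda>x. D x v) \<in> borel_measurable borel"
    using fc cont by (auto intro: borel_measurable_continuous_onI)
  have bK: "bounded K" using K compact_imp_bounded by blast
  obtain R where R: "K \<subseteq> ball 0 R" using bounded_subset_ballD[OF bK] by blast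
  have "bounded (f ` K)" using K fc by (intro compact_imp_bounded compact_continuous_image continuous_on_subset[OF fc]) auto
  then obtain A where A0: "A > 0" "\<And>x. x \<in> K \<Longrightarrow> \<bar>f x\<bar> \<le> A" by (auto simp: bounded_pos)
  have ball_int: "integrable lborel (\<lambda>x. c * indicator (ball (0::'a) r) x :: real)" for c r
    using emeasure_lborel_ball_finite[of "0::'a" r] by (intro integrable_mult_right integrable_real_indicator) auto
  have bnd: "norm (h x) \<le> norm (c * indicator (ball 0 R) x)"
    if "\<And>x. x \<in> K \<Longrightarrow> \<bar>h x\<bar> \<le> c" "\<And>x. x \<notin> K \<Longrightarrow> h x = 0" "c > 0" for h :: "'a \<Rightarrow> real" and c x
    using that(1,2)[of x] \<open>c > 0\<close> R by (cases "x \<in> K") (auto simp: indicator_def subset_iff)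
  have fint: "integrable lborel f"
    by (rule Bochner_Integration.integrable_bound[OF ball_int[of A R] _ AE_I2[OF bnd]])
       (use mf A0 K in auto)
  show "integrable lborel (\<lambda>x. D x v)"
    by (rule Bochner_Integration.integrable_bound[OF ball_int[of B R] _ AE_I2[OF bnd]])
       (use mD D0 B0 in auto)
  have shift: "integrable lborel (\<lambda>x. f (w + x))" "integral\<^sup>L lborel (\<lambda>x. f (w + x)) = integral\<^sup>L lborel f" for w
  proof -
    have "integrable (distr lborel borel ((+) w)) f" using fint by (simp add: lborel_distr_plus)
    then show "integrable lborel (\<lambda>x. f (w + x))" by (subst (asm) integrable_distr_eq) (use mf in auto)
    have "integral\<^sup>L lborel f = integral\<^sup>L (distr lborel borel ((+) w)) f" by (simp add: lborel_distr_plus)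
    also have "\<dots> = integral\<^sup>L lborel (\<lambda>x. f (w + x))" by (rule integral_distr) (use mf in auto)
    finally show "integral\<^sup>L lborel (\<lambda>x. f (w + x)) = integral\<^sup>L lborel f" by simp
  qed
  define q where "q = (\<lambda>(n::nat) x. (f ((1 / real (Suc n)) *\<^sub>R v + x) - f x) * real (Suc n))"
  have q0: "integral\<^sup>L lborel (q n) = 0" for n
    using shift fint by (simp add: q_def)
  have q_bound: "\<bar>q n x\<bar> \<le> B" for n x
  proof -
    define h where "h = 1 / real (Suc n)"
    have h: "h > 0" by (simp add: h_def)
    have "\<exists>z\<in>{0<..<h}. f (x + h *\<^sub>R v) - f (x + 0 *\<^sub>R v) = (\<lambda>t. t * D (x + z *\<^sub>R v) v) (h - 0)"
    proof (rule mvt_simple[OF h])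
      fix z
      have "((\<lambda>t. f (x + t *\<^sub>R v)) has_derivative (\<lambda>t. D (x + z *\<^sub>R v) (t *\<^sub>R v))) (at z)"
        by (rule has_derivative_compose[OF _ D]) (auto intro!: derivative_eq_intros)
      moreover have "D (x + z *\<^sub>R v) (t *\<^sub>R v) = t * D (x + z *\<^sub>R v) v" for t
        using linear_scale[OF has_derivative_linear[OF D]] by simp
      ultimately show "((\<lambda>t. f (x + t *\<^sub>R v)) has_derivative (\<lambda>t. t * D (x + z *\<^sub>R v) v)) (at z within {0..h})"
        by (simp add: has_derivative_at_withinI)
    qed
    then obtain z where "f (x + h *\<^sub>R v) - f x = h * D (x + z *\<^sub>R v) v" by auto
    then have "q n x = D (x + z *\<^sub>R v) v" by (simp add: q_def h_def add.commute field_simps del: of_nat_Suc)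
    then show ?thesis using B by simp
  qed
  \<comment> \<open>The quotients vanish outside the ball of radius R + |v|, since no shift is
    longer than |v|; inside it the mean value theorem bounds them by \<open>B\<close>.\<close>
  have "(\<lambda>n. integral\<^sup>L lborel (q n)) \<longlonglongrightarrow> integral\<^sup>L lborel (\<lambda>x. D x v)"
  proof (rule integral_dominated_convergence[OF _ _ ball_int[of B "R + norm v"]])
    show "(\<lambda>x. D x v) \<in> borel_measurable lborel" using mD by simp
    show "q n \<in> borel_measurable lborel" for n
      unfolding q_def using mf by measurable
    show "AE x in lborel. norm (q n x) \<le> B * indicator (ball 0 (R + norm v)) x" for n
    proof (rule AE_I2)
      fix x
      show "norm (q n x) \<le> B * indicator (ball 0 (R + norm v)) x"
      proof (cases "x \<in> ball 0 (R + norm v)")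
        case False
        have "norm ((1 / real (Suc n)) *\<^sub>R v) \<le> norm v"
          by (simp add: divide_le_eq mult_le_cancel_left1)
        then have "norm ((1 / real (Suc n)) *\<^sub>R v + x) \<ge> R"
          using False norm_diff_ineq[of x "(1 / real (Suc n)) *\<^sub>R v"] by (simp add: add.commute)
        moreover have "norm x \<ge> R" using False norm_ge_zero[of v] by (simp only: mem_ball_0)
        ultimately have "(1 / real (Suc n)) *\<^sub>R v + x \<notin> K" "x \<notin> K" using R by (auto simp: subset_iff)
        then have "q n x = 0" using K by (simp add: q_def)
        then show ?thesis using False by simp
      qed (use q_bound[of n x] in simp)
    qed
    show "AE x in lborel. (\<lambda>n. q n x) \<longlonglongrightarrow> D x v"
    proof (rule AE_I2)
      fix x
      have "((\<lambda>t. x + t *\<^sub>R v) has_derivative (\<lambda>t. t *\<^sub>R v)) (at (0::real))"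
        by (auto intro!: derivative_eq_intros)
      moreover have "(f has_derivative D x) (at (x + 0 *\<^sub>R v))" using D by simp
      ultimately have "((\<lambda>t. f (x + t *\<^sub>R v)) has_derivative (\<lambda>t. D x (t *\<^sub>R v))) (at 0)"
        by (rule has_derivative_compose)
      moreover have "D x (t *\<^sub>R v) = t * D x v" for t
        using linear_scale[OF has_derivative_linear[OF D]] by simp
      ultimately have "((\<lambda>t. f (x + t *\<^sub>R v)) has_real_derivative D x v) (at 0)"
        by (simp add: has_field_derivative_def mult_commute_abs)
      then have "((\<lambda>h. (f (x + h *\<^sub>R v) - f x) / h) \<longlongrightarrow> D x v) (at 0)"
        by (simp add: DERIV_def)
      then have "(\<lambda>n. (f (x + (1 / real (Suc n)) *\<^sub>R v) - f x) / (1 / real (Suc n))) \<longlonglongrightarrow> D x v"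
      proof (rule filterlim_compose)
        show "filterlim (\<lambda>n. 1 / real (Suc n)) (at 0) sequentially"
          using LIMSEQ_inverse_real_of_nat by (auto simp: filterlim_at inverse_eq_divide)
      qed
      then show "(\<lambda>n. q n x) \<longlonglongrightarrow> D x v" by (simp add: q_def add.commute)
    qed
  qed
  then show "integral\<^sup>L lborel (\<lambda>x. D x v) = 0" by (simp add: q0 LIMSEQ_const_iff)
qed

lemma test_functionD:
  assumes "test_function \<Omega> \<phi>"
  obtains K where "compact K" "K \<subseteq> \<Omega>" "\<And>x. x \<notin> K \<Longrightarrow> \<phi> x = 0"
    "continuous_on UNIV \<phi>" "\<And>x. \<phi> differentiable (at x)"
    "\<And>e. e \<in> Basis \<Longrightarrow> continuous_on UNIV (\<lambda>x. frechet_derivative \<phi> (at x) e)"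
    "\<And>x e. x \<notin> K \<Longrightarrow> frechet_derivative \<phi> (at x) e = 0"
proof -
  obtain K where K: "compact K" "K \<subseteq> \<Omega>" "\<And>x. x \<notin> K \<Longrightarrow> \<phi> x = 0" and C: "\<And>k. C_k k \<phi>"
    using assms unfolding test_function_def by blast
  have C1: "\<phi> differentiable (at x)" "e \<in> Basis \<Longrightarrow> continuous_on UNIV (\<lambda>x. frechet_derivative \<phi> (at x) e)" for x e
    using C[of "Suc 0"] by auto
  have "frechet_derivative \<phi> (at x) e = 0" if "x \<notin> K" for x e
  proof -
    have op: "open (- K)" using K compact_imp_closed by blast
    have "(\<phi> has_derivative (\<lambda>v. 0)) (at x)"
      by (rule has_derivative_transform_within_open[OF has_derivative_const op]) (use that K in auto)
    then show ?thesis by (metis frechet_derivative_at)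
  qed
  then show ?thesis using that K C1 C[of 0] by auto
qed

lemma integrable_mult_compact_support:
  fixes f g :: "'a::euclidean_space \<Rightarrow> real"
  assumes f: "f absolutely_integrable_on K" and K: "compact K" "K \<subseteq> \<Omega>" and \<Omega>: "\<Omega> \<in> sets lebesgue"
    and g: "continuous_on UNIV g" "\<And>x. x \<notin> K \<Longrightarrow> g x = 0"
  shows "integrable (lebesgue_on \<Omega>) (\<lambda>x. f x * g x)"
proof -
  have fi: "integrable lebesgue (\<lambda>x. indicator K x *\<^sub>R f x)" using f by (simp add: set_integrable_def)
  have "bounded (g ` K)" using K g by (intro compact_imp_bounded compact_continuous_image continuous_on_subset[OF g(1)]) auto
  then obtain B where B: "B > 0" "\<And>x. x \<in> K \<Longrightarrow> \<bar>g x\<bar> \<le> B" by (auto simp: bounded_pos)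
  have gm: "g \<in> borel_measurable lebesgue"
    using borel_measurable_continuous_onI[OF g(1)] by (simp add: measurable_completion)
  have eq: "indicator \<Omega> x *\<^sub>R (f x * g x) = (indicator K x *\<^sub>R f x) * g x" for x
    using K g(2)[of x] by (auto simp: indicator_def)
  have "integrable lebesgue (\<lambda>x. (indicator K x *\<^sub>R f x) * g x)"
  proof (rule Bochner_Integration.integrable_bound[OF integrable_mult_right[OF integrable_norm[OF fi], of B]])
    show "(\<lambda>x. (indicator K x *\<^sub>R f x) * g x) \<in> borel_measurable lebesgue"
      by (rule borel_measurable_times[OF borel_measurable_integrable[OF fi] gm])
    show "AE x in lebesgue. norm ((indicator K x *\<^sub>R f x) * g x) \<le> norm (B * norm (indicat_real K x *\<^sub>R f x))"
      using B by (intro AE_I2) (auto simp: indicator_def abs_mult mult.commute[of B] intro!: mult_left_mono)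
  qed
  then show ?thesis using \<Omega> by (simp only: integrable_restrict_space eq sets.Int_space_eq2)
qed

lemma absolutely_integrable_on_nth:
  fixes f :: "'a::euclidean_space \<Rightarrow> real^'n"
  assumes "f absolutely_integrable_on K" shows "(\<lambda>x. f x $ i) absolutely_integrable_on K"
  using absolutely_integrable_component[OF assms, of "axis i 1"] by (simp add: inner_axis)

lemma absolutely_integrable_on_nth2:
  fixes f :: "'a::euclidean_space \<Rightarrow> real^'n^'m"
  assumes "f absolutely_integrable_on K" shows "(\<lambda>x. f x $ i $ j) absolutely_integrable_on K"
  using absolutely_integrable_component[OF assms, of "axis i (axis j 1)"] by (simp add: inner_axis)

lemma has_weak_gradient_diff:
  fixes u v :: "real^'n \<Rightarrow> real^'n"
  assumes op: "open \<Omega>" and u: "has_weak_gradient \<Omega> u G" and v: "has_weak_gradient \<Omega> v H"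
  shows "has_weak_gradient \<Omega> (\<lambda>x. u x - v x) (\<lambda>x. G x - H x)"
  unfolding has_weak_gradient_def
proof (intro conjI allI impI)
  have loc: "u absolutely_integrable_on K" "v absolutely_integrable_on K" "G absolutely_integrable_on K" "H absolutely_integrable_on K"
    if "compact K" "K \<subseteq> \<Omega>" for K using that u v by (auto simp: has_weak_gradient_def)
  fix \<phi> i j assume \<phi>: "test_function \<Omega> \<phi>"
  obtain K where K: "compact K" "K \<subseteq> \<Omega>" "\<And>x. x \<notin> K \<Longrightarrow> \<phi> x = 0"
    "continuous_on UNIV \<phi>" "\<And>x. \<phi> differentiable (at x)"
    "\<And>e. e \<in> Basis \<Longrightarrow> continuous_on UNIV (\<lambda>x. frechet_derivative \<phi> (at x) e)"
    "\<And>x e. x \<notin> K \<Longrightarrow> frechet_derivative \<phi> (at x) e = 0"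
    by (rule test_functionD[OF \<phi>]) blast
  have \<Omega>s: "\<Omega> \<in> sets lebesgue" using op by simp
  have ij: "(axis j 1 :: real^'n) \<in> Basis" by (simp add: axis_in_Basis_iff)
  note I = integrable_mult_compact_support[OF _ K(1,2) \<Omega>s]
  note I1 = I[OF absolutely_integrable_on_nth K(6)[OF ij] K(7)]
  note I2 = I[OF absolutely_integrable_on_nth2 K(4) K(3)]
  show "(\<integral>x. (u x - v x) $ i * frechet_derivative \<phi> (at x) (axis j 1) \<partial>lebesgue_on \<Omega>)
      = - (\<integral>x. (G x - H x) $ i $ j * \<phi> x \<partial>lebesgue_on \<Omega>)"
    using u v \<phi> loc[OF K(1,2)]
    by (simp add: left_diff_distrib Bochner_Integration.integral_diff I1 I2 has_weak_gradient_def)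
qed (use u v in \<open>auto simp: has_weak_gradient_def\<close>)

text \<open>The difference of the two is a weak gradient of the zero function, and the fundamental
  lemma applies to each of its entries.\<close>

lemma has_weak_gradient_unique:
  fixes u :: "real^'n \<Rightarrow> real^'n"
  assumes op: "open \<Omega>" and u: "has_weak_gradient \<Omega> u G" and v: "has_weak_gradient \<Omega> u H"
  shows "AE x in lebesgue_on \<Omega>. G x = H x"
proof -
  have d: "has_weak_gradient \<Omega> (\<lambda>x. 0) (\<lambda>x. G x - H x)"
    using has_weak_gradient_diff[OF op u v] by simp
  have "AE x in lebesgue_on \<Omega>. (G x - H x) $ i $ j = 0" for i j
  proof (rule fundamental_lemma[OF op])
    fix K assume "compact K" "K \<subseteq> \<Omega>"
    then have "(\<lambda>x. G x - H x) absolutely_integrable_on K" using d by (auto simp: has_weak_gradient_def)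
    then show "(\<lambda>x. (G x - H x) $ i $ j) absolutely_integrable_on K" by (rule absolutely_integrable_on_nth2)
  next
    fix \<phi> assume "test_function \<Omega> \<phi>"
    then have "(\<integral>x. 0 $ i * frechet_derivative \<phi> (at x) (axis j 1) \<partial>lebesgue_on \<Omega>)
      = - (\<integral>x. (G x - H x) $ i $ j * \<phi> x \<partial>lebesgue_on \<Omega>)"
      using d unfolding has_weak_gradient_def by blast
    then show "(\<integral>x. (G x - H x) $ i $ j * \<phi> x \<partial>lebesgue_on \<Omega>) = 0" by simp
  qed
  then have "AE x in lebesgue_on \<Omega>. \<forall>i j. (G x - H x) $ i $ j = 0"
    by (intro AE_all_countable[THEN iffD2] allI) auto
  then show ?thesis by eventually_elim (simp add: vec_eq_iff)
qed

text \<open>\<open>wgrad\<close> is an arbitrary choice. As soon as some weak gradient exists the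
  choice is one as well, and uniqueness determines it almost everywhere.\<close>

lemma wgrad_AE_eq:
  assumes "open \<Omega>" "has_weak_gradient \<Omega> u G"
  shows "has_weak_gradient \<Omega> u (wgrad \<Omega> u)" "AE x in lebesgue_on \<Omega>. wgrad \<Omega> u x = G x"
proof -
  show *: "has_weak_gradient \<Omega> u (wgrad \<Omega> u)" unfolding wgrad_def using someI_ex[of "has_weak_gradient \<Omega> u"] assms(2) by blast
  show "AE x in lebesgue_on \<Omega>. wgrad \<Omega> u x = G x"
    by (rule has_weak_gradient_unique[OF assms(1) * assms(2)])
qed

text \<open>Local integrability gives measurability on each compact box of a countable cover of
  \<open>\<Omega>\<close>.\<close>

lemma has_weak_gradient_measurable:
  assumes op: "open \<Omega>" and u: "has_weak_gradient \<Omega> u G"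
  shows "u \<in> borel_measurable (lebesgue_on \<Omega>)" "G \<in> borel_measurable (lebesgue_on \<Omega>)"
proof -
  obtain \<D> where D: "countable \<D>" "\<D> \<subseteq> Pow \<Omega>" "\<And>X. X \<in> \<D> \<Longrightarrow> \<exists>a b. X = cbox a b" "\<Union>\<D> = \<Omega>"
    using open_countable_Union_open_cbox[OF op] by metis
  have loc: "u absolutely_integrable_on X" "G absolutely_integrable_on X" if "X \<in> \<D>" for X
    using u D(2) D(3)[OF that] that by (auto simp: has_weak_gradient_def)
  have gen: "f \<in> borel_measurable (lebesgue_on \<Omega>)" if f: "\<And>X. X \<in> \<D> \<Longrightarrow> f absolutely_integrable_on X"
    for f :: "real^'a \<Rightarrow> 'c::euclidean_space"
  proof (rule measurable_piecewise_restrict[OF D(1)])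
    fix X assume X: "X \<in> \<D>"
    then obtain a b where ab: "X = cbox a b" using D(3) by blast
    then show "X \<inter> space (lebesgue_on \<Omega>) \<in> sets (lebesgue_on \<Omega>)"
      using op by (auto simp: sets_restrict_space intro!: image_eqI[of _ _ X])
    have "(\<lambda>x. indicat_real X x *\<^sub>R f x) \<in> borel_measurable lebesgue"
      using f[OF X] by (simp add: set_integrable_def borel_measurable_integrable)
    then have "f \<in> borel_measurable (lebesgue_on X)"
      using ab by (simp add: borel_measurable_restrict_space_iff)
    moreover have "restrict_space (lebesgue_on \<Omega>) X = lebesgue_on X"
      using D(2) X by (subst restrict_restrict_space) (auto simp: ab op Int_absorb1)
    ultimately show "f \<in> borel_measurable (restrict_space (lebesgue_on \<Omega>) X)" by simp
  qed (use D(4) in auto)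
  show "u \<in> borel_measurable (lebesgue_on \<Omega>)" "G \<in> borel_measurable (lebesgue_on \<Omega>)"
    using gen loc by blast+
qed

lemma absolutely_integrable_continuous_compact:
  fixes f :: "'a::euclidean_space \<Rightarrow> 'b::euclidean_space"
  assumes "compact K" "continuous_on UNIV f" shows "f absolutely_integrable_on K"
proof -
  obtain a where "K \<subseteq> cbox (- a) a" using bounded_subset_cbox_symmetric[OF compact_imp_bounded[OF assms(1)]] by blast
  moreover have "f absolutely_integrable_on cbox (- a) a"
    using assms(2) by (intro absolutely_integrable_continuous) (auto intro: continuous_on_subset)
  moreover have "K \<in> sets lebesgue" using assms(1) by (simp add: compact_imp_closed)
  ultimately show ?thesis by (metis set_integrable_subset)
qed

text \<open>The derivative of x_i \<phi> in the j-th direction integrates to 0, and the product rule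
  turns this into the defining identity.\<close>

lemma has_weak_gradient_id:
  fixes \<Omega> :: "(real^'n) set"
  assumes op: "open \<Omega>" shows "has_weak_gradient \<Omega> (\<lambda>x. x) (\<lambda>x. mat 1)"
  unfolding has_weak_gradient_def
proof (intro conjI allI impI)
  fix \<phi> :: "real^'n \<Rightarrow> real" and i j :: 'n assume \<phi>: "test_function \<Omega> \<phi>"
  obtain K where K: "compact K" "K \<subseteq> \<Omega>" "\<And>x. x \<notin> K \<Longrightarrow> \<phi> x = 0"
    "continuous_on UNIV \<phi>" "\<And>x. \<phi> differentiable (at x)"
    "\<And>e. e \<in> Basis \<Longrightarrow> continuous_on UNIV (\<lambda>x. frechet_derivative \<phi> (at x) e)"
    "\<And>x e. x \<notin> K \<Longrightarrow> frechet_derivative \<phi> (at x) e = 0"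
    by (rule test_functionD[OF \<phi>]) blast
  have \<Omega>s: "\<Omega> \<in> sets lebesgue" using op by simp
  let ?e = "axis j 1 :: real^'n" and ?d = "\<lambda>x. frechet_derivative \<phi> (at x)"
  have ej: "?e \<in> Basis" by (simp add: axis_in_Basis_iff)
  let ?D = "\<lambda>x v. x $ i * ?d x v + v $ i * \<phi> x"
  have "((\<lambda>x. x $ i * \<phi> x) has_derivative ?D x) (at x)" for x
    using K(5) by (intro has_derivative_mult bounded_linear_imp_has_derivative bounded_linear_vec_nth)
      (simp add: frechet_derivative_works)
  moreover have "continuous_on UNIV (\<lambda>x. ?D x ?e)"
    using K(4) K(6)[OF ej] by (intro continuous_intros) auto
  ultimately have z: "integral\<^sup>L lborel (\<lambda>x. ?D x ?e) = 0" "integrable lborel (\<lambda>x. ?D x ?e)"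
    using integral_directional_derivative_eq_0[of "\<lambda>x. x $ i * \<phi> x" ?D ?e K] K by auto
  have "(\<integral>x. ?D x ?e \<partial>lebesgue_on \<Omega>) = (\<integral>x. indicator \<Omega> x *\<^sub>R ?D x ?e \<partial>lebesgue)"
    using \<Omega>s by (simp add: integral_restrict_space)
  also have "\<dots> = (\<integral>x. ?D x ?e \<partial>lebesgue)"
  proof (rule Bochner_Integration.integral_cong[OF refl])
    fix x show "indicator \<Omega> x *\<^sub>R ?D x ?e = ?D x ?e"
      using K(2) K(3)[of x] K(7)[of x ?e] by (cases "x \<in> K") (auto simp: indicator_def)
  qed
  also have "\<dots> = 0" using z by (subst integral_completion) auto
  finally have sum0: "(\<integral>x. ?D x ?e \<partial>lebesgue_on \<Omega>) = 0" .
  note I = integrable_mult_compact_support[OF _ K(1,2) \<Omega>s]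
  have i1: "integrable (lebesgue_on \<Omega>) (\<lambda>x. x $ i * ?d x ?e)"
    by (rule I[OF absolutely_integrable_continuous_compact[OF K(1)] K(6)[OF ej] K(7)]) (auto intro!: continuous_intros)
  have i2: "integrable (lebesgue_on \<Omega>) (\<lambda>x. ?e $ i * \<phi> x)"
    by (rule I[OF absolutely_integrable_continuous_compact[OF K(1)] K(4) K(3)]) auto
  have "(\<integral>x. x $ i * ?d x ?e \<partial>lebesgue_on \<Omega>) = - (\<integral>x. ?e $ i * \<phi> x \<partial>lebesgue_on \<Omega>)"
    using sum0 Bochner_Integration.integral_add[OF i1 i2] by linarith
  moreover have "?e $ i = (mat 1 :: real^'n^'n) $ i $ j" by (simp add: axis_def mat_def)
  ultimately show "(\<integral>x. x $ i * ?d x ?e \<partial>lebesgue_on \<Omega>) = - (\<integral>x. (mat 1 :: real^'n^'n) $ i $ j * \<phi> x \<partial>lebesgue_on \<Omega>)"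
    by simp
qed (auto intro!: absolutely_integrable_continuous_compact continuous_intros)

section \<open>Surface measure and traces\<close>

definition covers :: "real \<Rightarrow> 'a::metric_space set \<Rightarrow> (nat \<Rightarrow> 'a set) set" where
  "covers \<delta> A = {C. A \<subseteq> (\<Union>i. C i) \<and> (\<forall>i. bounded (C i) \<and> diameter (C i) \<le> \<delta>)}"

definition gauge_vol :: "nat \<Rightarrow> 'a::metric_space set \<Rightarrow> ennreal" where
  "gauge_vol m S = (if S = {} then 0 else ennreal (unit_ball_vol (real m) * (diameter S / 2) ^ m))"

lemma hausdorff_content_eq: "hausdorff_content m \<delta> A = (INF C\<in>covers \<delta> A. \<Sum>i. gauge_vol m (C i))"
  by (simp add: hausdorff_content_def covers_def gauge_vol_def)

lemma gauge_vol_empty [simp]: "gauge_vol m {} = 0"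
  by (simp add: gauge_vol_def)

lemma hausdorff_content_le: "C \<in> covers \<delta> A \<Longrightarrow> hausdorff_content m \<delta> A \<le> (\<Sum>i. gauge_vol m (C i))"
  unfolding hausdorff_content_eq by (rule INF_lower)

lemma hausdorff_content_mono: "A \<subseteq> B \<Longrightarrow> hausdorff_content m \<delta> A \<le> hausdorff_content m \<delta> B"
  unfolding hausdorff_content_eq by (rule INF_superset_mono) (auto simp: covers_def)

lemma hausdorff_content_antimono: "\<delta> \<le> \<delta>' \<Longrightarrow> hausdorff_content m \<delta>' A \<le> hausdorff_content m \<delta> A"
  unfolding hausdorff_content_eq by (rule INF_superset_mono) (auto simp: covers_def intro: order_trans)

text \<open>Covers of the single sets with excess e / 2^(n + 1) are merged into one sequence by the
  pairing of the natural numbers.\<close>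

lemma hausdorff_content_subadditive:
  "hausdorff_content m \<delta> (\<Union>i. A i) \<le> (\<Sum>n. hausdorff_content m \<delta> (A n))"
proof (rule ennreal_le_epsilon)
  let ?O = "hausdorff_content m \<delta>"
  fix e :: real assume e: "0 < e" and fin: "(\<Sum>n. ?O (A n)) < top"
  then have "?O (A n) < ?O (A n) + e * (1/2) ^ Suc n" for n
    by (auto simp: less_top dest!: ennreal_suminf_lessD)
  then have "\<forall>n. \<exists>C\<in>covers \<delta> (A n). (\<Sum>i. gauge_vol m (C i)) < ?O (A n) + e * (1/2) ^ Suc n"
    unfolding hausdorff_content_eq INF_less_iff by simp
  then obtain B where B: "\<And>n. B n \<in> covers \<delta> (A n)"
      "\<And>n. (\<Sum>i. gauge_vol m (B n i)) \<le> ?O (A n) + e * (1/2) ^ Suc n"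
    by (metis less_imp_le)
  define C where "C = case_prod B o prod_decode"
  have "C \<in> covers \<delta> (\<Union>i. A i)"
  proof -
    have "x \<in> (\<Union>i. C i)" if xA: "x \<in> A n" for x n
    proof -
      obtain i where "x \<in> B n i" using B(1)[of n] xA unfolding covers_def by blast
      then have "x \<in> C (prod_encode (n, i))" by (simp add: C_def)
      then show ?thesis by blast
    qed
    moreover have "bounded (C i) \<and> diameter (C i) \<le> \<delta>" for i
      using B(1) by (auto simp: covers_def C_def case_prod_unfold)
    ultimately show ?thesis by (auto simp: covers_def)
  qed
  then have "?O (\<Union>i. A i) \<le> (\<Sum>i. gauge_vol m (C i))" by (rule hausdorff_content_le)
  also have "\<dots> = (\<Sum>n. \<Sum>i. gauge_vol m (B n i))"
  proof -
    have "(\<Sum>i. (\<lambda>p. gauge_vol m (B (fst p) (snd p))) (prod_decode i)) = (\<Sum>n. \<Sum>i. gauge_vol m (B n i))"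
      by (rule suminf_ennreal_2dimen) simp
    then show ?thesis by (simp add: C_def case_prod_unfold)
  qed
  also have "\<dots> \<le> (\<Sum>n. ?O (A n) + e * (1/2) ^ Suc n)"
    by (intro suminf_le B) auto
  also have "\<dots> = (\<Sum>n. ?O (A n)) + (\<Sum>n. ennreal e * ennreal ((1/2) ^ Suc n))"
    using e by (subst suminf_add[symmetric]) (auto simp del: ennreal_suminf_cmult simp add: ennreal_mult[symmetric])
  also have "\<dots> = (\<Sum>n. ?O (A n)) + e"
    unfolding ennreal_suminf_cmult
    by (subst suminf_ennreal_eq[OF zero_le_power power_half_series]) auto
  finally show "?O (\<Union>i. A i) \<le> (\<Sum>n. ?O (A n)) + e" .
qed

lemma hausdorff_content_le_outer: "\<delta> > 0 \<Longrightarrow> hausdorff_content m \<delta> A \<le> hausdorff_outer m A"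
  unfolding hausdorff_outer_def by (rule SUP_upper) simp

text \<open>Along this sequence of scales the contents increase, so that two such suprema can be
  added.\<close>

lemma hausdorff_outer_seq: "hausdorff_outer m A = (SUP n. hausdorff_content m (1 / real (Suc n)) A)"
  unfolding hausdorff_outer_def
proof (rule SUP_eq)
  fix \<delta> :: real assume "\<delta> \<in> {0<..}"
  then obtain n where "1 / real (Suc n) < \<delta>" using nat_approx_posE by auto
  then show "\<exists>n\<in>UNIV. hausdorff_content m \<delta> A \<le> hausdorff_content m (1 / real (Suc n)) A"
    by (intro bexI[of _ n] hausdorff_content_antimono) auto
qed (auto intro!: bexI[of _ "1 / real (Suc _)"])

lemma incseq_hausdorff_content: "incseq (\<lambda>n. hausdorff_content m (1 / real (Suc n)) A)"
  by (intro incseq_SucI hausdorff_content_antimono) (simp add: frac_le)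

lemma hausdorff_outer_mono: "A \<subseteq> B \<Longrightarrow> hausdorff_outer m A \<le> hausdorff_outer m B"
  unfolding hausdorff_outer_def by (intro SUP_mono' hausdorff_content_mono)

lemma hausdorff_outer_empty [simp]: "hausdorff_outer m {} = 0"
proof -
  have "hausdorff_content m \<delta> {} \<le> 0" if "\<delta> > 0" for \<delta>
    using hausdorff_content_le[of "\<lambda>_. {}" \<delta> "{}" m] that by (simp add: covers_def)
  then have "hausdorff_outer m {} \<le> 0" unfolding hausdorff_outer_def by (intro SUP_least) auto
  then show ?thesis by simp
qed

lemma hausdorff_outer_subadditive: "hausdorff_outer m (\<Union>i. A i) \<le> (\<Sum>n. hausdorff_outer m (A n))"
  unfolding hausdorff_outer_def[of m "\<Union>i. A i"]
proof (rule SUP_least)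
  fix \<delta> :: real assume "\<delta> \<in> {0<..}"
  then show "hausdorff_content m \<delta> (\<Union>i. A i) \<le> (\<Sum>n. hausdorff_outer m (A n))"
    by (intro order_trans[OF hausdorff_content_subadditive] suminf_le hausdorff_content_le_outer) auto
qed

lemma hausdorff_outer_Un_le: "hausdorff_outer m (A \<union> B) \<le> hausdorff_outer m A + hausdorff_outer m B"
proof -
  have "A \<union> B = (\<Union>i. binaryset A B i)" by (simp add: UN_binaryset_eq)
  then have "hausdorff_outer m (A \<union> B) \<le> (\<Sum>n. hausdorff_outer m (binaryset A B n))"
    using hausdorff_outer_subadditive by metis
  also have "\<dots> = hausdorff_outer m A + hausdorff_outer m B" by (rule suminf_binaryset_eq) simp
  finally show ?thesis .
qed

lemma hausdorff_outer_measure_space: "outer_measure_space (Pow UNIV) (hausdorff_outer m)"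
  by (auto simp: outer_measure_space_def positive_def increasing_def countably_subadditive_def
      intro: hausdorff_outer_mono hausdorff_outer_subadditive)

text \<open>A set of diameter less than \<open>d\<close> meets at most one of \<open>A\<close> and
  \<open>B\<close>, so every sufficiently fine cover of the union splits into covers of the
  two.\<close>

lemma hausdorff_outer_separated:
  assumes d: "d > 0" and sep: "\<And>a b. a \<in> A \<Longrightarrow> b \<in> B \<Longrightarrow> d \<le> dist a b"
  shows "hausdorff_outer m A + hausdorff_outer m B \<le> hausdorff_outer m (A \<union> B)"
proof -
  have small: "hausdorff_content m \<delta> A + hausdorff_content m \<delta> B \<le> hausdorff_content m \<delta> (A \<union> B)" if \<delta>: "\<delta> < d" for \<delta>
    unfolding hausdorff_content_eq[of m \<delta> "A \<union> B"]
  proof (rule INF_greatest)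
    fix C assume C: "C \<in> covers \<delta> (A \<union> B)"
    define C1 where "C1 i = (if C i \<inter> A = {} then {} else C i)" for i
    define C2 where "C2 i = (if C i \<inter> B = {} then {} else C i)" for i
    \<comment> \<open>Members of the cover that are left out are replaced by empty sets, whose
      diameter 0 has to be admissible.\<close>
    have "\<delta> \<ge> 0" using C diameter_ge_0 by (force simp: covers_def intro: order_trans)
    then have "C1 \<in> covers \<delta> A" "C2 \<in> covers \<delta> B"
      using C by (force simp: covers_def C1_def C2_def)+
    then have "hausdorff_content m \<delta> A + hausdorff_content m \<delta> B \<le> (\<Sum>i. gauge_vol m (C1 i)) + (\<Sum>i. gauge_vol m (C2 i))"
      by (intro add_mono hausdorff_content_le)
    also have "\<dots> = (\<Sum>i. gauge_vol m (C1 i) + gauge_vol m (C2 i))" by (rule suminf_add) auto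
    also have "\<dots> \<le> (\<Sum>i. gauge_vol m (C i))"
    proof (intro suminf_le)
      fix i
      have "C i \<inter> A = {} \<or> C i \<inter> B = {}"
      proof (rule ccontr)
        assume "\<not> ?thesis"
        then obtain a b where ab: "a \<in> C i" "a \<in> A" "b \<in> C i" "b \<in> B" by blast
        then have "dist a b \<le> diameter (C i)" using C by (intro diameter_bounded_bound) (auto simp: covers_def)
        also have "\<dots> \<le> \<delta>" using C by (simp add: covers_def)
        finally show False using sep[OF ab(2,4)] \<delta> by simp
      qed
      then show "gauge_vol m (C1 i) + gauge_vol m (C2 i) \<le> gauge_vol m (C i)"
        by (auto simp: C1_def C2_def)
    qed auto
    finally show "hausdorff_content m \<delta> A + hausdorff_content m \<delta> B \<le> (\<Sum>i. gauge_vol m (C i))" .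
  qed
  have "hausdorff_outer m A + hausdorff_outer m B
      = (SUP n. hausdorff_content m (1 / real (Suc n)) A + hausdorff_content m (1 / real (Suc n)) B)"
    unfolding hausdorff_outer_seq by (rule ennreal_SUP_add[symmetric]) (rule incseq_hausdorff_content)+
  also have "\<dots> \<le> hausdorff_outer m (A \<union> B)"
  proof (rule SUP_least)
    fix n
    define \<delta> where "\<delta> = min (1 / real (Suc n)) (d / 2)"
    have \<delta>: "\<delta> > 0" "\<delta> < d" "\<delta> \<le> 1 / real (Suc n)" using d by (auto simp: \<delta>_def)
    have "hausdorff_content m (1 / real (Suc n)) A + hausdorff_content m (1 / real (Suc n)) B
        \<le> hausdorff_content m \<delta> A + hausdorff_content m \<delta> B"
      using \<delta> by (intro add_mono hausdorff_content_antimono)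
    also have "\<dots> \<le> hausdorff_content m \<delta> (A \<union> B)" by (rule small[OF \<delta>(2)])
    also have "\<dots> \<le> hausdorff_outer m (A \<union> B)" by (rule hausdorff_content_le_outer[OF \<delta>(1)])
    finally show "hausdorff_content m (1 / real (Suc n)) A + hausdorff_content m (1 / real (Suc n)) B \<le> hausdorff_outer m (A \<union> B)" .
  qed
  finally show ?thesis .
qed

text \<open>Caratheodory's criterion. The layers \<open>D j\<close> of equal parity are pairwise separated, so the
  sum of their outer measures is finite and its tails bound the part of \<open>A - F\<close> close to \<open>F\<close>.\<close>

lemma closed_in_lambda_system:
  fixes F :: "'a::metric_space set"
  assumes F: "closed F" shows "F \<in> lambda_system UNIV (Pow UNIV) (hausdorff_outer m)"
proof (cases "F = {}")
  case True then show ?thesis by (simp add: lambda_system_def)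
next
  case ne: False
  let ?O = "hausdorff_outer m" and ?d = "\<lambda>x. infdist x F"
  have "?O (A \<inter> F) + ?O (A - F) \<le> ?O A" if fin: "?O A < top" for A
  proof -
    define E where "E k = {x \<in> A. 1 / real (Suc k) \<le> ?d x}" for k
    define D where "D k = E (Suc k) - E k" for k
    have dist_ge: "dist x y \<ge> \<bar>?d x - ?d y\<bar>" for x y by (rule infdist_triangle_abs)
    have dF: "?d x = 0" if "x \<in> F" for x using that by simp
    have E_sep: "?O (A \<inter> F) + ?O (E k) \<le> ?O A" for k
    proof -
      have "?O (A \<inter> F) + ?O (E k) \<le> ?O (A \<inter> F \<union> E k)"
      proof (rule hausdorff_outer_separated)
        show "1 / real (Suc k) > 0" by simp
        fix a b assume "a \<in> A \<inter> F" "b \<in> E k"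
        then show "1 / real (Suc k) \<le> dist a b" using dist_ge[of a b] dF[of a] infdist_nonneg[of b F] by (simp add: E_def del: of_nat_Suc)
      qed
      also have "\<dots> \<le> ?O A" by (rule hausdorff_outer_mono) (auto simp: E_def)
      finally show ?thesis .
    qed
    have D_d: "1 / real (Suc (Suc j)) \<le> ?d x" "?d x < 1 / real (Suc j)" if "x \<in> D j" for x j
      using that by (auto simp: D_def E_def)
    have parity: "(\<Sum>j<n. ?O (D (2 * j + p))) \<le> ?O (\<Union>j<n. D (2 * j + p))" for n p
    proof (induction n)
      case (Suc n)
      let ?i = "2 * n + p"
      have "(\<Sum>j<Suc n. ?O (D (2 * j + p))) \<le> ?O (\<Union>j<n. D (2 * j + p)) + ?O (D ?i)"
        using Suc.IH by (simp add: add_right_mono)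
      also have "\<dots> \<le> ?O ((\<Union>j<n. D (2 * j + p)) \<union> D ?i)"
      \<comment> \<open>For n = 0 the union is empty, and \<open>?i\<close> may be 0. Otherwise a
        layer lies between any two of equal parity, and \<open>c\<close> is the thickness of the one
        just before \<open>D ?i\<close>, measured by the distance to \<open>F\<close>.\<close>
      proof (cases "n = 0")
        case False
        define c where "c = 1 / real ?i - 1 / real (Suc ?i)"
        show ?thesis
        proof (rule hausdorff_outer_separated)
          have "1 / real (Suc ?i) < 1 / real ?i" using False by (intro divide_strict_left_mono) auto
          then show "c > 0" by (simp add: c_def)
          fix a b assume "a \<in> (\<Union>j<n. D (2 * j + p))" and b: "b \<in> D ?i"
          then obtain j where j: "j < n" "a \<in> D (2 * j + p)" by auto
          have "1 / real ?i \<le> 1 / real (Suc (Suc (2 * j + p)))"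
            using j by (intro divide_left_mono) auto
          then have "1 / real ?i \<le> ?d a" using D_d(1)[OF j(2)] by linarith
          moreover have "?d b < 1 / real (Suc ?i)" by (rule D_d(2)[OF b])
          ultimately show "c \<le> dist a b" using dist_ge[of a b] by (simp add: c_def)
        qed
      qed simp
      also have "(\<Union>j<n. D (2 * j + p)) \<union> D ?i = (\<Union>j<Suc n. D (2 * j + p))" by (auto simp: lessThan_Suc)
      finally show ?case .
    qed simp
    have DA: "D j \<subseteq> A" for j by (auto simp: D_def E_def)
    have half: "(\<Sum>j<n. ?O (D (2 * j + p))) \<le> ?O A" for n p
      using DA by (intro order_trans[OF parity] hausdorff_outer_mono) blast
    have partial: "(\<Sum>j<n. ?O (D j)) \<le> 2 * ?O A" for n
    proof -
      have "(\<Sum>j<n. ?O (D j)) \<le> (\<Sum>j<2 * n. ?O (D j))" by (rule sum_mono2) auto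
      also have "\<dots> = (\<Sum>j<n. ?O (D (2 * j + 0))) + (\<Sum>j<n. ?O (D (2 * j + 1)))"
        by (induction n) (auto simp: algebra_simps)
      also have "\<dots> \<le> ?O A + ?O A" by (intro add_mono half)
      finally show ?thesis by (simp add: mult_2)
    qed
    have "(\<Sum>j. ?O (D j)) \<le> 2 * ?O A"
      unfolding suminf_eq_SUP by (rule SUP_least) (rule partial)
    then have Dfin: "(\<Sum>j. ?O (D j)) < top" using fin by (metis ennreal_mult_less_top ennreal_numeral_less_top order_le_less_trans)
    define g where "g j = enn2real (?O (D j))" for j
    have "?O (D j) < top" for j
      using fin hausdorff_outer_mono[OF DA[of j]] by (rule order_le_less_trans[rotated])
    then have g: "?O (D j) = ennreal (g j)" for j by (simp add: g_def)
    have g0: "g j \<ge> 0" for j by (simp add: g_def)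
    have sg: "summable g" using Dfin g0 unfolding g by (intro summable_suminf_not_top) auto
    have tail: "(\<lambda>n. \<Sum>k. g (k + n)) \<longlonglongrightarrow> 0" by (rule suminf_exist_split2[OF sg])
    have AF: "?O (A - F) \<le> ?O (E n) + ennreal (\<Sum>k. g (k + n))" for n
    proof -
      have "A - F \<subseteq> E n \<union> (\<Union>k. D (k + n))"
      proof
        fix x assume x: "x \<in> A - F"
        then have "?d x > 0" using infdist_pos_not_in_closed[OF F ne] by simp
        then obtain k where "1 / real (Suc k) < ?d x" using nat_approx_posE by blast
        then have ex: "\<exists>k. x \<in> E k" using x by (auto simp: E_def intro!: exI[of _ k])
        \<comment> \<open>The sets \<open>E k\<close> increase. So the first index whose set
          contains \<open>x\<close> either is at most \<open>n\<close> or places \<open>x\<close> in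
          the layer just before it.\<close>
        define l where "l = (LEAST k. x \<in> E k)"
        have l: "x \<in> E l" unfolding l_def using ex by (rule LeastI_ex)
        show "x \<in> E n \<union> (\<Union>k. D (k + n))"
        proof (cases "l \<le> n")
          case True
          have "1 / real (Suc n) \<le> 1 / real (Suc l)" using True by (simp add: frac_le)
          then have "x \<in> E n" using l unfolding E_def by (smt (verit) mem_Collect_eq)
          then show ?thesis by simp
        next
          case False
          then obtain j where j: "l = Suc j" by (metis not0_implies_Suc zero_le)
          then have "x \<notin> E j" unfolding l_def by (metis lessI not_less_Least)
          then have "x \<in> D ((j - n) + n)" using l j False by (simp add: D_def)
          then show ?thesis by blast
        qed
      qed
      then have "?O (A - F) \<le> ?O (E n \<union> (\<Union>k. D (k + n)))" by (rule hausdorff_outer_mono)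
      also have "\<dots> \<le> ?O (E n) + ?O (\<Union>k. D (k + n))" by (rule hausdorff_outer_Un_le)
      also have "?O (\<Union>k. D (k + n)) \<le> (\<Sum>k. ?O (D (k + n)))" by (rule hausdorff_outer_subadditive)
      also have "\<dots> = ennreal (\<Sum>k. g (k + n))"
        unfolding g using g0 sg by (intro suminf_ennreal2) (auto simp: summable_iff_shift)
      finally show ?thesis by (simp add: add_left_mono)
    qed
    show ?thesis
    proof (rule ennreal_le_epsilon)
      fix e :: real assume "e > 0"
      then have "eventually (\<lambda>n. (\<Sum>k. g (k + n)) < e) sequentially" using tail by (auto simp: order_tendsto_iff)
      then obtain n where n: "(\<Sum>k. g (k + n)) < e"
        using eventually_happens'[OF sequentially_bot, of "\<lambda>n. (\<Sum>k. g (k + n)) < e"] by blast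
      have "?O (A \<inter> F) + ?O (A - F) \<le> ?O (A \<inter> F) + (?O (E n) + ennreal (\<Sum>k. g (k + n)))"
        by (intro add_left_mono AF)
      also have "\<dots> \<le> ?O A + ennreal e"
        using E_sep[of n] n by (metis add.assoc add_mono ennreal_leI less_imp_le)
      finally show "?O (A \<inter> F) + ?O (A - F) \<le> ?O A + ennreal e" .
    qed
  qed
  moreover have "?O A \<le> ?O (A \<inter> F) + ?O (A - F)" for A
    using hausdorff_outer_Un_le[of m "A \<inter> F" "A - F"] by (simp add: Int_Diff_Un)
  ultimately have "?O (A \<inter> F) + ?O (A - F) = ?O A" for A
    by (metis antisym_conv less_top top_greatest)
  then show ?thesis by (auto simp: lambda_system_def Diff_eq Int_commute)
qed

lemma hausdorff_measure_space:
  "measure_space UNIV (lambda_system UNIV (Pow UNIV) (hausdorff_outer m)) (hausdorff_outer m)"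
proof -
  interpret sigma_algebra UNIV "Pow UNIV" by (rule sigma_algebra_Pow)
  show ?thesis by (rule caratheodory_lemma[OF hausdorff_outer_measure_space])
qed

lemma sets_hausdorff_measure:
  "sets (hausdorff_measure m) = lambda_system UNIV (Pow UNIV) (hausdorff_outer m)"
proof -
  have "sigma_algebra UNIV (lambda_system UNIV (Pow UNIV) (hausdorff_outer m))"
    using hausdorff_measure_space[of m] unfolding measure_space_def by blast
  then have "sigma_sets UNIV (lambda_system UNIV (Pow UNIV) (hausdorff_outer m)) = lambda_system UNIV (Pow UNIV) (hausdorff_outer m)"
    by (rule sigma_algebra.sigma_sets_eq)
  moreover have "sets (hausdorff_measure m) = sigma_sets UNIV (lambda_system UNIV (Pow UNIV) (hausdorff_outer m))"
    unfolding hausdorff_measure_def by (rule sets_measure_of) simp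
  ultimately show ?thesis by (rule trans[rotated])
qed

lemma space_hausdorff_measure [simp]: "space (hausdorff_measure m) = UNIV"
  by (simp add: hausdorff_measure_def)

lemma emeasure_hausdorff_measure:
  "A \<in> sets (hausdorff_measure m) \<Longrightarrow> emeasure (hausdorff_measure m) A = hausdorff_outer m A"
proof -
  assume "A \<in> sets (hausdorff_measure m)"
  then have "A \<in> lambda_system UNIV (Pow UNIV) (hausdorff_outer m)" by (simp only: sets_hausdorff_measure)
  then show ?thesis
    using hausdorff_measure_space[of m] unfolding measure_space_def hausdorff_measure_def
    by (intro emeasure_measure_of_sigma) blast+
qed

lemma borel_subset_hausdorff: "sets borel \<subseteq> sets (hausdorff_measure m :: 'a::metric_space measure)"
proof -
  have "sigma_sets UNIV (Collect closed) \<subseteq> sets (hausdorff_measure m :: 'a measure)"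
  proof (rule sets.sigma_sets_subset[of _ "hausdorff_measure m", simplified])
    show "Collect closed \<subseteq> sets (hausdorff_measure m :: 'a measure)"
      using closed_in_lambda_system by (auto simp: sets_hausdorff_measure)
  qed
  then show ?thesis by (simp add: borel_eq_closed)
qed

lemma space_surface_on [simp]: "space (surface_on A) = A"
  by (simp add: surface_on_def space_restrict_space)

lemma continuous_on_surface_measurable:
  fixes f :: "real^'n \<Rightarrow> 'b::topological_space"
  assumes "continuous_on A f" shows "f \<in> borel_measurable (surface_on A)"
proof (rule borel_measurableI)
  fix S :: "'b set" assume "open S"
  then obtain T where "open T" "T \<inter> A = f -` S \<inter> A" using assms continuous_on_open_invariant by metis
  then show "f -` S \<inter> space (surface_on A) \<in> sets (surface_on A)"
    using borel_subset_hausdorff[of "CARD('n) - 1"] unfolding space_surface_on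
    by (auto simp: surface_on_def sets_restrict_space intro!: image_eqI[of _ _ T])
qed

lemma hausdorff_content_finite_cover:
  fixes A :: "'a::euclidean_space set"
  assumes F: "finite F" "A \<subseteq> (\<Union>a\<in>F. ball a \<epsilon>)" and \<epsilon>: "\<epsilon> > 0" "2 * \<epsilon> \<le> \<delta>"
  shows "hausdorff_content m \<delta> A \<le> ennreal (real (card F) * (unit_ball_vol (real m) * \<epsilon> ^ m))"
proof -
  obtain h where h: "bij_betw h {0..<card F} F" using ex_bij_betw_nat_finite[OF F(1)] by blast
  define C where "C i = (if i < card F then ball (h i) \<epsilon> else {})" for i
  have "C \<in> covers \<delta> A"
  proof -
    have "x \<in> (\<Union>i. C i)" if xA: "x \<in> A" for x
    proof -
      obtain a where a: "a \<in> F" "x \<in> ball a \<epsilon>" using F(2) xA by blast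
      then have "a \<in> h ` {0..<card F}" using bij_betw_imp_surj_on[OF h] by simp
      then obtain i where "i < card F" "a = h i" by auto
      then show ?thesis using a by (auto simp: C_def intro!: exI[of _ i])
    qed
    then have "A \<subseteq> (\<Union>i. C i)" by blast
    then show ?thesis using \<epsilon> by (auto simp: covers_def C_def)
  qed
  then have "hausdorff_content m \<delta> A \<le> (\<Sum>i. gauge_vol m (C i))" by (rule hausdorff_content_le)
  also have "\<dots> = (\<Sum>i\<in>{..<card F}. gauge_vol m (C i))"
    by (rule suminf_finite) (auto simp: C_def)
  also have "\<dots> = (\<Sum>i\<in>{..<card F}. ennreal (unit_ball_vol (real m) * \<epsilon> ^ m))"
    using \<epsilon> by (intro sum.cong) (auto simp: C_def gauge_vol_def)
  also have "\<dots> = ennreal (real (card F) * (unit_ball_vol (real m) * \<epsilon> ^ m))"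
    by (simp add: ennreal_mult' ennreal_of_nat_eq_real_of_nat)
  finally show ?thesis .
qed

text \<open>Disjoint balls of radius \<open>\<epsilon>/2\<close> centred on the boundary lie in a strip of width \<open>\<epsilon>\<close>, whose volume
  is of order \<open>\<epsilon>\<close>, so that of order \<open>\<epsilon>\<^sup>1\<^sup>-\<^sup>n\<close> balls of radius \<open>\<epsilon>\<close> cover the boundary.\<close>

lemma hausdorff_frontier_finite:
  fixes \<Omega> :: "(real^'n) set"
  assumes dom: "lipschitz_domain \<Omega>"
  shows "hausdorff_outer (CARD('n) - 1) (frontier \<Omega>) < top"
proof -
  have op: "open \<Omega>" and bd: "bounded \<Omega>" and ne: "\<Omega> \<noteq> {}" using dom by (auto simp: lipschitz_domain_def)
  have fr: "frontier \<Omega> \<noteq> {}" using ne bd by (auto simp: frontier_eq_empty)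
  obtain \<rho> \<kappa> where \<rho>: "\<rho> > 0" and \<kappa>: "0 < \<kappa>" "\<kappa> \<le> 1"
    and cone: "\<And>y. y \<in> closure \<Omega> \<Longrightarrow> \<exists>e. interior_cone \<Omega> y \<rho> \<kappa> e"
    using uniform_interior_cone[OF dom] by metis
  define r where "r = \<rho> / 4"
  have r: "r > 0" "2 * (2 * r) \<le> \<rho>" using \<rho> by (auto simp: r_def)
  let ?m = "CARD('n) - 1"
  let ?O = "hausdorff_outer ?m :: (real^'n) set \<Rightarrow> ennreal"
  let ?\<omega> = "unit_ball_vol (real CARD('n))"
  have loc: "?O (frontier \<Omega> \<inter> ball y r) < top" if y: "y \<in> frontier \<Omega>" for y
  proof -
    obtain e where e: "interior_cone \<Omega> y \<rho> \<kappa> e" using cone y by (auto simp: frontier_def)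
    define M where "M = 3 / (\<kappa> * (2 * r)) * measure lebesgue (ball y (2 * (2 * r))) * 2 ^ CARD('n) / ?\<omega>"
    have "hausdorff_content ?m \<delta> (frontier \<Omega> \<inter> ball y r) \<le> ennreal (M * unit_ball_vol (real ?m))" if \<delta>: "\<delta> > 0" for \<delta>
    proof -
      define \<epsilon> where "\<epsilon> = min (\<delta> / 2) (r / 2)"
      have \<epsilon>: "\<epsilon> > 0" "2 * \<epsilon> \<le> \<delta>" "\<epsilon> < 2 * r" "\<epsilon> < r" using \<delta> r by (auto simp: \<epsilon>_def)
      let ?T = "ball y (2 * r) \<inter> {z. infdist z (frontier \<Omega>) \<le> \<epsilon>}"
      have aux: "a \<le> X * p / w" if "a * (w / p) \<le> X" "w > 0" "p > 0" for a X p w :: real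
        using that by (simp add: field_simps)
      have Tm: "?T \<in> lmeasurable"
      proof (rule fmeasurableI2[OF lmeasurable_ball])
        show "?T \<in> sets lebesgue"
          by (intro sets.Int sets_completionI_sets) (auto simp: borel_closed closed_Collect_le continuous_on_infdist)
      qed auto
      have sub: "ball a (\<epsilon>/2) \<subseteq> ?T" if "a \<in> frontier \<Omega> \<inter> ball y r" for a
      proof
        fix z assume z: "z \<in> ball a (\<epsilon>/2)"
        then have "infdist z (frontier \<Omega>) \<le> \<epsilon>"
          using that infdist_le[of a "frontier \<Omega>" z] \<epsilon> by (auto simp: dist_commute)
        moreover have "dist y z < 2 * r" using that z \<epsilon> dist_triangle[of y z a] by auto
        ultimately show "z \<in> ?T" by simp
      qed
      obtain F where F: "finite F" "F \<subseteq> frontier \<Omega> \<inter> ball y r" "frontier \<Omega> \<inter> ball y r \<subseteq> (\<Union>a\<in>F. ball a \<epsilon>)"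
        "real (card F) * measure lebesgue (ball (0::real^'n) (\<epsilon>/2)) \<le> measure lebesgue ?T"
        by (rule separated_covering[OF Tm \<epsilon>(1) sub])
      have "measure lebesgue ?T \<le> 3 * \<epsilon> / (\<kappa> * (2 * r)) * measure lebesgue (ball y (2 * (2 * r)))"
        by (rule boundary_strip_measure[OF e op fr \<kappa>(1) \<epsilon>(1,3) r(2)])
      moreover have "measure lebesgue (ball (0::real^'n) (\<epsilon>/2)) = ?\<omega> * (\<epsilon> * \<epsilon> ^ ?m) / 2 ^ CARD('n)"
      proof -
        have "\<epsilon> * \<epsilon> ^ ?m = \<epsilon> ^ CARD('n)" by (simp add: power_eq_if)
        then show ?thesis using \<epsilon> by (simp add: content_ball power_divide)
      qed
      ultimately have "real (card F) * (?\<omega> * (\<epsilon> * \<epsilon> ^ ?m) / 2 ^ CARD('n)) \<le> 3 * \<epsilon> / (\<kappa> * (2 * r)) * measure lebesgue (ball y (2 * (2 * r)))"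
        using F(4) by simp
      then have "\<epsilon> * (real (card F) * \<epsilon> ^ ?m * (?\<omega> / 2 ^ CARD('n))) \<le> \<epsilon> * (3 / (\<kappa> * (2 * r)) * measure lebesgue (ball y (2 * (2 * r))))"
        by (simp add: mult_ac)
      then have "real (card F) * \<epsilon> ^ ?m * (?\<omega> / 2 ^ CARD('n)) \<le> 3 / (\<kappa> * (2 * r)) * measure lebesgue (ball y (2 * (2 * r)))"
        using \<epsilon>(1) mult_le_cancel_left_pos by blast
      then have "real (card F) * \<epsilon> ^ ?m \<le> M"
        unfolding M_def by (rule aux) auto
      then have "real (card F) * (unit_ball_vol (real ?m) * \<epsilon> ^ ?m) \<le> M * unit_ball_vol (real ?m)"
        using mult_right_mono[of "real (card F) * \<epsilon> ^ ?m" M "unit_ball_vol (real ?m)"] by (simp add: mult_ac)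
      then show ?thesis
        using hausdorff_content_finite_cover[OF F(1,3) \<epsilon>(1,2)] by (meson ennreal_leI order_trans)
    qed
    then have "?O (frontier \<Omega> \<inter> ball y r) \<le> ennreal (M * unit_ball_vol (real ?m))"
      unfolding hausdorff_outer_def by (intro SUP_least) auto
    then show ?thesis using ennreal_less_top order_le_less_trans by blast
  qed
  have "compact (frontier \<Omega>)" using bd by (simp add: compact_frontier_bounded)
  then obtain F where F: "F \<subseteq> frontier \<Omega>" "finite F" "frontier \<Omega> \<subseteq> (\<Union>y\<in>F. ball y r)"
    by (rule compactE_image[of _ "frontier \<Omega>" "\<lambda>y. ball y r"]) (use r in \<open>force+\<close>)
  have fin: "?O (frontier \<Omega> \<inter> (\<Union>y\<in>G. ball y r)) < top" if "finite G" "G \<subseteq> F" for G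
    using that
  proof (induction G rule: finite_induct)
    case (insert a G)
    have "?O (frontier \<Omega> \<inter> (\<Union>y\<in>insert a G. ball y r)) \<le> ?O (frontier \<Omega> \<inter> ball a r) + ?O (frontier \<Omega> \<inter> (\<Union>y\<in>G. ball y r))"
      using hausdorff_outer_Un_le[of ?m "frontier \<Omega> \<inter> ball a r" "frontier \<Omega> \<inter> (\<Union>y\<in>G. ball y r)"] by (simp add: Int_Un_distrib)
    also have "\<dots> < top" using insert loc F by (auto simp: ennreal_add_less_top)
    finally show ?case .
  qed simp
  have "frontier \<Omega> \<inter> (\<Union>y\<in>F. ball y r) = frontier \<Omega>" using F by blast
  then show ?thesis using fin[of F] F by simp
qed

section \<open>Finite surface measure and traces of continuous functions\<close>

lemma finite_measure_surface_on:
  fixes \<Omega> :: "(real^'n) set"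
  assumes dom: "lipschitz_domain \<Omega>" and A: "A \<in> sets borel" "A \<subseteq> frontier \<Omega>"
  shows "finite_measure (surface_on A)"
proof
  have s: "A \<in> sets (hausdorff_measure (CARD('n) - 1))" using A borel_subset_hausdorff by blast
  have "emeasure (surface_on A) (space (surface_on A)) = hausdorff_outer (CARD('n) - 1) A"
    using s by (simp add: surface_on_def emeasure_restrict_space space_restrict_space emeasure_hausdorff_measure)
  also have "\<dots> \<le> hausdorff_outer (CARD('n) - 1) (frontier \<Omega>)" by (rule hausdorff_outer_mono[OF A(2)])
  also have "\<dots> < top" by (rule hausdorff_frontier_finite[OF dom])
  finally show "emeasure (surface_on A) (space (surface_on A)) \<noteq> \<infinity>" by simp
qed

lemma W12_norm_zero:
  assumes "open \<Omega>" shows "W12_norm \<Omega> (\<lambda>x. 0) = 0"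
proof -
  have z: "has_weak_gradient \<Omega> (\<lambda>x. 0) (\<lambda>x. 0)" by (simp add: has_weak_gradient_def)
  have "(\<integral>x. (norm (wgrad \<Omega> (\<lambda>x. 0) x))\<^sup>2 \<partial>lebesgue_on \<Omega>) = (\<integral>x. 0 \<partial>lebesgue_on \<Omega>)"
  proof (rule integral_cong_AE)
    show "AE x in lebesgue_on \<Omega>. (norm (wgrad \<Omega> (\<lambda>x. 0) x))\<^sup>2 = 0"
      using wgrad_AE_eq(2)[OF assms z] by eventually_elim simp
    have "wgrad \<Omega> (\<lambda>x. 0) \<in> borel_measurable (lebesgue_on \<Omega>)"
      by (rule has_weak_gradient_measurable(2)[OF assms wgrad_AE_eq(1)[OF assms z]])
    then show "(\<lambda>x. (norm (wgrad \<Omega> (\<lambda>x. 0) x))\<^sup>2) \<in> borel_measurable (lebesgue_on \<Omega>)" by measurable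
  qed simp
  then show ?thesis by (simp add: W12_norm_def)
qed

lemma continuous_surface_Lp:
  fixes \<Omega> :: "(real^'n) set" and w :: "real^'n \<Rightarrow> 'b::euclidean_space"
  assumes dom: "lipschitz_domain \<Omega>" and w: "continuous_on (closure \<Omega>) w" and A: "A \<in> sets borel" "A \<subseteq> frontier \<Omega>"
  shows "Lp (surface_on A) p w"
proof -
  interpret finite_measure "surface_on A" by (rule finite_measure_surface_on[OF dom A])
  have Acl: "A \<subseteq> closure \<Omega>" using A by (auto simp: frontier_def)
  have m: "w \<in> borel_measurable (surface_on A)"
    by (rule continuous_on_surface_measurable[OF continuous_on_subset[OF w Acl]])
  have "compact (closure \<Omega>)" using dom by (simp add: lipschitz_domain_def)
  then have "bounded (w ` closure \<Omega>)" by (intro compact_imp_bounded compact_continuous_image w)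
  then obtain B where B: "B > 0" "\<And>x. x \<in> closure \<Omega> \<Longrightarrow> norm (w x) \<le> B" by (auto simp: bounded_pos)
  have "integrable (surface_on A) (\<lambda>x. norm (w x) ^ p)"
  proof (rule integrable_const_bound[of _ "B ^ p"])
    show "AE x in surface_on A. norm (norm (w x) ^ p) \<le> B ^ p"
      using B Acl by (intro AE_I2) (auto intro!: power_mono)
  qed (use m in measurable)
  then show ?thesis using m by (simp add: Lp_def)
qed

text \<open>The function itself serves as a constant approximating sequence.\<close>

lemma continuous_has_trace:
  fixes \<Omega> :: "(real^'n) set"
  assumes dom: "lipschitz_domain \<Omega>" and w: "continuous_on (closure \<Omega>) w" "W1p \<Omega> 2 w"
  shows "has_trace \<Omega> w w"
proof -
  have op: "open \<Omega>" using dom by (simp add: lipschitz_domain_def)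
  have "Lp (surface_on (frontier \<Omega>)) 2 w"
    by (rule continuous_surface_Lp[OF dom w(1)]) auto
  moreover have "\<exists>\<phi> :: nat \<Rightarrow> real^'n \<Rightarrow> real^'n.
        (\<forall>m. continuous_on (closure \<Omega>) (\<phi> m) \<and> W1p \<Omega> 2 (\<phi> m)) \<and>
        (\<lambda>m. W12_norm \<Omega> (\<lambda>x. \<phi> m x - w x)) \<longlonglongrightarrow> 0 \<and>
        (\<lambda>m. \<integral>x. (norm (\<phi> m x - w x))\<^sup>2 \<partial>(surface_on (frontier \<Omega>))) \<longlonglongrightarrow> 0"
    using w by (intro exI[of _ "\<lambda>_. w"]) (simp add: W12_norm_zero[OF op])
  ultimately show ?thesis using w by (simp add: has_trace_def)
qed

section \<open>Stored-energy densities along segments\<close>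

lemma matrix_inner_sum: "(A :: real^'n^'m) \<bullet> B = (\<Sum>i\<in>UNIV. \<Sum>j\<in>UNIV. A $ i $ j * B $ i $ j)"
  by (simp add: inner_vec_def)

lemma inner_transpose: "(A :: real^'n^'m) \<bullet> transpose B = transpose A \<bullet> B"
  unfolding matrix_inner_sum by (subst sum.swap) (simp add: transpose_def)

lemma inner_matrix_mul: "((A :: real^'n^'m) ** B) \<bullet> C = B \<bullet> (transpose A ** C)"
proof -
  have "(A ** B) \<bullet> C = (\<Sum>i\<in>UNIV. \<Sum>j\<in>UNIV. \<Sum>k\<in>UNIV. A $ i $ k * B $ k $ j * C $ i $ j)"
    by (simp add: matrix_inner_sum matrix_matrix_mult_def sum_distrib_right)
  also have "\<dots> = (\<Sum>i\<in>UNIV. \<Sum>k\<in>UNIV. \<Sum>j\<in>UNIV. A $ i $ k * B $ k $ j * C $ i $ j)"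
    by (intro sum.cong refl sum.swap)
  also have "\<dots> = (\<Sum>k\<in>UNIV. \<Sum>i\<in>UNIV. \<Sum>j\<in>UNIV. A $ i $ k * B $ k $ j * C $ i $ j)"
    by (rule sum.swap)
  also have "\<dots> = (\<Sum>k\<in>UNIV. \<Sum>j\<in>UNIV. \<Sum>i\<in>UNIV. A $ i $ k * B $ k $ j * C $ i $ j)"
    by (intro sum.cong refl sum.swap)
  also have "\<dots> = B \<bullet> (transpose A ** C)"
    by (simp add: matrix_inner_sum matrix_matrix_mult_def transpose_def sum_distrib_left mult_ac)
  finally show ?thesis .
qed

text \<open>The vectors \<open>H $ i\<close> are the rows of H. In this form the lower bounds on the
  stress, which are stated for vectors, apply to the term that is quadratic in H.\<close>

lemma inner_gram: "K \<bullet> (transpose H ** H) = (\<Sum>i\<in>UNIV. H $ i \<bullet> (K *v H $ i))" for H :: "real^'n^'m"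
proof -
  have "K \<bullet> (transpose H ** H) = (\<Sum>j\<in>UNIV. \<Sum>k\<in>UNIV. \<Sum>i\<in>UNIV. K $ j $ k * (H $ i $ j * H $ i $ k))"
    by (simp add: matrix_inner_sum matrix_matrix_mult_def transpose_def sum_distrib_left)
  also have "\<dots> = (\<Sum>j\<in>UNIV. \<Sum>i\<in>UNIV. \<Sum>k\<in>UNIV. K $ j $ k * (H $ i $ j * H $ i $ k))"
    by (intro sum.cong refl sum.swap)
  also have "\<dots> = (\<Sum>i\<in>UNIV. \<Sum>j\<in>UNIV. \<Sum>k\<in>UNIV. K $ j $ k * (H $ i $ j * H $ i $ k))"
    by (rule sum.swap)
  also have "\<dots> = (\<Sum>i\<in>UNIV. H $ i \<bullet> (K *v H $ i))"
    by (simp add: inner_vec_def matrix_vector_mult_def sum_distrib_left mult_ac)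
  finally show ?thesis .
qed

lemma inner_gram_ge:
  fixes H :: "real^'n^'m"
  assumes "\<And>a. a \<bullet> (K *v a) \<ge> - c * (norm a)\<^sup>2"
  shows "K \<bullet> (transpose H ** H) \<ge> - c * (norm H)\<^sup>2"
proof -
  have "- c * (norm H)\<^sup>2 = (\<Sum>i\<in>UNIV. - c * (norm (H $ i))\<^sup>2)"
    unfolding power2_norm_eq_inner sum_distrib_left[symmetric] by (simp add: inner_vec_def[of H])
  also have "\<dots> \<le> (\<Sum>i\<in>UNIV. H $ i \<bullet> (K *v H $ i))" by (intro sum_mono assms)
  finally show ?thesis by (simp add: inner_gram)
qed

lemma transpose_add: "transpose (A + B) = transpose A + transpose B" for A B :: "real^'n^'m"
  by (simp add: transpose_def vec_eq_iff)

lemma transpose_diff: "transpose (A - B) = transpose A - transpose B" for A B :: "real^'n^'m"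
  by (simp add: transpose_def vec_eq_iff)

lemma transpose_scaleR: "transpose (c *\<^sub>R A) = c *\<^sub>R transpose A" for A :: "real^'n^'m"
  by (simp add: transpose_def vec_eq_iff)

lemma Symm_gram: "transpose F ** F \<in> Symm" for F :: "real^'n^'n"
  by (simp add: Symm_def matrix_transpose_mul transpose_transpose)

lemma Symm_diff: "A \<in> Symm \<Longrightarrow> B \<in> Symm \<Longrightarrow> A - B \<in> Symm"
  by (simp add: Symm_def transpose_diff)

lemma Symm_add: "A \<in> Symm \<Longrightarrow> B \<in> Symm \<Longrightarrow> A + B \<in> Symm"
  by (simp add: Symm_def transpose_add)

lemma Symm_scaleR: "A \<in> Symm \<Longrightarrow> c *\<^sub>R A \<in> Symm"
  by (simp add: Symm_def transpose_scaleR)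

lemma Symm_mat: "mat 1 \<in> Symm"
  by (simp add: Symm_def)

lemma matrix_add_rdistrib: "(A + B) ** C = A ** C + B ** C" for A B :: "real^'n^'m"
  by (simp add: matrix_matrix_mult_def vec_eq_iff sum.distrib distrib_right)

text \<open>E = H + H^T + H^T H. The first identity isolates the part of K : E that is linear in H,
  which equilibrium cancels; the second expresses the work of the stress at F on the displacement
  gradient H.\<close>

lemma strain_identity:
  fixes F K :: "real^'n^'n"
  assumes K: "K \<in> Symm"
  defines "H \<equiv> F - mat 1" and "E \<equiv> transpose F ** F - mat 1"
  shows "K \<bullet> E = 2 * (K \<bullet> H) + K \<bullet> (transpose H ** H)"
    and "(F ** K) \<bullet> H = (K \<bullet> E + K \<bullet> (transpose H ** H)) / 2"
proof -
  have F: "F = mat 1 + H" by (simp add: H_def)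
  have tF: "transpose F = mat 1 + transpose H" by (simp add: F transpose_add)
  have E: "E = H + transpose H + transpose H ** H"
    unfolding E_def tF by (simp add: F matrix_add_ldistrib matrix_add_rdistrib)
  have "K \<bullet> transpose H = K \<bullet> H" using K by (simp add: inner_transpose Symm_def)
  then show 1: "K \<bullet> E = 2 * (K \<bullet> H) + K \<bullet> (transpose H ** H)"
    by (simp add: E inner_add_right)
  have "(F ** K) \<bullet> H = K \<bullet> (transpose F ** H)" by (rule inner_matrix_mul)
  also have "\<dots> = K \<bullet> H + K \<bullet> (transpose H ** H)"
    unfolding tF by (simp add: matrix_add_rdistrib inner_add_right)
  finally show "(F ** K) \<bullet> H = (K \<bullet> E + K \<bullet> (transpose H ** H)) / 2" using 1 by simp
qed

text \<open>The squared norm is the trace of the Gram matrix.\<close>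

lemma norm_le_gram: "(norm F)\<^sup>2 \<le> CARD('n) * norm (transpose F ** F)" for F :: "real^'n^'m"
proof -
  have "(norm F)\<^sup>2 = (mat 1 :: real^'n^'n) \<bullet> (transpose F ** F)"
    unfolding inner_gram by (simp add: power2_norm_eq_inner inner_vec_def[of F])
  also have "\<dots> = (\<Sum>i\<in>UNIV. (transpose F ** F) $ i $ i)"
    by (simp add: matrix_inner_sum mat_def if_distrib[of "\<lambda>c. c * _"] cong: if_cong)
  also have "\<dots> \<le> (\<Sum>i\<in>(UNIV::'n set). norm (transpose F ** F))"
  proof (rule sum_mono)
    fix i
    have "(transpose F ** F) $ i $ i \<le> norm ((transpose F ** F) $ i)" using component_le_norm_cart abs_le_D1 by blast
    also have "\<dots> \<le> norm (transpose F ** F)" by (rule Finite_Cartesian_Product.norm_nth_le)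
    finally show "(transpose F ** F) $ i $ i \<le> norm (transpose F ** F)" .
  qed
  finally show ?thesis by simp
qed

lemma quadratic_gram: "a \<bullet> ((transpose F ** F) *v a) = (norm (F *v a))\<^sup>2" for F :: "real^'n^'m"
  by (metis dot_lmul_matrix inner_commute matrix_vector_mul_assoc power2_norm_eq_inner transpose_matrix_vector)

text \<open>The minimum of |F a| over a compact set of matrices with determinant bounded below and
  over unit vectors a; it is positive because these matrices are invertible. Homogeneity in a
  extends the bound to all vectors.\<close>

lemma norm_matrix_vector_ge:
  fixes X :: real
  assumes X: "X \<ge> 1"
  obtains c where "c > 0" "c \<le> 1" "\<And>(F :: real^'n^'n) a. norm F \<le> R \<Longrightarrow> det F \<ge> 1 / X \<Longrightarrow> norm (F *v a) \<ge> c * norm a"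
proof -
  \<comment> \<open>Enlarged so that the identity matrix belongs to the compact set, over which a
    minimum can then be attained.\<close>
  define R' where "R' = max R (norm (mat 1 :: real^'n^'n))"
  let ?S = "{F :: real^'n^'n. norm F \<le> R' \<and> 1 / X \<le> det F} \<times> sphere (0::real^'n) 1"
  have cdet: "continuous_on UNIV (\<lambda>F :: real^'n^'n. det F)"
    unfolding det_def by (intro continuous_intros)
  have "compact {F :: real^'n^'n. norm F \<le> R' \<and> 1 / X \<le> det F}"
  proof -
    have "{F :: real^'n^'n. norm F \<le> R' \<and> 1 / X \<le> det F} = cball 0 R' \<inter> {F. 1 / X \<le> det F}" by auto
    moreover have "closed {F :: real^'n^'n. 1 / X \<le> det F}"
      using cdet by (intro closed_Collect_le) auto
    ultimately show ?thesis by (simp add: compact_Int_closed)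
  qed
  then have cS: "compact ?S" by (intro compact_Times) auto
  obtain u :: "real^'n" where "norm u = 1" using vector_choose_size[of 1] by auto
  then have "(mat 1, u) \<in> ?S" using X by (simp add: R'_def)
  then have ne: "?S \<noteq> {}" by blast
  have "continuous_on ?S (\<lambda>p. norm (fst p *v snd p))"
    unfolding matrix_vector_mult_def by (intro continuous_intros)
  then obtain p where p: "p \<in> ?S" "\<And>q. q \<in> ?S \<Longrightarrow> norm (fst p *v snd p) \<le> norm (fst q *v snd q)"
    using continuous_attains_inf[OF cS ne] by blast
  have "fst p *v snd p \<noteq> 0"
  proof
    assume z: "fst p *v snd p = 0"
    have "0 < 1 / X" using X by simp
    also have "\<dots> \<le> det (fst p)" using p(1) by auto
    finally have "invertible (fst p)" by (simp add: invertible_det_nz)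
    then have "snd p = 0" using z by (metis invertible_def matrix_left_invertible_ker)
    then show False using p(1) by auto
  qed
  then have pos: "norm (fst p *v snd p) > 0" by simp
  define c where "c = min 1 (norm (fst p *v snd p))"
  show ?thesis
  proof
    show "c > 0" "c \<le> 1" using pos by (auto simp: c_def)
    fix F :: "real^'n^'n" and a assume F: "norm F \<le> R" "det F \<ge> 1 / X"
    show "norm (F *v a) \<ge> c * norm a"
    proof (cases "a = 0")
      case False
      let ?u = "(1 / norm a) *\<^sub>R a"
      have "(F, ?u) \<in> ?S" using F False by (simp add: R'_def)
      from p(2)[OF this] have "c \<le> norm (F *v ?u)" by (simp add: c_def)
      also have "F *v ?u = (1 / norm a) *\<^sub>R (F *v a)"
        by (simp add: matrix_vector_mult_scaleR)
      finally show ?thesis using False by (simp add: field_simps)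
    qed simp
  qed
qed

text \<open>A lower bound on |F a| is a lower bound on the quadratic form of F^T F, and such bounds
  define a convex set of symmetric matrices. Convexity keeps the segment from the identity to the
  strain inside, and compactness gives uniform bounds on the derivatives of the stored
  energy.\<close>

lemma compact_strains:
  fixes X :: real
  assumes X: "X \<ge> 1"
  obtains K :: "(real^'n^'n) set" where "compact K" "convex K" "K \<subseteq> Psym" "mat 1 \<in> K"
    "\<And>F. norm (transpose F ** F) \<le> X \<Longrightarrow> det F \<ge> 1 / X \<Longrightarrow> transpose F ** F \<in> K"
proof -
  let ?R = "sqrt (CARD('n) * X)"
  obtain c where c: "c > 0" "c \<le> 1" "\<And>(F :: real^'n^'n) a. norm F \<le> ?R \<Longrightarrow> det F \<ge> 1 / X \<Longrightarrow> norm (F *v a) \<ge> c * norm a"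
    using norm_matrix_vector_ge[OF X, of ?R] by metis
  define N where "N = max X (norm (mat 1 :: real^'n^'n))"
  define K where "K = cball 0 N \<inter> Symm \<inter> {C :: real^'n^'n. \<forall>a. c\<^sup>2 * (norm a)\<^sup>2 \<le> a \<bullet> (C *v a)}"
  show ?thesis
  proof (rule that)
    have "closed (Symm :: (real^'n^'n) set)"
      unfolding Symm_def transpose_def by (intro closed_Collect_eq continuous_intros)
    moreover have "closed {C :: real^'n^'n. \<forall>a. c\<^sup>2 * (norm a)\<^sup>2 \<le> a \<bullet> (C *v a)}"
      unfolding matrix_vector_mult_def by (intro closed_Collect_all closed_Collect_le continuous_intros)
    ultimately show "compact K" unfolding K_def Int_assoc by (intro compact_Int_closed closed_Int) auto
    show "convex K" unfolding K_def
    proof (intro convex_Int convex_cball)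
      show "convex (Symm :: (real^'n^'n) set)"
        unfolding convex_def by (auto intro: Symm_add Symm_scaleR)
      show "convex {C :: real^'n^'n. \<forall>a. c\<^sup>2 * (norm a)\<^sup>2 \<le> a \<bullet> (C *v a)}"
        unfolding convex_def
      proof clarify
        fix A B :: "real^'n^'n" and u v :: real and a :: "real^'n"
        assume A: "\<forall>a. c\<^sup>2 * (norm a)\<^sup>2 \<le> a \<bullet> (A *v a)" and B: "\<forall>a. c\<^sup>2 * (norm a)\<^sup>2 \<le> a \<bullet> (B *v a)"
          and uv: "0 \<le> u" "0 \<le> v" "u + v = 1"
        have "c\<^sup>2 * (norm a)\<^sup>2 = u * (c\<^sup>2 * (norm a)\<^sup>2) + v * (c\<^sup>2 * (norm a)\<^sup>2)"
          using uv by (metis distrib_right mult_1)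
        also have "\<dots> \<le> u * (a \<bullet> (A *v a)) + v * (a \<bullet> (B *v a))"
          using A B uv by (intro add_mono mult_left_mono) auto
        also have "\<dots> = a \<bullet> ((u *\<^sub>R A + v *\<^sub>R B) *v a)"
          by (simp add: matrix_vector_mult_add_rdistrib scaleR_matrix_vector_assoc[symmetric] inner_add_right)
        finally show "c\<^sup>2 * (norm a)\<^sup>2 \<le> a \<bullet> ((u *\<^sub>R A + v *\<^sub>R B) *v a)" .
      qed
    qed
    show "K \<subseteq> Psym"
    proof
      fix C assume C: "C \<in> K"
      have "a \<bullet> (C *v a) > 0" if "a \<noteq> 0" for a
      proof -
        have "0 < c\<^sup>2 * (norm a)\<^sup>2" using that c by simp
        also have "\<dots> \<le> a \<bullet> (C *v a)" using C by (simp add: K_def)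
        finally show ?thesis .
      qed
      then show "C \<in> Psym" using C by (simp add: Psym_def K_def)
    qed
    have "c\<^sup>2 \<le> 1" using c by (simp add: power_le_one)
    then have "c\<^sup>2 * (norm a)\<^sup>2 \<le> a \<bullet> a" for a :: "real^'n"
      unfolding power2_norm_eq_inner by (metis inner_ge_zero mult_right_mono mult_1)
    then show "mat 1 \<in> K" by (simp add: K_def N_def Symm_mat)
    fix F :: "real^'n^'n" assume F: "norm (transpose F ** F) \<le> X" "det F \<ge> 1 / X"
    have "(norm F)\<^sup>2 \<le> CARD('n) * X"
      using norm_le_gram[of F] F(1) by (meson mult_left_mono of_nat_0_le_iff order_trans)
    then have "norm F \<le> ?R" by (rule real_le_rsqrt)
    then have "(c * norm a)\<^sup>2 \<le> (norm (F *v a))\<^sup>2" for a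
      using c F by (intro power_mono) auto
    then show "transpose F ** F \<in> K"
      using F by (simp add: K_def N_def Symm_gram quadratic_gram power_mult_distrib)
  qed
qed

section \<open>Taylor expansion of the stored energy\<close>

text \<open>The definite description denotes: \<open>G0\<close> represents the derivative on all
  matrices, its symmetric part does so on \<open>Symm\<close>, and two symmetric representatives
  agree because their difference can be tested with itself.\<close>

lemma D1_gradient:
  fixes f :: "real^'n^'n \<Rightarrow> real"
  assumes "f differentiable (at C within Psym)"
  shows "D1 f C \<in> Symm" "H \<in> Symm \<Longrightarrow> frechet_derivative f (at C within Psym) H = D1 f C \<bullet> H"
proof -
  let ?D = "frechet_derivative f (at C within Psym)"
  have lin: "linear ?D"
    using assms frechet_derivative_works has_derivative_linear by blast
  define G0 where "G0 = (\<Sum>b\<in>Basis. ?D b *\<^sub>R b)"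
  have G0: "?D H = G0 \<bullet> H" for H
  proof -
    have "?D H = ?D (\<Sum>b\<in>Basis. (H \<bullet> b) *\<^sub>R b)" by (simp add: euclidean_representation)
    also have "\<dots> = (\<Sum>b\<in>Basis. (H \<bullet> b) * ?D b)" by (simp add: linear_sum[OF lin] linear_scale[OF lin])
    also have "\<dots> = G0 \<bullet> H" by (simp add: G0_def inner_sum_left inner_commute[of H] mult.commute)
    finally show ?thesis .
  qed
  let ?P = "\<lambda>G. G \<in> Symm \<and> (\<forall>H\<in>Symm. ?D H = G \<bullet> H)"
  have "?P (sym_part G0)"
  proof (intro conjI ballI)
    show "sym_part G0 \<in> Symm"
      by (simp add: sym_part_def Symm_def transpose_scaleR transpose_add transpose_transpose add.commute)
    fix H :: "real^'n^'n" assume "H \<in> Symm"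
    then have "transpose G0 \<bullet> H = G0 \<bullet> H" by (simp add: inner_transpose[symmetric] Symm_def)
    then show "?D H = sym_part G0 \<bullet> H" by (simp add: sym_part_def inner_add_left G0)
  qed
  moreover have "G = G'" if "?P G" "?P G'" for G G'
  proof -
    have "(G - G') \<bullet> (G - G') = 0"
      using that Symm_diff[of G G'] by (metis inner_diff_left right_minus_eq)
    then show ?thesis by simp
  qed
  ultimately have "\<exists>!G. ?P G" by metis
  then have "?P (D1 f C)" unfolding D1_def by (rule theI')
  then show "D1 f C \<in> Symm" "H \<in> Symm \<Longrightarrow> ?D H = D1 f C \<bullet> H" by blast+
qed

text \<open>A lower bound on \<open>k'\<close> is integrated up to \<open>k\<close>,
  \<open>h\<close> and \<open>g\<close> by monotonicity. The bound for \<open>h\<close> serves the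
  comparison of stresses, the one for \<open>g\<close> that of energies.\<close>

lemma real_taylor_lower:
  fixes g h k k' :: "real \<Rightarrow> real"
  assumes g: "\<And>t. 0 \<le> t \<Longrightarrow> t \<le> 1 \<Longrightarrow> (g has_real_derivative h t) (at t within {0..1})"
    and h: "\<And>t. 0 \<le> t \<Longrightarrow> t \<le> 1 \<Longrightarrow> (h has_real_derivative k t) (at t within {0..1})"
    and k: "\<And>t. 0 \<le> t \<Longrightarrow> t \<le> 1 \<Longrightarrow> (k has_real_derivative k' t) (at t within {0..1})"
    and b: "\<And>t. 0 \<le> t \<Longrightarrow> t \<le> 1 \<Longrightarrow> \<bar>k' t\<bar> \<le> b"
  shows "h 1 \<ge> h 0 + k 0 - b / 2" "g 1 \<ge> g 0 + h 0 + k 0 / 2 - b / 6"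
proof -
  have mono: "f 0 \<le> f t"
    if f: "\<And>s. 0 \<le> s \<Longrightarrow> s \<le> 1 \<Longrightarrow> (f has_real_derivative f' s) (at s within {0..1})"
      and f': "\<And>s. 0 < s \<Longrightarrow> s < 1 \<Longrightarrow> f' s \<ge> 0" and t: "0 \<le> t" "t \<le> 1" for f f' :: "real \<Rightarrow> real" and t
  proof (rule DERIV_nonneg_imp_increasing_open[OF t(1)])
    fix s assume s: "0 < s" "s < t"
    then show "\<exists>y. DERIV f s :> y \<and> 0 \<le> y"
      using f[of s] f'[of s] t by (auto simp: at_within_Icc_at)
  next
    have "continuous_on {0..1} f"
      using f by (intro DERIV_continuous_on) auto
    then show "continuous_on {0..t} f" by (rule continuous_on_subset) (use t in auto)
  qed
  have k1: "k t \<ge> k 0 - b * t" if t: "0 \<le> t" "t \<le> 1" for t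
  proof -
    have "k 0 + b * 0 \<le> k t + b * t"
    proof (rule mono[OF _ _ t])
      fix s :: real assume s: "0 \<le> s" "s \<le> 1"
      show "((\<lambda>s. k s + b * s) has_real_derivative k' s + b) (at s within {0..1})"
        by (rule derivative_eq_intros k[OF s] refl | simp)+
    next
      fix s :: real assume "0 < s" "s < 1"
      then show "0 \<le> k' s + b" using b[of s] by simp
    qed
    then show ?thesis by simp
  qed
  have h1: "h t \<ge> h 0 + k 0 * t - b * t\<^sup>2 / 2" if t: "0 \<le> t" "t \<le> 1" for t
  proof -
    have "h 0 - k 0 * 0 + b * 0\<^sup>2 / 2 \<le> h t - k 0 * t + b * t\<^sup>2 / 2"
    proof (rule mono[OF _ _ t])
      fix s :: real assume s: "0 \<le> s" "s \<le> 1"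
      show "((\<lambda>s. h s - k 0 * s + b * s\<^sup>2 / 2) has_real_derivative k s - k 0 + b * s) (at s within {0..1})"
        by (rule derivative_eq_intros h[OF s] refl | simp)+
    next
      fix s :: real assume "0 < s" "s < 1"
      then show "0 \<le> k s - k 0 + b * s" using k1[of s] by simp
    qed
    then show ?thesis by simp
  qed
  show "h 1 \<ge> h 0 + k 0 - b / 2" using h1[of 1] by simp
  have "g t \<ge> g 0 + h 0 * t + k 0 * t\<^sup>2 / 2 - b * t ^ 3 / 6" if t: "0 \<le> t" "t \<le> 1" for t
  proof -
    have "g 0 - h 0 * 0 - k 0 * 0\<^sup>2 / 2 + b * 0 ^ 3 / 6 \<le> g t - h 0 * t - k 0 * t\<^sup>2 / 2 + b * t ^ 3 / 6"
    proof (rule mono[OF _ _ t])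
      fix s :: real assume s: "0 \<le> s" "s \<le> 1"
      show "((\<lambda>s. g s - h 0 * s - k 0 * s\<^sup>2 / 2 + b * s ^ 3 / 6) has_real_derivative h s - h 0 - k 0 * s + b * s\<^sup>2 / 2) (at s within {0..1})"
        by (rule derivative_eq_intros g[OF s] refl | simp)+
    next
      fix s :: real assume "0 < s" "s < 1"
      then show "0 \<le> h s - h 0 - k 0 * s + b * s\<^sup>2 / 2" using h1[of s] by simp
    qed
    then show ?thesis by simp
  qed
  from this[of 1] show "g 1 \<ge> g 0 + h 0 + k 0 / 2 - b / 6" by simp
qed

text \<open>Restriction to the segment from \<open>C0\<close> to \<open>C\<close>, which convexity
  keeps in \<open>K\<close>. Derivatives are taken within \<open>Psym\<close>, where they are
  determined only on symmetric directions; \<open>E\<close> is one.\<close>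

lemma energy_taylor_lower:
  fixes f :: "real^'n^'n \<Rightarrow> real"
  assumes f: "C3_Psym f" and K: "convex K" "K \<subseteq> Psym" "C0 \<in> K" "C \<in> K"
    and B: "\<And>A H J. A \<in> K \<Longrightarrow> H \<in> Symm \<Longrightarrow> J \<in> Symm \<Longrightarrow> norm (D3 f A H J) \<le> B * norm H * norm J"
  defines "E \<equiv> C - C0"
  shows "f C \<ge> f C0 + D1 f C0 \<bullet> E + (E \<bullet> D2 f C0 E) / 2 - B * norm E ^ 3 / 6"
    and "(D1 f C - D1 f C0) \<bullet> E \<ge> E \<bullet> D2 f C0 E - B * norm E ^ 3 / 2"
proof -
  let ?\<gamma> = "\<lambda>t::real. C0 + t *\<^sub>R E"
  have E: "E \<in> Symm" using K by (auto simp: E_def Psym_def intro: Symm_diff)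
  have \<gamma>K: "?\<gamma> t \<in> K" if "0 \<le> t" "t \<le> 1" for t
  proof -
    have "(1 - t) *\<^sub>R C0 + t *\<^sub>R C \<in> K" using K that unfolding convex_alt by blast
    then show ?thesis by (simp add: E_def algebra_simps)
  qed
  have chain: "((\<lambda>t. F (?\<gamma> t)) has_derivative (\<lambda>s. s *\<^sub>R frechet_derivative F (at (?\<gamma> t) within Psym) E)) (at t within {0..1})"
    if F: "F differentiable_on Psym" and t: "0 \<le> t" "t \<le> 1" for F :: "real^'n^'n \<Rightarrow> 'c::real_normed_vector" and t
  proof -
    let ?D = "frechet_derivative F (at (?\<gamma> t) within Psym)"
    have "F differentiable (at (?\<gamma> t) within Psym)"
      using F \<gamma>K[OF t] K(2) by (auto simp: differentiable_on_def)
    then have D: "(F has_derivative ?D) (at (?\<gamma> t) within Psym)" by (simp add: frechet_derivative_works)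
    have "?\<gamma> ` {0..1} \<subseteq> Psym" using \<gamma>K K(2) by force
    note D' = has_derivative_subset[OF D this]
    have "(?\<gamma> has_derivative (\<lambda>s. s *\<^sub>R E)) (at t within {0..1})"
      by (rule derivative_eq_intros refl | simp)+
    from has_derivative_in_compose[OF this D']
    have "((\<lambda>t. F (?\<gamma> t)) has_derivative (\<lambda>s. ?D (s *\<^sub>R E))) (at t within {0..1})" .
    then show ?thesis by (simp add: linear_scale[OF has_derivative_linear[OF D]])
  qed
  have d: "f differentiable_on Psym" "D1 f differentiable_on Psym" "(\<lambda>A. D2 f A E) differentiable_on Psym"
    using f E by (auto simp: C3_Psym_def)
  have g: "((\<lambda>t. f (?\<gamma> t)) has_real_derivative D1 f (?\<gamma> t) \<bullet> E) (at t within {0..1})" if t: "0 \<le> t" "t \<le> 1" for t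
  proof -
    have "f differentiable (at (?\<gamma> t) within Psym)" using d(1) \<gamma>K[OF t] K(2) by (auto simp: differentiable_on_def)
    then show ?thesis using chain[OF d(1) t] D1_gradient(2)[OF _ E] by (simp add: has_field_derivative_def mult_commute_abs)
  qed
  have h: "((\<lambda>t. D1 f (?\<gamma> t) \<bullet> E) has_real_derivative D2 f (?\<gamma> t) E \<bullet> E) (at t within {0..1})" if t: "0 \<le> t" "t \<le> 1" for t
    using has_derivative_inner_left[OF chain[OF d(2) t], of E] by (simp add: has_field_derivative_def D2_def mult_commute_abs)
  have k: "((\<lambda>t. D2 f (?\<gamma> t) E \<bullet> E) has_real_derivative D3 f (?\<gamma> t) E E \<bullet> E) (at t within {0..1})" if t: "0 \<le> t" "t \<le> 1" for t
    using has_derivative_inner_left[OF chain[OF d(3) t], of E] by (simp add: has_field_derivative_def D3_def mult_commute_abs)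
  have b: "\<bar>D3 f (?\<gamma> t) E E \<bullet> E\<bar> \<le> B * norm E ^ 3" if t: "0 \<le> t" "t \<le> 1" for t
  proof -
    have "\<bar>D3 f (?\<gamma> t) E E \<bullet> E\<bar> \<le> norm (D3 f (?\<gamma> t) E E) * norm E" by (rule Cauchy_Schwarz_ineq2)
    also have "\<dots> \<le> (B * norm E * norm E) * norm E" using B[OF \<gamma>K[OF t] E E] by (intro mult_right_mono) auto
    finally show ?thesis by (simp add: power3_eq_cube mult_ac)
  qed
  have
    "D1 f (?\<gamma> 1) \<bullet> E \<ge> D1 f (?\<gamma> 0) \<bullet> E + D2 f (?\<gamma> 0) E \<bullet> E - B * norm E ^ 3 / 2"
    "f (?\<gamma> 1) \<ge> f (?\<gamma> 0) + D1 f (?\<gamma> 0) \<bullet> E + D2 f (?\<gamma> 0) E \<bullet> E / 2 - B * norm E ^ 3 / 6"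
    using real_taylor_lower[where g = "\<lambda>t. f (?\<gamma> t)" and h = "\<lambda>t. D1 f (?\<gamma> t) \<bullet> E" and k = "\<lambda>t. D2 f (?\<gamma> t) E \<bullet> E",
        OF g h k b] by blast+
  moreover have "?\<gamma> 1 = C" by (simp add: E_def)
  ultimately show "f C \<ge> f C0 + D1 f C0 \<bullet> E + (E \<bullet> D2 f C0 E) / 2 - B * norm E ^ 3 / 6"
    "(D1 f C - D1 f C0) \<bullet> E \<ge> E \<bullet> D2 f C0 E - B * norm E ^ 3 / 2"
    by (simp_all add: inner_commute[of E] inner_diff_left)
qed

section \<open>Lower integrals and exceptional null sets\<close>

text \<open>The stored energy need not be known to be measurable: for a non-measurable \<open>f\<close> the integral
  \<open>nn_integral\<close> is a lower integral, which is still additive with respect to an integrable \<open>g\<close>.\<close>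

lemma lower_integral_add_le:
  fixes f g F :: "'a \<Rightarrow> real"
  assumes g: "integrable M g" and F: "AE x in M. f x + g x \<le> F x" and f: "AE x in M. 0 \<le> f x"
    and fin: "(\<integral>\<^sup>+x. ennreal (f x) \<partial>M) < top"
  shows "enn2ereal (\<integral>\<^sup>+x. ennreal (f x) \<partial>M) + ereal (integral\<^sup>L M g) \<le> enn2ereal (\<integral>\<^sup>+x. ennreal (F x) \<partial>M)"
proof (cases "(\<integral>\<^sup>+x. ennreal (F x) \<partial>M) = top")
  case False
  define l where "l = enn2real (\<integral>\<^sup>+x. ennreal (F x) \<partial>M)"
  have l: "(\<integral>\<^sup>+x. ennreal (F x) \<partial>M) = ennreal l" "l \<ge> 0" using False by (auto simp: l_def less_top)
  \<comment> \<open>The lower integral of \<open>f\<close> is the supremum over the simple functions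
    \<open>s\<close> below it. Each of them is integrable, and \<open>s + g\<close> lies below
    \<open>F\<close> almost everywhere, so the additivity of the integral bounds it.\<close>
  have simple: "integral\<^sup>S M s \<le> ennreal (l - integral\<^sup>L M g) \<and> integral\<^sup>L M g \<le> l"
    if s: "simple_function M s" "s \<le> (\<lambda>x. ennreal (f x))" for s
  proof -
    define u where "u x = enn2real (s x)" for x
    have stop: "s x < top" for x using s(2) by (auto simp: le_fun_def intro: order_le_less_trans)
    have su: "s x = ennreal (u x)" for x using stop[of x] by (simp add: u_def)
    have u0: "u x \<ge> 0" for x by (simp add: u_def)
    have sm: "s \<in> borel_measurable M" using s(1) by (rule borel_measurable_simple_function)
    then have um: "u \<in> borel_measurable M" unfolding u_def[abs_def] by measurable
    have nn: "(\<integral>\<^sup>+x. ennreal (u x) \<partial>M) = integral\<^sup>S M s"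
      using nn_integral_eq_simple_integral[OF s(1)] unfolding su[symmetric] .
    have "(\<integral>\<^sup>+x. ennreal (u x) \<partial>M) \<le> (\<integral>\<^sup>+x. ennreal (f x) \<partial>M)"
      using s(2) by (intro nn_integral_mono) (simp add: su[symmetric] le_fun_def)
    then have "(\<integral>\<^sup>+x. ennreal (u x) \<partial>M) < top" using fin by (rule order_le_less_trans)
    then have ui: "integrable M u" using um u0 by (intro integrableI_nonneg) auto
    have le: "AE x in M. u x + g x \<le> F x" using F f
    proof eventually_elim
      case (elim x)
      have "ennreal (u x) \<le> ennreal (f x)" using s(2) by (simp add: su[symmetric] le_fun_def)
      then have "u x \<le> f x" using elim by (simp add: ennreal_le_iff)
      then show ?case using elim by simp
    qed
    have "ennreal (integral\<^sup>L M u + integral\<^sup>L M g) = ennreal (\<integral>x. u x + g x \<partial>M)" using ui g by simp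
    \<comment> \<open>The sum may be negative, whereas the integral in \<open>ennreal\<close> only
      sees its positive part.\<close>
    also have "\<dots> \<le> ennreal (\<integral>x. max 0 (u x + g x) \<partial>M)"
      using ui g by (intro ennreal_leI integral_mono) auto
    also have "\<dots> = (\<integral>\<^sup>+x. ennreal (max 0 (u x + g x)) \<partial>M)"
      using ui g by (intro nn_integral_eq_integral[symmetric]) auto
    also have "\<dots> \<le> (\<integral>\<^sup>+x. ennreal (F x) \<partial>M)"
    proof (rule nn_integral_mono_AE)
      show "AE x in M. ennreal (max 0 (u x + g x)) \<le> ennreal (F x)"
        using le by eventually_elim (simp add: max_def ennreal_leI)
    qed
    finally have *: "integral\<^sup>L M u + integral\<^sup>L M g \<le> l" using l by (simp add: ennreal_le_iff)
    moreover have "integral\<^sup>L M u \<ge> 0" using u0 by simp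
    moreover have "integral\<^sup>S M s = ennreal (integral\<^sup>L M u)"
      using nn nn_integral_eq_integral[OF ui] u0 by simp
    ultimately show ?thesis by (simp add: ennreal_leI)
  qed
  \<comment> \<open>The simple function 0 shows that the difference in the next bound is not
    negative, hence not truncated by \<open>ennreal\<close>.\<close>
  have gl: "integral\<^sup>L M g \<le> l" using simple[of "\<lambda>x. 0"] by (simp add: le_fun_def)
  have "(\<integral>\<^sup>+x. ennreal (f x) \<partial>M) \<le> ennreal (l - integral\<^sup>L M g)"
    unfolding nn_integral_def using simple by (intro SUP_least) auto
  then have "enn2ereal (\<integral>\<^sup>+x. ennreal (f x) \<partial>M) \<le> ereal (l - integral\<^sup>L M g)"
    using gl by (metis diff_ge_0_iff_ge enn2ereal_ennreal less_eq_ennreal.rep_eq)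
  then have "enn2ereal (\<integral>\<^sup>+x. ennreal (f x) \<partial>M) + ereal (integral\<^sup>L M g) \<le> ereal (l - integral\<^sup>L M g) + ereal (integral\<^sup>L M g)"
    by (rule add_right_mono)
  then show ?thesis using l by simp
qed simp

text \<open>The null set in the assumption depends on the vector. A countable dense set of vectors
  has a common one, and continuity in the vector extends the inequality.\<close>

lemma AE_all_quadratic_ge:
  fixes A :: "'a \<Rightarrow> real^'n^'n"
  assumes "\<And>a. AE x in M. a \<bullet> (A x *v a) \<ge> c * (norm a)\<^sup>2"
  shows "AE x in M. \<forall>a. a \<bullet> (A x *v a) \<ge> c * (norm a)\<^sup>2"
proof -
  obtain D :: "(real^'n) set" where D: "countable D" "\<And>X. open X \<Longrightarrow> X \<noteq> {} \<Longrightarrow> \<exists>d\<in>D. d \<in> X"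
    using countable_dense_setE by blast
  have clD: "closure D = UNIV"
  proof (rule ccontr)
    assume "closure D \<noteq> UNIV"
    then obtain d where "d \<in> D" "d \<in> - closure D" using D(2)[of "- closure D"] by auto
    then show False using closure_subset by auto
  qed
  have "AE x in M. \<forall>a\<in>D. a \<bullet> (A x *v a) \<ge> c * (norm a)\<^sup>2"
    using assms by (subst AE_ball_countable[OF D(1)]) auto
  then show ?thesis
  proof eventually_elim
    case (elim x)
    have "closed {a. c * (norm a)\<^sup>2 \<le> a \<bullet> (A x *v a)}"
      unfolding matrix_vector_mult_def by (intro closed_Collect_le continuous_intros)
    then have "closure D \<subseteq> {a. c * (norm a)\<^sup>2 \<le> a \<bullet> (A x *v a)}"
      using elim by (intro closure_minimal) auto
    then show ?case using clD by auto
  qed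
qed

section \<open>Comparison of energies\<close>

text \<open>The gradient of the stored energy is K/2 and its second derivative a quarter of the
  elasticity tensor, hence 1/8 in the quadratic term. With stresses K1 at I and K2 at F^T F, the
  work at I is (K1 : E - K1 : H^T H)/2 and that at F is (K2 : E + K2 : H^T H)/2; the opposite signs
  are why the sum of the two stresses appears in the second part.\<close>

lemma stored_energy_expansion:
  fixes \<sigma> :: "real^'n \<Rightarrow> real^'n^'n \<Rightarrow> real" and F :: "real^'n^'n"
  assumes f: "C3_Psym (\<sigma> x)" and K: "convex K" "K \<subseteq> Psym" "mat 1 \<in> K" "transpose F ** F \<in> K"
    and B: "\<And>A H J. A \<in> K \<Longrightarrow> H \<in> Symm \<Longrightarrow> J \<in> Symm \<Longrightarrow> norm (D3 (\<sigma> x) A H J) \<le> B * norm H * norm J"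
  defines "H \<equiv> F - mat 1" and "E \<equiv> transpose F ** F - mat 1"
  shows "\<sigma> x (transpose F ** F) \<ge> \<sigma> x (mat 1) + stress_S \<sigma> x (mat 1) \<bullet> H
      + stress_K \<sigma> x (mat 1) \<bullet> (transpose H ** H) / 2 + E \<bullet> elasticity \<sigma> x (mat 1) E / 8 - B * norm E ^ 3 / 6"
    and "stress_S \<sigma> x F \<bullet> H - stress_S \<sigma> x (mat 1) \<bullet> H \<ge> E \<bullet> elasticity \<sigma> x (mat 1) E / 4
      + (stress_K \<sigma> x (mat 1) + stress_K \<sigma> x (transpose F ** F)) \<bullet> (transpose H ** H) / 2 - B * norm E ^ 3 / 2"
proof -
  have sym: "stress_K \<sigma> x A \<in> Symm" if "A \<in> K" for A
  proof -
    have "\<sigma> x differentiable (at A within Psym)"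
      using f K(2) that unfolding C3_Psym_def differentiable_on_def by blast
    then show ?thesis unfolding stress_K_def by (intro Symm_scaleR D1_gradient(1))
  qed
  let ?C = "transpose F ** F" and ?K1 = "stress_K \<sigma> x (mat 1)" and ?K2 = "stress_K \<sigma> x (transpose F ** F)"
  have S1: "stress_S \<sigma> x (mat 1) = ?K1" by (simp add: stress_S_def)
  have S2: "stress_S \<sigma> x F = F ** ?K2" by (simp add: stress_S_def)
  have D1: "D1 (\<sigma> x) (mat 1) \<bullet> E = ?K1 \<bullet> E / 2" "(D1 (\<sigma> x) ?C - D1 (\<sigma> x) (mat 1)) \<bullet> E = (?K2 \<bullet> E - ?K1 \<bullet> E) / 2"
    by (simp_all add: stress_K_def inner_diff_left)
  have D2: "E \<bullet> D2 (\<sigma> x) (mat 1) E = E \<bullet> elasticity \<sigma> x (mat 1) E / 4"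
    by (simp add: elasticity_def)
  note id1 = strain_identity(1)[OF sym[OF K(3)], of F, folded H_def E_def]
  note id2 = strain_identity(2)[OF sym[OF K(4)], of F, folded H_def E_def]
  have T: "\<sigma> x ?C \<ge> \<sigma> x (mat 1) + D1 (\<sigma> x) (mat 1) \<bullet> E + (E \<bullet> D2 (\<sigma> x) (mat 1) E) / 2 - B * norm E ^ 3 / 6"
    "(D1 (\<sigma> x) ?C - D1 (\<sigma> x) (mat 1)) \<bullet> E \<ge> E \<bullet> D2 (\<sigma> x) (mat 1) E - B * norm E ^ 3 / 2"
    unfolding E_def by (rule energy_taylor_lower[OF f K], rule B, assumption+)+
  show "\<sigma> x ?C \<ge> \<sigma> x (mat 1) + stress_S \<sigma> x (mat 1) \<bullet> H
      + ?K1 \<bullet> (transpose H ** H) / 2 + E \<bullet> elasticity \<sigma> x (mat 1) E / 8 - B * norm E ^ 3 / 6"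
    using T(1) id1 unfolding S1 D1 D2 by argo
  show "stress_S \<sigma> x F \<bullet> H - stress_S \<sigma> x (mat 1) \<bullet> H \<ge> E \<bullet> elasticity \<sigma> x (mat 1) E / 4
      + (?K1 + ?K2) \<bullet> (transpose H ** H) / 2 - B * norm E ^ 3 / 2"
    using T(2) id1 id2 unfolding S1 S2 D1 D2 inner_add_left by argo
qed

text \<open>The average of \<open>C\<close> over the cube, shifted by \<open>c0\<close>, is an
  admissible constant, and the closed ball around the cube is the compact set in the definition of
  the seminorm.\<close>

lemma mean_osc_le_of_bmo_seminorm:
  fixes C :: "real^'n \<Rightarrow> 'b::euclidean_space"
  assumes int: "integrable lebesgue (\<lambda>x. indicator \<Omega> x *\<^sub>R (C x - c0))"
    and bmo: "bmo_seminorm \<Omega> C < ennreal \<delta>"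
  shows "mean_osc_le \<Omega> \<delta> (\<lambda>x. indicator \<Omega> x *\<^sub>R (C x - c0))"
  unfolding mean_osc_le_def
proof (intro conjI int allI impI)
  fix p :: "real^'n" and h :: real assume h: "h > 0" and adm: "cball p (CARD('n) * h) \<subseteq> \<Omega>"
  let ?Q = "cube p h"
  have \<mu>: "measure lebesgue ?Q > 0" using h by (simp add: measure_cube)
  define m where "m = (1 / measure lebesgue ?Q) *\<^sub>R (\<integral>x. C x \<partial>(lebesgue_on ?Q))"
  have QO: "?Q \<subseteq> \<Omega>" using cube_subset_cball adm by blast
  have "ennreal ((1 / measure lebesgue ?Q) * (\<integral>x. norm (C x - m) \<partial>(lebesgue_on ?Q))) \<le> bmo_seminorm \<Omega> C"
    unfolding bmo_seminorm_def Let_def m_def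
  proof (rule SUP_upper)
    show "?Q \<in> {box a b | a b. (\<exists>h>0. \<forall>i. b $ i - a $ i = h) \<and> (\<exists>K. compact K \<and> box a b \<subseteq> K \<and> K \<subseteq> \<Omega>)}"
      using h adm cube_subset_cball[of p h] unfolding cube_def
      by (intro CollectI exI conjI refl) (auto intro!: exI[of _ "2 * h"] exI[of _ "cball p (CARD('n) * h)"])
  qed
  also note bmo
  finally have "(1 / measure lebesgue ?Q) * (\<integral>x. norm (C x - m) \<partial>(lebesgue_on ?Q)) < \<delta>"
    by (subst (asm) ennreal_less_iff) (auto intro!: integral_nonneg_AE)
  then have le: "(\<integral>x. norm (C x - m) \<partial>(lebesgue_on ?Q)) \<le> \<delta> * measure lebesgue ?Q"
    using \<mu> by (simp add: field_simps)
  have "(LINT x:?Q|lebesgue. norm (indicator \<Omega> x *\<^sub>R (C x - c0) - (m - c0))) = (\<integral>x. norm (C x - m) \<partial>(lebesgue_on ?Q))"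
    unfolding set_lebesgue_integral_def
    by (subst integral_restrict_space) (use QO in \<open>auto simp: indicator_def intro!: Bochner_Integration.integral_cong\<close>)
  with le show "\<exists>c. (LINT x:?Q|lebesgue. norm (indicator \<Omega> x *\<^sub>R (C x - c0) - c)) \<le> \<delta> * measure lebesgue ?Q"
    by (intro exI[of _ "m - c0"]) (simp only:)
qed

lemma Lp_2_inner_integrable:
  assumes "Lp M 2 f" "Lp M 2 g" shows "integrable M (\<lambda>x. f x \<bullet> g x)"
proof (rule Bochner_Integration.integrable_bound)
  show "integrable M (\<lambda>x. (norm (f x))\<^sup>2 + (norm (g x))\<^sup>2)" using assms by (simp add: Lp_def)
  show "(\<lambda>x. f x \<bullet> g x) \<in> borel_measurable M" using assms by (auto simp: Lp_def)
  have "\<bar>f x \<bullet> g x\<bar> \<le> (norm (f x))\<^sup>2 + (norm (g x))\<^sup>2" for x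
    using Cauchy_Schwarz_ineq2[of "f x" "g x"] sum_squares_bound[of "norm (f x)" "norm (g x)"]
      mult_nonneg_nonneg[OF norm_ge_zero[of "f x"] norm_ge_zero[of "g x"]] by linarith
  then show "AE x in M. norm (f x \<bullet> g x) \<le> norm ((norm (f x))\<^sup>2 + (norm (g x))\<^sup>2)" by (intro AE_I2) simp
qed

lemma integrable_power_norm:
  fixes f :: "'a \<Rightarrow> 'b::euclidean_space"
  assumes "finite_measure M" "f \<in> borel_measurable M" "AE x in M. norm (f x) \<le> B"
  shows "integrable M (\<lambda>x. norm (f x) ^ p)" "integrable M f" "Lp M p f"
proof -
  interpret finite_measure M by fact
  show "integrable M f" by (rule integrable_const_bound[OF assms(3,2)])
  show 1: "integrable M (\<lambda>x. norm (f x) ^ p)"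
  proof (rule integrable_const_bound[of _ "B ^ p"])
    show "AE x in M. norm (norm (f x) ^ p) \<le> B ^ p"
      using assms(3) by eventually_elim (simp add: power_mono)
  qed (use assms(2) in measurable)
  show "Lp M p f" using 1 assms(2) by (simp add: Lp_def)
qed

lemma borel_measurable_matrix_mult:
  fixes F :: "'a \<Rightarrow> real^'n^'m" and G :: "'a \<Rightarrow> real^'k^'n"
  assumes "F \<in> borel_measurable M" "G \<in> borel_measurable M"
  shows "(\<lambda>x. F x ** G x) \<in> borel_measurable M"
proof -
  have "continuous_on UNIV (\<lambda>p :: (real^'n^'m) \<times> (real^'k^'n). fst p ** snd p)"
    unfolding matrix_matrix_mult_def by (intro continuous_intros)
  then show ?thesis
    using borel_measurable_continuous_on[of "\<lambda>p :: (real^'n^'m) \<times> (real^'k^'n). fst p ** snd p" "\<lambda>x. (F x, G x)" M] assms by simp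
qed

lemma borel_measurable_transpose:
  fixes F :: "'a \<Rightarrow> real^'n^'m"
  assumes "F \<in> borel_measurable M" shows "(\<lambda>x. transpose (F x)) \<in> borel_measurable M"
proof -
  have "continuous_on UNIV (\<lambda>p :: real^'n^'m. transpose p)"
    unfolding transpose_def by (intro continuous_intros)
  then show ?thesis using borel_measurable_continuous_on assms by blast
qed

text \<open>A continuous function that is nonzero at one point is nonzero on an open set, which is
  not null.\<close>

lemma norm_square_integral_pos:
  fixes w :: "real^'n \<Rightarrow> real^'n"
  assumes op: "open \<Omega>" and w: "continuous_on \<Omega> w" and x: "x \<in> \<Omega>" "w x \<noteq> 0"
    and int: "integrable (lebesgue_on \<Omega>) (\<lambda>x. (norm (w x))\<^sup>2)"
  shows "(\<integral>x. (norm (w x))\<^sup>2 \<partial>lebesgue_on \<Omega>) > 0"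
proof (rule ccontr)
  assume "\<not> ?thesis"
  moreover have "(\<integral>x. (norm (w x))\<^sup>2 \<partial>lebesgue_on \<Omega>) \<ge> 0" by simp
  ultimately have "(\<integral>x. (norm (w x))\<^sup>2 \<partial>lebesgue_on \<Omega>) = 0" by simp
  then have "AE x in lebesgue_on \<Omega>. (norm (w x))\<^sup>2 = 0"
    using integral_nonneg_eq_0_iff_AE[OF int] by simp
  then have "AE x in lebesgue. x \<in> \<Omega> \<longrightarrow> w x = 0"
    using op by (simp add: AE_restrict_space_iff)
  then have "AE x in lebesgue. x \<notin> \<Omega> \<inter> w -` (- {0})" by eventually_elim auto
  moreover have opN: "open (\<Omega> \<inter> w -` (- {0}))"
    by (rule continuous_open_preimage[OF w op]) auto
  ultimately have "negligible (\<Omega> \<inter> w -` (- {0}))"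
    by (simp add: negligible_iff_null_sets AE_iff_null_sets)
  then show False using open_not_negligible[OF opN] x by auto
qed

lemma W1p_bounded_gradient:
  fixes \<Omega> :: "(real^'n) set"
  assumes dom: "lipschitz_domain \<Omega>" and u: "continuous_on (closure \<Omega>) u"
    and G: "has_weak_gradient \<Omega> u G" "AE x in lebesgue_on \<Omega>. norm (G x) \<le> R"
  shows "W1p \<Omega> p u"
proof -
  have op: "open \<Omega>" and bd: "bounded \<Omega>" using dom by (auto simp: lipschitz_domain_def)
  have fm: "finite_measure (lebesgue_on \<Omega>)"
    using op bd by (intro finite_measure_lebesgue_on) (simp add: lmeasurable_open)
  have "compact (closure \<Omega>)" using bd by simp
  then have "bounded (u ` closure \<Omega>)" by (intro compact_imp_bounded compact_continuous_image u)
  then obtain B where B: "\<And>x. x \<in> closure \<Omega> \<Longrightarrow> norm (u x) \<le> B" by (auto simp: bounded_iff)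
  have "AE x in lebesgue_on \<Omega>. norm (u x) \<le> B"
    using B closure_subset by (intro AE_I2) (auto simp: space_restrict_space)
  then have "Lp (lebesgue_on \<Omega>) p u" "Lp (lebesgue_on \<Omega>) p G"
    using integrable_power_norm(3)[OF fm] has_weak_gradient_measurable[OF op G(1)] G(2) by blast+
  then show ?thesis using G(1) unfolding W1p_def by blast
qed

lemma AE_wgrad_id:
  assumes "open \<Omega>"
  shows "AE x in lebesgue_on \<Omega>. wgrad \<Omega> (\<lambda>x. x) x = mat 1"
  by (rule wgrad_AE_eq(2)[OF assms has_weak_gradient_id[OF assms]])

section \<open>Admissible deformations with bounded strain\<close>

locale bounded_deformation =
  fixes \<Omega> \<D> :: "(real^'n) set" and v :: "real^'n \<Rightarrow> real^'n" and X :: real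
  assumes dom: "lipschitz_domain \<Omega>" and DF: "\<D> \<subseteq> frontier \<Omega>"
    and v: "v \<in> AD \<Omega> \<D> (\<lambda>x. x)"
    and C_le: "AE x in lebesgue_on \<Omega>. norm (cauchy_green \<Omega> v x) \<le> X"
begin

abbreviation "G \<equiv> wgrad \<Omega> v"
abbreviation "w \<equiv> \<lambda>x. v x - x"
abbreviation "H \<equiv> \<lambda>x. G x - mat 1"
abbreviation "E \<equiv> \<lambda>x. cauchy_green \<Omega> v x - mat 1"

lemma op: "open \<Omega>" and bd: "bounded \<Omega>" and \<Omega>m: "\<Omega> \<in> lmeasurable"
  using dom by (auto simp: lipschitz_domain_def lmeasurable_open)

lemma fm: "finite_measure (lebesgue_on \<Omega>)"
  by (rule finite_measure_lebesgue_on[OF \<Omega>m])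

lemma v_cont: "continuous_on (closure \<Omega>) v" and w_cont: "continuous_on (closure \<Omega>) w"
  using v by (auto simp: AD_def intro!: continuous_intros)

lemma v_grad: "has_weak_gradient \<Omega> v G"
  using v wgrad_AE_eq(1)[OF op] by (auto simp: AD_def W1inf_def)

lemma w_grad: "has_weak_gradient \<Omega> w H"
  by (rule has_weak_gradient_diff[OF op v_grad has_weak_gradient_id[OF op]])

lemma G_measurable: "G \<in> borel_measurable (lebesgue_on \<Omega>)"
  and H_measurable: "H \<in> borel_measurable (lebesgue_on \<Omega>)"
  using has_weak_gradient_measurable(2)[OF op] v_grad w_grad by blast+

lemma E_measurable: "E \<in> borel_measurable (lebesgue_on \<Omega>)"
  unfolding cauchy_green_def
  by (intro borel_measurable_diff borel_measurable_matrix_mult borel_measurable_transpose G_measurable) simp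

lemma G_bounded: "AE x in lebesgue_on \<Omega>. norm (G x) \<le> sqrt (CARD('n) * X)"
  using C_le
proof eventually_elim
  case (elim x)
  have "(norm (G x))\<^sup>2 \<le> CARD('n) * X"
    using norm_le_gram[of "G x"] elim unfolding cauchy_green_def by (meson mult_left_mono of_nat_0_le_iff order_trans)
  then show ?case by (rule real_le_rsqrt)
qed

lemma H_bounded: "AE x in lebesgue_on \<Omega>. norm (H x) \<le> sqrt (CARD('n) * X) + norm (mat 1 :: real^'n^'n)"
  using G_bounded by eventually_elim (metis add_right_mono norm_triangle_ineq4 order_trans)

lemma E_bounded: "AE x in lebesgue_on \<Omega>. norm (E x) \<le> X + norm (mat 1 :: real^'n^'n)"
  using C_le by eventually_elim (metis add_right_mono norm_triangle_ineq4 order_trans)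

lemma W1p_v: "W1p \<Omega> p v" and W1p_w: "W1p \<Omega> p w"
  using W1p_bounded_gradient[OF dom] v_cont w_cont v_grad w_grad G_bounded H_bounded by blast+

lemma v_trace: "trace_eq_on \<Omega> \<D> v (\<lambda>x. x)"
  using continuous_has_trace[OF dom v_cont W1p_v] v
  unfolding trace_eq_on_def by (auto simp: AD_def intro!: exI[of _ v] AE_I2)

lemma w_trace: "has_trace \<Omega> w w"
  by (rule continuous_has_trace[OF dom w_cont W1p_w])

lemma w_Var: "w \<in> Var \<Omega> \<D>"
  using w_trace v W1p_w unfolding Var_def trace_eq_on_def by (auto simp: AD_def intro!: exI[of _ w] AE_I2)

lemma wgrad_w: "AE x in lebesgue_on \<Omega>. wgrad \<Omega> w x = H x"
  by (rule wgrad_AE_eq(2)[OF op w_grad])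

lemma E_Symm: "E x \<in> Symm"
  unfolding cauchy_green_def by (intro Symm_diff Symm_gram Symm_mat)

lemmas E_integrable = integrable_power_norm[OF fm E_measurable E_bounded]
lemmas H_integrable = integrable_power_norm[OF fm H_measurable H_bounded]

text \<open>Both parts of the Sobolev norm are used: the gradient part gives the first bound, and
  the other part is positive since \<open>v\<close> is continuous and differs from the identity at a
  point of the domain.\<close>

lemma strain_integral_ge:
  assumes const: "ciarlet_mardare_const \<Omega> \<D> c" and ne: "x \<in> \<Omega>" "v x \<noteq> x"
  shows "(\<integral>x. (norm (E x))\<^sup>2 \<partial>lebesgue_on \<Omega>) \<ge> c * (\<integral>x. (norm (H x))\<^sup>2 \<partial>lebesgue_on \<Omega>)"
    and "(\<integral>x. (norm (E x))\<^sup>2 \<partial>lebesgue_on \<Omega>) > 0"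
proof -
  let ?w2 = "\<integral>x. (norm (w x))\<^sup>2 \<partial>lebesgue_on \<Omega>" and ?h2 = "\<integral>x. (norm (H x))\<^sup>2 \<partial>lebesgue_on \<Omega>"
  have c: "c > 0" using const by (simp add: ciarlet_mardare_const_def)
  have "AE x in lebesgue_on \<Omega>. det (G x) > 0" using v by (simp add: AD_def)
  then have CM: "(\<integral>x. (norm (E x))\<^sup>2 \<partial>lebesgue_on \<Omega>) \<ge> c * (W12_norm \<Omega> w)\<^sup>2"
    using const W1p_v v_trace unfolding ciarlet_mardare_const_def by blast
  have "(\<integral>x. (norm (wgrad \<Omega> w x))\<^sup>2 \<partial>lebesgue_on \<Omega>) = ?h2"
  proof (rule integral_cong_AE)
    have "wgrad \<Omega> w \<in> borel_measurable (lebesgue_on \<Omega>)"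
      by (rule has_weak_gradient_measurable(2)[OF op wgrad_AE_eq(1)[OF op w_grad]])
    then show "(\<lambda>x. (norm (wgrad \<Omega> w x))\<^sup>2) \<in> borel_measurable (lebesgue_on \<Omega>)" by measurable
    show "(\<lambda>x. (norm (H x))\<^sup>2) \<in> borel_measurable (lebesgue_on \<Omega>)" using H_measurable by measurable
    show "AE x in lebesgue_on \<Omega>. (norm (wgrad \<Omega> w x))\<^sup>2 = (norm (H x))\<^sup>2" using wgrad_w by eventually_elim simp
  qed
  then have W: "(W12_norm \<Omega> w)\<^sup>2 = ?w2 + ?h2" by (simp add: W12_norm_def)
  have "?w2 > 0"
  proof (rule norm_square_integral_pos[OF op _ ne(1)])
    show "continuous_on \<Omega> w" by (rule continuous_on_subset[OF w_cont closure_subset])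
    show "integrable (lebesgue_on \<Omega>) (\<lambda>x. (norm (w x))\<^sup>2)" using W1p_w[of 2] by (simp add: W1p_def Lp_def)
  qed (use ne in simp)
  moreover have "?h2 \<ge> 0" by simp
  ultimately show "(\<integral>x. (norm (E x))\<^sup>2 \<partial>lebesgue_on \<Omega>) \<ge> c * ?h2" "(\<integral>x. (norm (E x))\<^sup>2 \<partial>lebesgue_on \<Omega>) > 0"
    using CM W c by (smt (verit) mult_left_mono, smt (verit) mult_pos_pos)
qed

text \<open>The estimate for functions on the whole space is applied to \<open>E\<close> extended by
  0. It is assumed for the bound on the strain that depends on \<open>X\<close> only, so that
  \<delta> can be fixed before \<open>v\<close>.\<close>

lemma cube_integral_le:
  assumes \<delta>: "\<And>\<psi> :: real^'n \<Rightarrow> real^'n^'n. mean_osc_le \<Omega> \<delta> \<psi> \<Longrightarrow>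
      AE x in lebesgue. norm (\<psi> x) \<le> X + norm (mat 1 :: real^'n^'n) \<Longrightarrow> norm (average \<Omega> \<psi>) \<le> \<delta> \<Longrightarrow>
      integrable lebesgue (\<lambda>x. (norm (\<psi> x))\<^sup>2) \<Longrightarrow> integrable lebesgue (\<lambda>x. norm (\<psi> x) ^ 3) \<Longrightarrow>
      (LINT x:\<Omega>|lebesgue. norm (\<psi> x) ^ 3) \<le> \<eta> * (LINT x:\<Omega>|lebesgue. (norm (\<psi> x))\<^sup>2)"
    and bmo: "bmo_seminorm \<Omega> (cauchy_green \<Omega> v)
       + ennreal (norm ((1 / measure lebesgue \<Omega>) *\<^sub>R (\<integral>x. E x \<partial>(lebesgue_on \<Omega>)))) < ennreal \<delta>"
    and X: "X \<ge> 0"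
  shows "(\<integral>x. norm (E x) ^ 3 \<partial>lebesgue_on \<Omega>) \<le> \<eta> * (\<integral>x. (norm (E x))\<^sup>2 \<partial>lebesgue_on \<Omega>)"
proof -
  define \<psi> where "\<psi> x = indicator \<Omega> x *\<^sub>R E x" for x
  have \<Omega>s: "\<Omega> \<in> sets lebesgue" using op by simp
  have conv: "integrable lebesgue (\<lambda>x. indicator \<Omega> x *\<^sub>R f x) \<longleftrightarrow> integrable (lebesgue_on \<Omega>) f"
    "integral\<^sup>L lebesgue (\<lambda>x. indicator \<Omega> x *\<^sub>R f x) = integral\<^sup>L (lebesgue_on \<Omega>) f"
    for f :: "real^'n \<Rightarrow> 'b::{banach, second_countable_topology}"
    using \<Omega>s by (simp_all add: integrable_restrict_space integral_restrict_space)
  have pow: "norm (\<psi> x) ^ p = indicator \<Omega> x *\<^sub>R norm (E x) ^ p" if "p > 0" for x p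
    using that by (simp add: \<psi>_def indicator_def)
  have LI: "(LINT x:\<Omega>|lebesgue. norm (\<psi> x) ^ p) = (\<integral>x. norm (E x) ^ p \<partial>lebesgue_on \<Omega>)" for p
    unfolding set_lebesgue_integral_def conv(2)[symmetric]
    by (intro Bochner_Integration.integral_cong) (auto simp: \<psi>_def indicator_def)
  have int: "integrable lebesgue \<psi>" unfolding \<psi>_def conv(1) by (rule E_integrable(2))
  have powint: "integrable lebesgue (\<lambda>x. norm (\<psi> x) ^ p)" if "p > 0" for p
    unfolding pow[OF that] conv(1) by (rule E_integrable(1))
  have parts: "bmo_seminorm \<Omega> (cauchy_green \<Omega> v) < ennreal \<delta>"
    "ennreal (norm ((1 / measure lebesgue \<Omega>) *\<^sub>R (\<integral>x. E x \<partial>(lebesgue_on \<Omega>)))) < ennreal \<delta>"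
    using bmo by (auto intro: order_le_less_trans[rotated] simp: add_increasing add_increasing2)
  have "mean_osc_le \<Omega> \<delta> \<psi>"
    using int parts(1) unfolding \<psi>_def by (rule mean_osc_le_of_bmo_seminorm)
  moreover have "AE x in lebesgue. norm (\<psi> x) \<le> X + norm (mat 1 :: real^'n^'n)"
  proof -
    have "AE x in lebesgue. x \<in> \<Omega> \<longrightarrow> norm (E x) \<le> X + norm (mat 1 :: real^'n^'n)"
      using E_bounded \<Omega>s by (simp add: AE_restrict_space_iff)
    then show ?thesis by eventually_elim (use X in \<open>auto simp: \<psi>_def indicator_def\<close>)
  qed
  moreover have "norm (average \<Omega> \<psi>) \<le> \<delta>"
  proof -
    have "(LINT x:\<Omega>|lebesgue. \<psi> x) = (\<integral>x. E x \<partial>lebesgue_on \<Omega>)"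
      unfolding set_lebesgue_integral_def conv(2)[symmetric]
      by (intro Bochner_Integration.integral_cong) (auto simp: \<psi>_def indicator_def)
    then show ?thesis using parts(2) unfolding average_def by (subst (asm) ennreal_less_iff) auto
  qed
  ultimately have "(LINT x:\<Omega>|lebesgue. norm (\<psi> x) ^ 3) \<le> \<eta> * (LINT x:\<Omega>|lebesgue. (norm (\<psi> x))\<^sup>2)"
    using powint by (intro \<delta>) auto
  then show ?thesis unfolding LI .
qed

end

theorem theorem6p2:
  fixes \<Omega> \<D> \<S> :: "(real^'n) set"
    and \<sigma> :: "real^'n \<Rightarrow> real^'n^'n \<Rightarrow> real"
    and b s :: "real^'n \<Rightarrow> real^'n"
    and C\<^sub>M k X :: real
  assumes dim: "CARD('n) \<in> {2, 3}"
    and dom: "lipschitz_domain \<Omega>"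
    and bdry: "boundary_partition \<Omega> \<D> \<S>"
    and body_force: "Lp (lebesgue_on \<Omega>) 2 b"
    and traction: "Lp (surface_on \<S>) 2 s"
    and density: "stored_energy_density \<Omega> \<sigma>"
    and const: "ciarlet_mardare_const \<Omega> \<D> C\<^sub>M"
    and equil: "weak_solution \<Omega> \<D> \<S> (\<lambda>x. x) \<sigma> b s (\<lambda>x. x)"
    and k: "k > 0"
    and coercive: "\<And>P. Lp (lebesgue_on \<Omega>) 2 P \<Longrightarrow> (\<forall>x\<in>\<Omega>. P x \<in> Symm) \<Longrightarrow>
          (\<integral>x. P x \<bullet> elasticity \<sigma> x (mat 1) (P x) \<partial>(lebesgue_on \<Omega>))
            \<ge> 16 * k * (\<integral>x. (norm (P x))\<^sup>2 \<partial>(lebesgue_on \<Omega>))"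
    and stress: "\<And>a. AE x in lebesgue_on \<Omega>.
          a \<bullet> (stress_K \<sigma> x (mat 1) *v a) \<ge> - 2 * k * C\<^sub>M * (norm a)\<^sup>2"
    and X: "X > sqrt (real CARD('n))"
  shows "\<exists>\<delta>>0. \<forall>v\<in>AD \<Omega> \<D> (\<lambda>x. x).
     (\<exists>x\<in>\<Omega>. v x \<noteq> x) \<and>
     bmo_seminorm \<Omega> (cauchy_green \<Omega> v)
       + ennreal (norm ((1 / measure lebesgue \<Omega>) *\<^sub>R
           (\<integral>x. cauchy_green \<Omega> v x - mat 1 \<partial>(lebesgue_on \<Omega>)))) < ennreal \<delta> \<and>
     esssup (lebesgue_on \<Omega>) (\<lambda>x. ereal (norm (cauchy_green \<Omega> v x))) < ereal X \<and>
     (AE x in lebesgue_on \<Omega>. det (wgrad \<Omega> v x) > 1 / X)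
     \<longrightarrow>
     energy \<Omega> \<S> \<sigma> b s v > energy \<Omega> \<S> \<sigma> b s (\<lambda>x. x) \<and>
     ((AE x in lebesgue_on \<Omega>. \<forall>a.
         a \<bullet> ((stress_K \<sigma> x (mat 1) + stress_K \<sigma> x (cauchy_green \<Omega> v x)) *v a)
           \<ge> - 3 * k * C\<^sub>M * (norm a)\<^sup>2)
       \<longrightarrow> \<not> weak_solution \<Omega> \<D> \<S> (\<lambda>x. x) \<sigma> b s v) \<and>
     ((AE x in lebesgue_on \<Omega>.
         (\<forall>a. a \<bullet> (stress_K \<sigma> x (mat 1) *v a) \<ge> 0) \<and>
         (\<forall>a. a \<bullet> (stress_K \<sigma> x (cauchy_green \<Omega> v x) *v a) \<ge> 0))
       \<longrightarrow> \<not> weak_solution \<Omega> \<D> \<S> (\<lambda>x. x) \<sigma> b s v)"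
proof -
  have op: "open \<Omega>" and ne: "\<Omega> \<noteq> {}" and bd: "bounded \<Omega>" using dom by (auto simp: lipschitz_domain_def)
  have fm: "finite_measure (lebesgue_on \<Omega>)"
    using op bd by (intro finite_measure_lebesgue_on) (simp add: lmeasurable_open)
  have DF: "\<D> \<subseteq> frontier \<Omega>" and SF: "\<S> \<subseteq> frontier \<Omega>" and Sb: "\<S> \<in> sets borel"
  proof -
    have o: "openin (top_of_set (frontier \<Omega>)) \<D>" "openin (top_of_set (frontier \<Omega>)) \<S>"
      using bdry by (auto simp: boundary_partition_def)
    then show "\<D> \<subseteq> frontier \<Omega>" "\<S> \<subseteq> frontier \<Omega>" using openin_imp_subset by blast+
    obtain T where "open T" "\<S> = frontier \<Omega> \<inter> T" using o(2) openin_open by metis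
    then show "\<S> \<in> sets borel" by (simp add: borel_closed)
  qed
  \<comment> \<open>Gives 1 / X \<le> 1 = det I, the condition on the determinant for the identity
    matrix.\<close>
  have X1: "X \<ge> 1"
  proof -
    have "sqrt (real CARD('n)) \<ge> 1" by (simp add: Suc_leI)
    then show ?thesis using X by linarith
  qed
  obtain K :: "(real^'n^'n) set" where K: "compact K" "convex K" "K \<subseteq> Psym" "mat 1 \<in> K"
    "\<And>F. norm (transpose F ** F) \<le> X \<Longrightarrow> det F \<ge> 1 / X \<Longrightarrow> transpose F ** F \<in> K"
    using compact_strains[OF X1] by metis
  have pos: "0 \<le> \<sigma> x C" if "x \<in> closure \<Omega>" "C \<in> Psym" for x C
    using density that by (simp add: stored_energy_density_def)
  have "\<exists>B. \<forall>x\<in>closure \<Omega>. \<forall>C\<in>K. \<bar>\<sigma> x C\<bar> \<le> B \<and>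
           (C3_Psym (\<sigma> x) \<longrightarrow> norm (D1 (\<sigma> x) C) \<le> B \<and>
              (\<forall>H\<in>Symm. norm (D2 (\<sigma> x) C H) \<le> B * norm H) \<and>
              (\<forall>H\<in>Symm. \<forall>J\<in>Symm. norm (D3 (\<sigma> x) C H J) \<le> B * norm H * norm J))"
    using density K unfolding stored_energy_density_def by blast
  then obtain B where B\<sigma>: "\<And>x C. x \<in> closure \<Omega> \<Longrightarrow> C \<in> K \<Longrightarrow> \<bar>\<sigma> x C\<bar> \<le> B"
    and BD: "\<And>x A H J. x \<in> closure \<Omega> \<Longrightarrow> C3_Psym (\<sigma> x) \<Longrightarrow> A \<in> K \<Longrightarrow> H \<in> Symm \<Longrightarrow> J \<in> Symm \<Longrightarrow>
        norm (D3 (\<sigma> x) A H J) \<le> B * norm H * norm J"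
    by metis
  have B0: "B \<ge> 0"
    using B\<sigma>[OF _ K(4)] ne closure_subset by (metis abs_ge_zero all_not_in_conv order_trans subsetD)
  \<comment> \<open>Lets the cubic remainder use up at most k times the integral of |E|^2; the added
    1 covers \<open>B\<close> = 0.\<close>
  define \<eta> where "\<eta> = k / (B + 1)"
  have \<eta>: "\<eta> > 0" "B * \<eta> \<le> k" using k B0 by (auto simp: \<eta>_def field_simps)
  have M0: "X + norm (mat 1 :: real^'n^'n) \<ge> 0" using X1 norm_ge_zero[of "mat 1 :: real^'n^'n"] by linarith
  obtain \<delta> where \<delta>: "\<delta> > 0" and small: "\<And>\<psi> :: real^'n \<Rightarrow> real^'n^'n. mean_osc_le \<Omega> \<delta> \<psi> \<Longrightarrow>
      AE x in lebesgue. norm (\<psi> x) \<le> X + norm (mat 1 :: real^'n^'n) \<Longrightarrow> norm (average \<Omega> \<psi>) \<le> \<delta> \<Longrightarrow>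
      integrable lebesgue (\<lambda>x. (norm (\<psi> x))\<^sup>2) \<Longrightarrow> integrable lebesgue (\<lambda>x. norm (\<psi> x) ^ 3) \<Longrightarrow>
      (LINT x:\<Omega>|lebesgue. norm (\<psi> x) ^ 3) \<le> \<eta> * (LINT x:\<Omega>|lebesgue. (norm (\<psi> x))\<^sup>2)"
    using cube_integral_le_small_square_integral[OF dom \<eta>(1) M0] by metis
  \<comment> \<open>A null set common to all vectors is needed, since the bound is applied to the
    rows of H, which vary with x.\<close>
  have quad: "AE x in lebesgue_on \<Omega>. \<forall>a. a \<bullet> (stress_K \<sigma> x (mat 1) *v a) \<ge> (- 2 * k * C\<^sub>M) * (norm a)\<^sup>2"
    by (rule AE_all_quadratic_ge[OF stress])
  have C\<^sub>M: "C\<^sub>M > 0" using const by (simp add: ciarlet_mardare_const_def)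
  have CG1: "AE x in lebesgue_on \<Omega>. cauchy_green \<Omega> (\<lambda>x. x) x = mat 1"
    using AE_wgrad_id[OF op] by eventually_elim (simp add: cauchy_green_def)
  have inO: "AE x in lebesgue_on \<Omega>. x \<in> \<Omega>" by (intro AE_I2) (simp add: space_restrict_space)
  have C3: "AE x in lebesgue_on \<Omega>. C3_Psym (\<sigma> x)" using density by (simp add: stored_energy_density_def)
  show ?thesis
  proof (intro exI[of _ \<delta>] conjI[OF \<delta>] ballI impI; elim conjE)
    fix v assume vAD: "v \<in> AD \<Omega> \<D> (\<lambda>x. x)" and "\<exists>x\<in>\<Omega>. v x \<noteq> x"
      and bmo: "bmo_seminorm \<Omega> (cauchy_green \<Omega> v)
       + ennreal (norm ((1 / measure lebesgue \<Omega>) *\<^sub>R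
           (\<integral>x. cauchy_green \<Omega> v x - mat 1 \<partial>(lebesgue_on \<Omega>)))) < ennreal \<delta>"
      and sup: "esssup (lebesgue_on \<Omega>) (\<lambda>x. ereal (norm (cauchy_green \<Omega> v x))) < ereal X"
      and det: "AE x in lebesgue_on \<Omega>. det (wgrad \<Omega> v x) > 1 / X"
    then obtain x0 where x0: "x0 \<in> \<Omega>" "v x0 \<noteq> x0" by blast
    have CX: "AE x in lebesgue_on \<Omega>. norm (cauchy_green \<Omega> v x) \<le> X"
      using esssup_AE[of "\<lambda>x. ereal (norm (cauchy_green \<Omega> v x))" "lebesgue_on \<Omega>"]
    proof eventually_elim
      case (elim x)
      then have "ereal (norm (cauchy_green \<Omega> v x)) < ereal X" using sup by (rule order_le_less_trans)
      then show ?case by simp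
    qed
    interpret bounded_deformation \<Omega> \<D> v X
      by (rule bounded_deformation.intro[OF dom DF vAD CX])
    define I2 where "I2 = (\<integral>x. (norm (E x))\<^sup>2 \<partial>lebesgue_on \<Omega>)"
    define I3 where "I3 = (\<integral>x. norm (E x) ^ 3 \<partial>lebesgue_on \<Omega>)"
    define Ih where "Ih = (\<integral>x. (norm (H x))\<^sup>2 \<partial>lebesgue_on \<Omega>)"
    have I2: "I2 > 0" "I2 \<ge> C\<^sub>M * Ih"
      unfolding I2_def Ih_def by (rule strain_integral_ge[OF const x0])+
    have I3: "I3 \<le> \<eta> * I2"
      unfolding I2_def I3_def
    proof (rule cube_integral_le[OF _ bmo])
      fix \<psi> :: "real^'n \<Rightarrow> real^'n^'n"
      assume \<psi>: "mean_osc_le \<Omega> \<delta> \<psi>" "AE x in lebesgue. norm (\<psi> x) \<le> X + norm (mat 1 :: real^'n^'n)"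
        "norm (average \<Omega> \<psi>) \<le> \<delta>" "integrable lebesgue (\<lambda>x. (norm (\<psi> x))\<^sup>2)" "integrable lebesgue (\<lambda>x. norm (\<psi> x) ^ 3)"
      show "(LINT x:\<Omega>|lebesgue. norm (\<psi> x) ^ 3) \<le> \<eta> * (LINT x:\<Omega>|lebesgue. (norm (\<psi> x))\<^sup>2)"
        by (rule small[OF \<psi>])
    qed (use X1 in simp)
    define r where "r x = E x \<bullet> elasticity \<sigma> x (mat 1) (E x)" for x
    have r16: "integral\<^sup>L (lebesgue_on \<Omega>) r \<ge> 16 * k * I2"
      unfolding r_def I2_def by (rule coercive[OF E_integrable(3)]) (use E_Symm in auto)
    \<comment> \<open>A function that is not integrable has Bochner integral 0, which contradicts
      the positive lower bound from coercivity.\<close>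
    have ri: "integrable (lebesgue_on \<Omega>) r"
    proof (rule ccontr)
      assume "\<not> integrable (lebesgue_on \<Omega>) r"
      then have "integral\<^sup>L (lebesgue_on \<Omega>) r = 0" by (rule not_integrable_integral_eq)
      moreover have "16 * k * I2 > 0" using k I2 by simp
      ultimately show False using r16 by linarith
    qed
    have BI3: "B * I3 \<le> k * I2"
    proof -
      have "B * I3 \<le> B * (\<eta> * I2)" by (rule mult_left_mono[OF I3 B0])
      also have "\<dots> \<le> k * I2" using mult_right_mono[OF \<eta>(2), of I2] I2 by (simp add: mult.assoc)
      finally show ?thesis .
    qed
    have kIh: "k * C\<^sub>M * Ih \<le> k * I2" using mult_left_mono[OF I2(2), of k] k by (simp add: mult.assoc)
    define q where "q x = stress_S \<sigma> x (wgrad \<Omega> (\<lambda>x. x) x) \<bullet> wgrad \<Omega> w x - b x \<bullet> w x" for x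
    have q: "integrable (lebesgue_on \<Omega>) q" "integral\<^sup>L (lebesgue_on \<Omega>) q = (\<integral>x. s x \<bullet> w x \<partial>surface_on \<S>)"
    proof -
      have "integrable (lebesgue_on \<Omega>) q \<and> integral\<^sup>L (lebesgue_on \<Omega>) q - (\<integral>x. s x \<bullet> w x \<partial>surface_on \<S>) = 0"
        using equil w_Var w_trace unfolding weak_solution_def q_def by blast
      then show "integrable (lebesgue_on \<Omega>) q" "integral\<^sup>L (lebesgue_on \<Omega>) q = (\<integral>x. s x \<bullet> w x \<partial>surface_on \<S>)" by auto
    qed
    have expand: "AE x in lebesgue_on \<Omega>. wgrad \<Omega> (\<lambda>x. x) x = mat 1 \<and> wgrad \<Omega> w x = H x \<and>
        \<sigma> x (cauchy_green \<Omega> v x) \<ge> \<sigma> x (mat 1) + stress_S \<sigma> x (mat 1) \<bullet> H x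
          + stress_K \<sigma> x (mat 1) \<bullet> (transpose (H x) ** H x) / 2 + r x / 8 - B * norm (E x) ^ 3 / 6 \<and>
        stress_S \<sigma> x (G x) \<bullet> H x - stress_S \<sigma> x (mat 1) \<bullet> H x \<ge> r x / 4
          + (stress_K \<sigma> x (mat 1) + stress_K \<sigma> x (cauchy_green \<Omega> v x)) \<bullet> (transpose (H x) ** H x) / 2
          - B * norm (E x) ^ 3 / 2"
      using inO C3 CX det AE_wgrad_id[OF op] wgrad_w
    proof eventually_elim
      case (elim x)
      have cl: "x \<in> closure \<Omega>" using elim closure_subset by blast
      have CK: "transpose (G x) ** G x \<in> K" using elim by (intro K(5)) (auto simp: cauchy_green_def)
      show ?case
        using stored_energy_expansion[of \<sigma> x K "G x" B, OF elim(2) K(2,3,4) CK BD[OF cl elim(2)]] elim(5,6)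
        unfolding r_def cauchy_green_def by blast
    qed
    have wL2: "Lp (lebesgue_on \<Omega>) 2 w" using W1p_w by (simp add: W1p_def)
    have bw: "integrable (lebesgue_on \<Omega>) (\<lambda>x. b x \<bullet> w x)" by (rule Lp_2_inner_integrable[OF body_force wL2])
    \<comment> \<open>Almost everywhere \<open>q x + b x \<bullet> w x\<close> is the linear term
      S(x, I) : H, and \<open>g\<close> bounds the difference of the stored energies from below. All
      its terms are integrable, unlike possibly the stress term quadratic in H that it replaces by
      its bound.\<close>
    define g where "g x = q x + b x \<bullet> w x - k * C\<^sub>M * (norm (H x))\<^sup>2 + r x / 8 - B / 6 * norm (E x) ^ 3" for x
    have gi: "integrable (lebesgue_on \<Omega>) g"
      unfolding g_def[abs_def] using q bw ri E_integrable(1) H_integrable(1) by simp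
    have g_int: "integral\<^sup>L (lebesgue_on \<Omega>) g = (\<integral>x. s x \<bullet> w x \<partial>surface_on \<S>) + (\<integral>x. b x \<bullet> w x \<partial>lebesgue_on \<Omega>)
        - k * C\<^sub>M * Ih + integral\<^sup>L (lebesgue_on \<Omega>) r / 8 - B / 6 * I3"
      unfolding g_def[abs_def] Ih_def I3_def q(2)[symmetric] using q(1) bw ri E_integrable(1) H_integrable(1) by simp
    have "k * I2 > 0" using k I2 by simp
    \<comment> \<open>The elasticity term contributes 16 k / 8 = 2 k, the stress term takes away k
      and the cubic term k / 6, all times \<open>I2\<close>.\<close>
    then have g_gt: "integral\<^sup>L (lebesgue_on \<Omega>) g > (\<integral>x. s x \<bullet> w x \<partial>surface_on \<S>) + (\<integral>x. b x \<bullet> w x \<partial>lebesgue_on \<Omega>)"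
      unfolding g_int using kIh BI3 r16 by linarith
    let ?L = "\<lambda>u. \<integral>\<^sup>+x. ennreal (\<sigma> x (cauchy_green \<Omega> u x)) \<partial>lebesgue_on \<Omega>"
    have Lid: "?L (\<lambda>x. x) < top"
    proof -
      have "?L (\<lambda>x. x) \<le> (\<integral>\<^sup>+x. ennreal B \<partial>lebesgue_on \<Omega>)"
      proof (rule nn_integral_mono_AE)
        show "AE x in lebesgue_on \<Omega>. ennreal (\<sigma> x (cauchy_green \<Omega> (\<lambda>x. x) x)) \<le> ennreal B"
          using CG1 inO
        proof eventually_elim
          case (elim x)
          then have "x \<in> closure \<Omega>" using closure_subset by blast
          then show ?case using B\<sigma>[OF _ K(4), of x] elim by (auto intro!: ennreal_leI)
        qed
      qed
      also have "\<dots> < top" using finite_measure.emeasure_finite[OF fm] by (simp add: ennreal_mult_less_top less_top)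
      finally show ?thesis .
    qed
    have Lv: "enn2ereal (?L (\<lambda>x. x)) + ereal (integral\<^sup>L (lebesgue_on \<Omega>) g) \<le> enn2ereal (?L v)"
    proof (rule lower_integral_add_le[OF gi _ _ Lid])
      show "AE x in lebesgue_on \<Omega>. 0 \<le> \<sigma> x (cauchy_green \<Omega> (\<lambda>x. x) x)"
        using CG1 inO
      proof eventually_elim
        case (elim x)
        then have "x \<in> closure \<Omega>" "mat 1 \<in> (Psym :: (real^'n^'n) set)" using closure_subset K by blast+
        then show ?case using pos elim by simp
      qed
      show "AE x in lebesgue_on \<Omega>. \<sigma> x (cauchy_green \<Omega> (\<lambda>x. x) x) + g x \<le> \<sigma> x (cauchy_green \<Omega> v x)"
        using CG1 expand quad
      proof eventually_elim
        case (elim x)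
        have "stress_K \<sigma> x (mat 1) \<bullet> (transpose (H x) ** H x) \<ge> - (2 * k * C\<^sub>M) * (norm (H x))\<^sup>2"
          using elim(3) by (intro inner_gram_ge) simp
        then show ?case using elim(1,2) by (simp add: g_def q_def)
      qed
    qed
    have ssplit: "(\<integral>x. s x \<bullet> w x \<partial>surface_on \<S>) = (\<integral>x. s x \<bullet> v x \<partial>surface_on \<S>) - (\<integral>x. s x \<bullet> x \<partial>surface_on \<S>)"
    proof -
      have "integrable (surface_on \<S>) (\<lambda>x. s x \<bullet> v x)" "integrable (surface_on \<S>) (\<lambda>x. s x \<bullet> x)"
        using v_cont by (auto intro!: Lp_2_inner_integrable[OF traction] continuous_surface_Lp[OF dom _ Sb SF] continuous_intros)
      then show ?thesis by (simp add: inner_diff_right)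
    qed
    have bsplit: "(\<integral>x. b x \<bullet> w x \<partial>lebesgue_on \<Omega>) = (\<integral>x. b x \<bullet> v x \<partial>lebesgue_on \<Omega>) - (\<integral>x. b x \<bullet> x \<partial>lebesgue_on \<Omega>)"
    proof -
      have bv: "integrable (lebesgue_on \<Omega>) (\<lambda>x. b x \<bullet> v x)"
        using W1p_v by (intro Lp_2_inner_integrable[OF body_force]) (simp add: W1p_def)
      have "integrable (lebesgue_on \<Omega>) (\<lambda>x. b x \<bullet> v x - b x \<bullet> w x)" by (rule Bochner_Integration.integrable_diff[OF bv bw])
      then have "integrable (lebesgue_on \<Omega>) (\<lambda>x. b x \<bullet> x)" by (simp add: inner_diff_right)
      then show ?thesis using bv by (simp add: inner_diff_right)
    qed
    have "energy \<Omega> \<S> \<sigma> b s v > energy \<Omega> \<S> \<sigma> b s (\<lambda>x. x)"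
    proof -
      \<comment> \<open>The energy of the identity is finite, whereas that of \<open>v\<close> may
        be infinite.\<close>
      obtain l where l: "?L (\<lambda>x. x) = ennreal l" "l \<ge> 0" using Lid by (cases "?L (\<lambda>x. x)") auto
      show ?thesis
        using Lv g_gt unfolding energy_def l(1) ssplit bsplit
        by (cases "enn2ereal (?L v)") (use l in auto)
    qed
    moreover have not_weak: "\<not> weak_solution \<Omega> \<D> \<S> (\<lambda>x. x) \<sigma> b s v"
      if sum: "AE x in lebesgue_on \<Omega>. \<forall>a. a \<bullet> ((stress_K \<sigma> x (mat 1) + stress_K \<sigma> x (cauchy_green \<Omega> v x)) *v a)
           \<ge> - 3 * k * C\<^sub>M * (norm a)\<^sup>2"
    proof
      assume weak: "weak_solution \<Omega> \<D> \<S> (\<lambda>x. x) \<sigma> b s v"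
      define p where "p x = stress_S \<sigma> x (G x) \<bullet> wgrad \<Omega> w x - b x \<bullet> w x" for x
      have "integrable (lebesgue_on \<Omega>) p \<and> integral\<^sup>L (lebesgue_on \<Omega>) p - (\<integral>x. s x \<bullet> w x \<partial>surface_on \<S>) = 0"
        using weak w_Var w_trace unfolding weak_solution_def p_def by blast
      \<comment> \<open>Both equilibrium equations, tested with \<open>w\<close>, contain the same
        surface load, so the integrals of \<open>p\<close> and \<open>q\<close> agree.\<close>
      then have p: "integrable (lebesgue_on \<Omega>) p" "integral\<^sup>L (lebesgue_on \<Omega>) p = integral\<^sup>L (lebesgue_on \<Omega>) q"
        using q(2) by auto
      have "(\<integral>x. r x / 4 - 3 / 2 * k * C\<^sub>M * (norm (H x))\<^sup>2 - B / 2 * norm (E x) ^ 3 \<partial>lebesgue_on \<Omega>)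
          \<le> (\<integral>x. p x - q x \<partial>lebesgue_on \<Omega>)"
      proof (rule integral_mono_AE)
        show "AE x in lebesgue_on \<Omega>. r x / 4 - 3 / 2 * k * C\<^sub>M * (norm (H x))\<^sup>2 - B / 2 * norm (E x) ^ 3 \<le> p x - q x"
          using expand sum
        proof eventually_elim
          case (elim x)
          have "(stress_K \<sigma> x (mat 1) + stress_K \<sigma> x (cauchy_green \<Omega> v x)) \<bullet> (transpose (H x) ** H x)
              \<ge> - (3 * k * C\<^sub>M) * (norm (H x))\<^sup>2"
            using elim(2) by (intro inner_gram_ge) simp
          then show ?case using elim(1) by (simp add: p_def q_def)
        qed
      qed (use p q ri E_integrable(1) H_integrable(1) in auto)
      also have "\<dots> = 0" using p q(1) by simp
      also have "(\<integral>x. r x / 4 - 3 / 2 * k * C\<^sub>M * (norm (H x))\<^sup>2 - B / 2 * norm (E x) ^ 3 \<partial>lebesgue_on \<Omega>)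
          = integral\<^sup>L (lebesgue_on \<Omega>) r / 4 - 3 / 2 * k * C\<^sub>M * Ih - B / 2 * I3"
        unfolding Ih_def I3_def using ri E_integrable(1) H_integrable(1) by simp
      \<comment> \<open>The balance is 16 k / 4 = 4 k against 3/2 k from the stresses and k / 2 from
        the cubic term, which leaves 2 k times \<open>I2\<close> > 0.\<close>
      finally show False using r16 kIh BI3 \<open>k * I2 > 0\<close> by linarith
    qed
    moreover have "\<not> weak_solution \<Omega> \<D> \<S> (\<lambda>x. x) \<sigma> b s v"
      if psd: "AE x in lebesgue_on \<Omega>. (\<forall>a. a \<bullet> (stress_K \<sigma> x (mat 1) *v a) \<ge> 0) \<and>
         (\<forall>a. a \<bullet> (stress_K \<sigma> x (cauchy_green \<Omega> v x) *v a) \<ge> 0)"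
    proof (rule not_weak)
      show "AE x in lebesgue_on \<Omega>. \<forall>a. a \<bullet> ((stress_K \<sigma> x (mat 1) + stress_K \<sigma> x (cauchy_green \<Omega> v x)) *v a)
           \<ge> - 3 * k * C\<^sub>M * (norm a)\<^sup>2"
        using psd
      proof eventually_elim
        case (elim x)
        show ?case
        proof
          fix a :: "real^'n"
          have "- 3 * k * C\<^sub>M * (norm a)\<^sup>2 \<le> 0" using k C\<^sub>M by simp
          also have "0 \<le> a \<bullet> ((stress_K \<sigma> x (mat 1) + stress_K \<sigma> x (cauchy_green \<Omega> v x)) *v a)"
            using elim by (simp add: matrix_vector_mult_add_rdistrib inner_add_right)
          finally show "- 3 * k * C\<^sub>M * (norm a)\<^sup>2 \<le> a \<bullet> ((stress_K \<sigma> x (mat 1) + stress_K \<sigma> x (cauchy_green \<Omega> v x)) *v a)" .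
        qed
      qed
    qed
    ultimately show "energy \<Omega> \<S> \<sigma> b s v > energy \<Omega> \<S> \<sigma> b s (\<lambda>x. x) \<and>
     ((AE x in lebesgue_on \<Omega>. \<forall>a.
         a \<bullet> ((stress_K \<sigma> x (mat 1) + stress_K \<sigma> x (cauchy_green \<Omega> v x)) *v a)
           \<ge> - 3 * k * C\<^sub>M * (norm a)\<^sup>2)
       \<longrightarrow> \<not> weak_solution \<Omega> \<D> \<S> (\<lambda>x. x) \<sigma> b s v) \<and>
     ((AE x in lebesgue_on \<Omega>.
         (\<forall>a. a \<bullet> (stress_K \<sigma> x (mat 1) *v a) \<ge> 0) \<and>
         (\<forall>a. a \<bullet> (stress_K \<sigma> x (cauchy_green \<Omega> v x) *v a) \<ge> 0))
       \<longrightarrow> \<not> weak_solution \<Omega> \<D> \<S> (\<lambda>x. x) \<sigma> b s v)"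
      by blast
  qed
qed

end
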